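(* Let $d\ge2$, let $t>0$ be fixed, let $A_tf(x)=\int_{S^{d-1}}f(x-ty)\,d\sigma(y)$ be the spherical averaging operator, and define $$E_f=\{x\in\mathbb{R}^d:A_tf(x)=\infty\}.$$ If $f\in L^p(\mathbb{R}^d)$, $1\le p\le2$, then $$\dim_{\mathcal H}(E_f)\le d-(p-1)(d-1).$$ If $f\in L^p(\mathbb{R}^d)$, $p\ge2$, then $$\dim_{\mathcal H}(E_f)\le1.$$
   Context: $\dim_{\mathcal H}$ denotes Hausdorff dimension, and $\sigma$ is the surface measure on the unit sphere $S^{d-1}\subset\mathbb{R}^d$. *)

theory Defs
  imports "HOL-Analysis.Analysis"
begin

text \<open>Hausdorff measure and dimension. In the library the diameter of an unbounded set is \<open>0\<close>,
  so covering sets are required to be bounded; and \<open>0 powr 0 = 0\<close>, so the case \<open>s = 0\<close>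
  (counting measure) is spelled out.\<close>

definition diam_power :: "real \<Rightarrow> 'a::metric_space set \<Rightarrow> ennreal" where
  "diam_power s U =
     (if U = {} then 0 else if s = 0 then 1 else ennreal (diameter U powr s))"

definition hausdorff_pre_measure :: "real \<Rightarrow> real \<Rightarrow> 'a::metric_space set \<Rightarrow> ennreal" where
  "hausdorff_pre_measure \<delta> s A =
     Inf {\<Sum>i. diam_power s (U i) | U :: nat \<Rightarrow> 'a set.
            A \<subseteq> (\<Union>i. U i) \<and> (\<forall>i. bounded (U i) \<and> diameter (U i) \<le> \<delta>)}"

definition hausdorff_outer_measure :: "real \<Rightarrow> 'a::metric_space set \<Rightarrow> ennreal" where
  "hausdorff_outer_measure s A = (SUP \<delta>\<in>{0<..}. hausdorff_pre_measure \<delta> s A)"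

definition hausdorff_dim :: "'a::metric_space set \<Rightarrow> ereal" where
  "hausdorff_dim A = Inf {ereal s | s. 0 \<le> s \<and> hausdorff_outer_measure s A = 0}"

text \<open>Surface measure on the unit sphere by polar coordinates: \<open>d\<close> times the image of Lebesgue
  measure on the punctured unit ball under \<open>x \<mapsto> x / \<bar>x\<bar>\<close>; see \<open>emeasure_sphere_measure\<close>.\<close>

definition sphere_measure :: "'a::euclidean_space measure" where
  "sphere_measure =
     scale_measure (of_nat DIM('a))
       (distr (restrict_space lborel (ball 0 1 - {0})) (restrict_space borel (sphere 0 1)) sgn)"

lemma sgn_measurable_sphere:
  "sgn \<in> restrict_space lborel (ball 0 1 - {0::'a::euclidean_space})
           \<rightarrow>\<^sub>M restrict_space borel (sphere 0 1)"
proof (rule measurable_restrict_space2)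
  show "sgn \<in> space (restrict_space lborel (ball 0 1 - {0::'a})) \<rightarrow> sphere 0 1"
    by (auto simp: space_restrict_space norm_sgn)
  have "(\<lambda>x::'a. x /\<^sub>R norm x) \<in> borel_measurable borel"
    by measurable
  then have "(sgn :: 'a \<Rightarrow> 'a) \<in> borel_measurable borel"
    by (simp add: sgn_div_norm[abs_def])
  then show "sgn \<in> borel_measurable (restrict_space lborel (ball 0 1 - {0::'a}))"
    by (intro measurable_restrict_space1) simp
qed

lemma emeasure_sphere_measure:
  assumes "B \<in> sets borel" "B \<subseteq> sphere 0 1"
  shows "emeasure sphere_measure B =
           of_nat DIM('a) * emeasure lborel {r *\<^sub>R y | r y. 0 < r \<and> r < 1 \<and> y \<in> (B :: 'a::euclidean_space set)}"
proof -
  let ?M = "restrict_space lborel (ball 0 1 - {0::'a})"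
  have B: "B \<in> sets (restrict_space borel (sphere 0 1))"
    using assms by (auto simp: sets_restrict_space)
  have eq: "sgn -` B \<inter> space ?M = {r *\<^sub>R y | r y. 0 < r \<and> r < 1 \<and> y \<in> B}" (is "?L = ?R")
  proof (intro set_eqI iffI)
    fix x assume "x \<in> ?L"
    then have "x = norm x *\<^sub>R sgn x" "0 < norm x" "norm x < 1" "sgn x \<in> B"
      by (auto simp: space_restrict_space sgn_div_norm)
    then show "x \<in> ?R" by blast
  next
    fix x assume "x \<in> ?R"
    then obtain r y where x: "x = r *\<^sub>R y" "0 < r" "r < 1" "y \<in> B" by blast
    moreover from x assms have "norm y = 1" by auto
    ultimately show "x \<in> ?L"
      by (auto simp: space_restrict_space sgn_div_norm)
  qed
  have "emeasure ?M ?R = emeasure lborel ?R"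
    unfolding eq[symmetric]
    by (rule emeasure_restrict_space) (auto simp: space_restrict_space)
  then show ?thesis
    using emeasure_distr[OF sgn_measurable_sphere B] eq
    by (simp add: sphere_measure_def)
qed

text \<open>The spherical average as an extended-real Lebesgue integral, positive part minus negative
  part. In \<^typ>\<open>ereal\<close> we have \<open>\<infinity> - \<infinity> = \<infinity>\<close>, so the value is \<open>\<infinity>\<close> exactly when the integral of the
  positive part is infinite.\<close>

definition sphere_average :: "real \<Rightarrow> ('a::euclidean_space \<Rightarrow> real) \<Rightarrow> 'a \<Rightarrow> ereal" where
  "sphere_average t f x =
     enn2ereal (\<integral>\<^sup>+ y. ennreal (f (x - t *\<^sub>R y)) \<partial>sphere_measure)
     - enn2ereal (\<integral>\<^sup>+ y. ennreal (- f (x - t *\<^sub>R y)) \<partial>sphere_measure)"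

definition infinity_set :: "real \<Rightarrow> ('a::euclidean_space \<Rightarrow> real) \<Rightarrow> 'a set" where
  "infinity_set t f = {x. sphere_average t f x = \<infinity>}"

definition in_Lp :: "ereal \<Rightarrow> 'a measure \<Rightarrow> ('a \<Rightarrow> real) \<Rightarrow> bool" where
  "in_Lp p M f \<longleftrightarrow> f \<in> borel_measurable M \<and>
     (if p = \<infinity> then \<exists>C. AE x in M. \<bar>f x\<bar> \<le> C
      else (\<integral>\<^sup>+ x. ennreal (\<bar>f x\<bar> powr real_of_ereal p) \<partial>M) < \<infinity>)"

lemma sphere_average_eq_infinity_iff:
  "sphere_average t f x = \<infinity> \<longleftrightarrow> (\<integral>\<^sup>+ y. ennreal (f (x - t *\<^sub>R y)) \<partial>sphere_measure) = \<infinity>"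
proof -
  have *: "enn2ereal a - enn2ereal b = \<infinity> \<longleftrightarrow> a = \<infinity>" for a b
    by (cases a; cases b) (auto simp: ennreal.rep_eq enn2ereal_ennreal)
  show ?thesis unfolding sphere_average_def * ..
qed

lemma sphere_average_eq_integral:
  assumes "integrable sphere_measure (\<lambda>y. f (x - t *\<^sub>R y))"
  shows "sphere_average t f x = ereal (\<integral>y. f (x - t *\<^sub>R y) \<partial>sphere_measure)"
proof -
  let ?g = "\<lambda>y. f (x - t *\<^sub>R y)"
  have 1: "(\<integral>\<^sup>+ y. ennreal (?g y) \<partial>sphere_measure) \<noteq> \<infinity>"
    "(\<integral>\<^sup>+ y. ennreal (- ?g y) \<partial>sphere_measure) \<noteq> \<infinity>"
    using assms by (auto simp: real_integrable_def)
  then show ?thesis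
    unfolding sphere_average_def real_lebesgue_integral_def[OF assms]
    by (cases "\<integral>\<^sup>+ y. ennreal (?g y) \<partial>sphere_measure";
        cases "\<integral>\<^sup>+ y. ennreal (- ?g y) \<partial>sphere_measure") (auto simp: enn2ereal_ennreal)
qed

end

theory Submission imports Defs begin

text \<open>Let \<open>h \<ge> 0\<close> be a lower semicontinuous majorant of the positive part of \<open>f\<close> near a ball of radius
  \<open>t/4\<close>, still locally in \<open>L\<^sup>p\<close>. Averages of \<open>h\<close> over the shells \<open>0 \<le> |y - x|\<^sup>2 - t\<^sup>2 \<le> 2\<^sup>-\<^sup>j\<close>
  tend to infinity at every \<open>x\<close> with \<open>A\<^sub>t f(x) = \<infinity>\<close>. A fixed linear combination over consecutive
  \<open>j\<close> of these averages, whose kernel has \<open>d + 1\<close> vanishing moments in the variable \<open>|y - x|\<^sup>2 - t\<^sup>2\<close>,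
  can therefore not be bounded by \<open>1/(j+1)\<^sup>2\<close> for all large \<open>j\<close>.

  The points of a \<open>2\<^sup>-\<^sup>j\<close>-separated set where such a combination is large are counted by duality.
  In coordinates given by the distances to two centres at distance \<open>r\<close>, Lebesgue measure has a
  density that is smooth at scale \<open>r\<close>, so the moments make the kernels of the two centres almost
  orthogonal, with correlation \<open>2\<^sup>j (1 + 2\<^sup>j r)\<^sup>-\<^sup>d\<^sup>-\<^sup>2\<close>. This gives an \<open>L\<^sup>2\<close> bound with factor
  \<open>2\<^sup>j\<close>; the trivial \<open>L\<^sup>1\<close> bound has factor \<open>2\<^sup>j\<^sup>d\<close>. Splitting \<open>h\<close> at height \<open>2\<^sup>j\<^sup>(\<^sup>d\<^sup>-\<^sup>1\<^sup>)\<close>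
  leaves at most a polynomial in \<open>j\<close> times \<open>2\<^sup>j\<^sup>s\<close> points with \<open>s = d - (p - 1)(d - 1)\<close>, hence covers of
  the exceptional set with arbitrarily small \<open>s'\<close>-dimensional content for each \<open>s' > s\<close>. For \<open>p \<ge> 2\<close>
  the function is locally in \<open>L\<^sup>2\<close>.\<close>

subsection \<open>Hausdorff content\<close>

text \<open>\<open>f\<close> is a fixed representative, and changing it on a null set can change
  \<open>A_t f\<close>, since single spheres are null. A majorant valid at every point, averaged
  over solid shells, replaces integrals over null sets by Lebesgue integrals that norms control.
  Cancellation is what makes duality work. Two shells of thickness 2^-j whose centres have distance
  r overlap in volume about 4^-j / r, so their normalised indicators correlate like 2^j / (2^j r).
  Summed over a 2^-j-separated set this loses a power of 2^j, whereas the decay gained from the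
  moments is summable. The price is that only combinations of averages are controlled. It is
  harmless: combinations summable in j cannot produce unbounded averages, and asking for no more
  than 1/(j+1)^2 costs a polynomial in j, which the dimension does not see. Centres within t/4 of a
  common point have distance less than t/2. This keeps the two spheres away from external tangency,
  where the weight in the two-centre coordinates may lose smoothness.\<close>

definition content_null :: "real \<Rightarrow> 'a::metric_space set \<Rightarrow> bool" where
  "content_null s A \<longleftrightarrow> (\<forall>\<epsilon>>0. \<exists>U :: nat \<Rightarrow> 'a set.
     A \<subseteq> (\<Union>i. U i) \<and> (\<forall>i. bounded (U i)) \<and> (\<Sum>i. diam_power s (U i)) \<le> ennreal \<epsilon>)"

text \<open>A cover of small total size consists of sets of small diameter, so vanishing content suffices.\<close>

lemma hausdorff_outer_measure_eq_0:
  assumes "s > 0" "content_null s A"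
  shows "hausdorff_outer_measure s A = 0"
proof -
  have pre: "hausdorff_pre_measure \<delta> s A \<le> ennreal \<epsilon>" if "\<delta> > 0" "\<epsilon> > 0" for \<delta> \<epsilon>
  proof -
    define e where "e = min \<epsilon> (\<delta> powr s)"
    have e: "e > 0" "e \<le> \<epsilon>" "e \<le> \<delta> powr s" using that by (auto simp: e_def)
    from assms(2) e(1) obtain U :: "nat \<Rightarrow> 'a set" where
      U: "A \<subseteq> (\<Union>i. U i)" "\<And>i. bounded (U i)" "(\<Sum>i. diam_power s (U i)) \<le> ennreal e"
      unfolding content_null_def by blast
    have "diameter (U i) \<le> \<delta>" for i
    proof (cases "U i = {}")
      case False
      have "diam_power s (U i) \<le> (\<Sum>i. diam_power s (U i))"
        using sum_le_suminf[of "\<lambda>i. diam_power s (U i)" "{i}"] by auto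
      also have "\<dots> \<le> ennreal e" by (fact U)
      finally have "ennreal (diameter (U i) powr s) \<le> ennreal e"
        using False assms(1) by (simp add: diam_power_def)
      then have "diameter (U i) powr s \<le> \<delta> powr s" using e by (simp add: ennreal_le_iff)
      then show ?thesis
        using assms(1) that by (meson not_less powr_less_mono2 diameter_ge_0 U(2) less_imp_le)
    qed (use that in \<open>auto simp: diameter_def\<close>)
    then have "hausdorff_pre_measure \<delta> s A \<le> (\<Sum>i. diam_power s (U i))"
      unfolding hausdorff_pre_measure_def by (intro Inf_lower) (use U in blast)
    also have "\<dots> \<le> ennreal \<epsilon>" using U(3) e by (meson ennreal_leI order_trans)
    finally show ?thesis .
  qed
  have "hausdorff_pre_measure \<delta> s A \<le> 0" if "\<delta> > 0" for \<delta>
  proof (rule ennreal_le_epsilon)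
    fix e :: real assume "0 < e"
    then show "hausdorff_pre_measure \<delta> s A \<le> 0 + ennreal e"
      using pre[OF that] by simp
  qed
  then have "hausdorff_outer_measure s A \<le> 0"
    unfolding hausdorff_outer_measure_def by (intro SUP_least) simp
  then show ?thesis by simp
qed

lemma content_null_UN:
  assumes "\<And>n::nat. content_null s (A n)"
  shows "content_null s (\<Union>n. A n)"
  unfolding content_null_def
proof (intro allI impI)
  fix \<epsilon> :: real assume "\<epsilon> > 0"
  have "\<forall>n. \<exists>U :: nat \<Rightarrow> 'a set. A n \<subseteq> (\<Union>i. U i) \<and> (\<forall>i. bounded (U i)) \<and>
          (\<Sum>i. diam_power s (U i)) \<le> ennreal (\<epsilon> * (1/2)^Suc n)"
    using assms \<open>\<epsilon> > 0\<close> unfolding content_null_def by simp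
  then obtain U :: "nat \<Rightarrow> nat \<Rightarrow> 'a set" where U: "\<And>n. A n \<subseteq> (\<Union>i. U n i)"
    "\<And>n i. bounded (U n i)" "\<And>n. (\<Sum>i. diam_power s (U n i)) \<le> ennreal (\<epsilon> * (1/2)^Suc n)"
    by metis
  let ?V = "\<lambda>k. case prod_decode k of (n, i) \<Rightarrow> U n i"
  have "(\<Sum>k. diam_power s (?V k)) = (\<Sum>k. (\<lambda>(n, i). diam_power s (U n i)) (prod_decode k))"
    by (intro suminf_cong) (auto split: prod.split)
  also have "\<dots> = (\<Sum>n. \<Sum>i. diam_power s (U n i))"
    by (intro suminf_ennreal_2dimen) simp
  also have "\<dots> \<le> (\<Sum>n. ennreal (\<epsilon> * (1/2)^Suc n))"
    by (intro suminf_le U(3)) auto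
  also have "\<dots> = ennreal \<epsilon>"
    using \<open>\<epsilon> > 0\<close> sums_mult[OF power_half_series, of \<epsilon>] by (intro suminf_ennreal_eq) auto
  finally have "(\<Sum>k. diam_power s (?V k)) \<le> ennreal \<epsilon>" .
  moreover have "(\<Union>n. A n) \<subseteq> (\<Union>k. ?V k)"
  proof (intro subsetI)
    fix x assume "x \<in> (\<Union>n. A n)"
    then obtain n i where "x \<in> U n i" using U(1) by blast
    then have "x \<in> ?V (prod_encode (n, i))" by simp
    then show "x \<in> (\<Union>k. ?V k)" by (rule UN_I[OF UNIV_I])
  qed
  ultimately show "\<exists>V :: nat \<Rightarrow> 'a set. (\<Union>n. A n) \<subseteq> (\<Union>i. V i) \<and> (\<forall>i. bounded (V i)) \<and>
      (\<Sum>i. diam_power s (V i)) \<le> ennreal \<epsilon>"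
    using U(2) by (intro exI[of _ ?V] conjI allI) (simp_all split: prod.split)
qed

text \<open>The convergence half of a Borel-Cantelli argument: every tail of the families covers
  \<open>A\<close>, and the tails of a convergent series of sizes are arbitrarily small.\<close>

lemma content_null_limsup_cballs:
  fixes P :: "nat \<Rightarrow> 'a::real_normed_vector set"
  assumes "s > 0" "\<And>j. finite (P j)" "\<And>j. r j \<ge> 0"
    and summ: "summable (\<lambda>j. real (card (P j)) * (2 * r j) powr s)"
    and cover: "\<And>J. A \<subseteq> (\<Union>j\<in>{J..}. \<Union>x\<in>P j. cball x (r j))"
  shows "content_null s A"
  unfolding content_null_def
proof (intro allI impI)
  fix \<epsilon> :: real assume "\<epsilon> > 0"
  let ?c = "\<lambda>j. real (card (P j)) * (2 * r j) powr s"
  obtain J where J: "norm (\<Sum>j. ?c (j + J)) < \<epsilon>"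
    using suminf_exist_split[OF \<open>\<epsilon> > 0\<close> summ] by blast
  have summJ: "summable (\<lambda>j. ?c (j + J))" using summ by (rule summable_ignore_initial_segment)
  have "\<exists>g. \<forall>j. P j = g j ` {..<card (P j)}"
    by (intro choice allI) (metis assms(2) ex_bij_betw_nat_finite atLeast0LessThan bij_betw_def)
  then obtain g where g: "\<And>j. P j = g j ` {..<card (P j)}" by blast
  \<comment> \<open>Empty sets fill up each finite family to a sequence; they cost nothing because
    \<open>diam_power s {}\<close> is 0.\<close>
  define V where "V = (\<lambda>j i. if i < card (P (j + J)) then cball (g (j + J) i) (r (j + J)) else {})"
  have bV: "bounded (V j i)" for j i by (simp add: V_def)
  have dV: "diam_power s (V j i) \<le> (if i < card (P (j + J)) then ennreal ((2 * r (j + J)) powr s) else 0)" for j i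
  proof (cases "i < card (P (j + J))")
    case True
    have "diameter (V j i) \<le> 2 * r (j + J)"
    proof (rule diameter_le)
      show "V j i \<noteq> {} \<or> 0 \<le> 2 * r (j + J)" using assms(3) by auto
    next
      fix x y assume "x \<in> V j i" "y \<in> V j i"
      then show "norm (x - y) \<le> 2 * r (j + J)"
        using dist_triangle3[of x y "g (j + J) i"] True by (auto simp: V_def simp flip: dist_norm)
    qed
    then show ?thesis using True assms(1,3) bV
      by (auto simp: diam_power_def intro!: ennreal_leI powr_mono2 diameter_ge_0)
  qed (simp add: V_def diam_power_def)
  let ?W = "\<lambda>k. case prod_decode k of (n, i) \<Rightarrow> V n i"
  have "(\<Sum>k. diam_power s (?W k)) = (\<Sum>k. (\<lambda>(n, i). diam_power s (V n i)) (prod_decode k))"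
    by (intro suminf_cong) (auto split: prod.split)
  also have "\<dots> = (\<Sum>j. \<Sum>i. diam_power s (V j i))"
    by (intro suminf_ennreal_2dimen) simp
  also have "\<dots> \<le> (\<Sum>j. ennreal (?c (j + J)))"
  proof (intro suminf_le)
    fix j
    have "(\<Sum>i. diam_power s (V j i)) \<le> (\<Sum>i. if i < card (P (j + J)) then ennreal ((2 * r (j + J)) powr s) else 0)"
      by (intro suminf_le dV) auto
    also have "\<dots> = (\<Sum>i<card (P (j + J)). ennreal ((2 * r (j + J)) powr s))"
      by (subst suminf_finite[of "{..<card (P (j + J))}"]) auto
    also have "\<dots> = ennreal (?c (j + J))"
      by (simp add: ennreal_mult ennreal_of_nat_eq_real_of_nat)
    finally show "(\<Sum>i. diam_power s (V j i)) \<le> ennreal (?c (j + J))" .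
  qed auto
  also have "\<dots> = ennreal (\<Sum>j. ?c (j + J))"
    using summJ by (intro suminf_ennreal2) auto
  also have "\<dots> \<le> ennreal \<epsilon>" using J by (intro ennreal_leI) auto
  finally have "(\<Sum>k. diam_power s (?W k)) \<le> ennreal \<epsilon>" .
  moreover have "A \<subseteq> (\<Union>k. ?W k)"
  proof (intro subsetI)
    fix x assume "x \<in> A"
    then obtain j y where "j \<ge> J" "y \<in> P j" "x \<in> cball y (r j)" using cover[of J] by blast
    moreover from this obtain i where "i < card (P j)" "y = g j i" using g by blast
    ultimately have "x \<in> V (j - J) i" by (simp add: V_def)
    then have "x \<in> ?W (prod_encode (j - J, i))" by simp
    then show "x \<in> (\<Union>k. ?W k)" by (rule UN_I[OF UNIV_I])
  qed
  ultimately show "\<exists>V :: nat \<Rightarrow> 'a set. A \<subseteq> (\<Union>i. V i) \<and> (\<forall>i. bounded (V i)) \<and>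
      (\<Sum>i. diam_power s (V i)) \<le> ennreal \<epsilon>"
    using bV by (intro exI[of _ ?W] conjI allI) (simp_all split: prod.split)
qed

text \<open>A partial sum \<open>S\<close> of the \<open>|a j|\<close> satisfies
  \<open>S \<le> |a 0| + E + \<rho> * S\<close> with \<open>E\<close> the sum of the given series,
  and \<open>\<rho> < 1\<close> lets \<open>S\<close> be solved for. This serves to undo a step of
  the recursion that defines the kernels.\<close>

lemma summable_of_summable_recurrence:
  fixes a :: "nat \<Rightarrow> real"
  assumes "0 \<le> \<rho>" "\<rho> < 1" and summ: "summable (\<lambda>j. \<bar>a (Suc j) - \<rho> * a j\<bar>)"
  shows "summable (\<lambda>j. \<bar>a j\<bar>)"
proof (rule bounded_imp_summable)
  fix n
  let ?e = "\<lambda>j. \<bar>a (Suc j) - \<rho> * a j\<bar>"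
  have "(\<Sum>j\<le>n. \<bar>a j\<bar>) \<le> (\<Sum>j\<le>Suc n. \<bar>a j\<bar>)" by simp
  also have "\<dots> = \<bar>a 0\<bar> + (\<Sum>j\<le>n. \<bar>a (Suc j)\<bar>)" by (subst sum.atMost_Suc_shift) simp
  also have "\<dots> \<le> \<bar>a 0\<bar> + (\<Sum>j\<le>n. ?e j + \<rho> * \<bar>a j\<bar>)"
  proof (intro add_left_mono sum_mono)
    fix j
    have "\<bar>a (Suc j)\<bar> \<le> ?e j + \<bar>\<rho> * a j\<bar>" by linarith
    then show "\<bar>a (Suc j)\<bar> \<le> ?e j + \<rho> * \<bar>a j\<bar>" using assms(1) by (simp add: abs_mult)
  qed
  also have "\<dots> = \<bar>a 0\<bar> + (\<Sum>j\<le>n. ?e j) + \<rho> * (\<Sum>j\<le>n. \<bar>a j\<bar>)"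
    by (simp add: sum.distrib sum_distrib_left)
  also have "(\<Sum>j\<le>n. ?e j) \<le> suminf ?e" using summ by (intro sum_le_suminf) auto
  finally have "(1 - \<rho>) * (\<Sum>j\<le>n. \<bar>a j\<bar>) \<le> \<bar>a 0\<bar> + suminf ?e"
    by (simp add: algebra_simps)
  then show "(\<Sum>j\<le>n. \<bar>a j\<bar>) \<le> (\<bar>a 0\<bar> + suminf ?e) / (1 - \<rho>)"
    using assms by (simp add: field_simps)
qed simp

subsection \<open>Radial kernels with vanishing moments\<close>

text \<open>The \<open>n\<close>-th moment of \<open>kern m j\<close> is proportional to \<open>2 powr (- j n)\<close>, so step \<open>m\<close> of the recursion
  annihilates the \<open>m\<close>-th moment.\<close>

fun kern :: "nat \<Rightarrow> nat \<Rightarrow> real \<Rightarrow> real" where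
  "kern 0 j q = 2^j * indicator {0..1/2^j} q"
| "kern (Suc m) j q = kern m (Suc j) q - kern m j q / 2^m"

lemma kern_measurable [measurable]: "kern m j \<in> borel_measurable borel"
proof (induction m arbitrary: j)
  case 0
  have "kern 0 j = (\<lambda>q. 2^j * indicator {0..1/2^j} q)" by auto
  then show ?case by simp
next
  case (Suc m)
  have "kern (Suc m) j = (\<lambda>q. kern m (Suc j) q - kern m j q / 2^m)" by auto
  then show ?case using Suc by simp
qed

lemma kern_eq_0: "q \<notin> {0..1/2^j} \<Longrightarrow> kern m j q = 0"
proof (induction m arbitrary: j)
  case (Suc m)
  have "(1::real) / 2^Suc j \<le> 1 / 2^j" by (simp add: field_simps)
  then have "q \<notin> {0..1/2^Suc j}" using Suc.prems by auto
  then show ?case using Suc.IH[of "Suc j"] Suc.IH[of j] Suc.prems by simp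
qed auto

lemma abs_kern_le: "\<bar>kern m j q\<bar> \<le> 3^m * 2^j"
proof (induction m arbitrary: j)
  case (Suc m)
  have "\<bar>kern m j q / 2^m\<bar> \<le> \<bar>kern m j q\<bar>" by (simp add: divide_le_eq mult_le_cancel_left1)
  then have "\<bar>kern (Suc m) j q\<bar> \<le> \<bar>kern m (Suc j) q\<bar> + \<bar>kern m j q\<bar>"
    unfolding kern.simps by linarith
  also have "\<dots> \<le> 3^m * 2^Suc j + 3^m * 2^j" using Suc by (intro add_mono)
  also have "\<dots> = 3^Suc m * 2^j" by simp
  finally show ?case .
qed (auto simp: indicator_def)

lemma abs_kern_le_indicator: "\<bar>kern m j q\<bar> \<le> 3^m * 2^j * indicator {0..1/2^j} q"
  using abs_kern_le[of m j q] kern_eq_0[of q j m] by (cases "q \<in> {0..1/2^j}") auto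

lemma integrable_kern_times:
  fixes g :: "real \<Rightarrow> real"
  assumes "continuous_on {0..1/2^j} g"
  shows "integrable lborel (\<lambda>q. kern m j q * g q)"
proof -
  obtain B where B: "\<And>q. q \<in> {0..1/2^j} \<Longrightarrow> \<bar>g q\<bar> \<le> B"
    using compact_imp_bounded[OF compact_continuous_image[OF assms compact_Icc]]
    unfolding bounded_iff real_norm_def by blast
  have "integrable lborel (\<lambda>q. indicator {0..1/2^j} q *\<^sub>R (kern m j q * g q))"
  proof (rule Bochner_Integration.integrable_bound)
    show "integrable lborel (\<lambda>q::real. indicator {0..1/2^j} q *\<^sub>R (3^m * 2^j * B))"
      by (intro integrable_real_indicator integrable_scaleR_left) auto
    have "(\<lambda>q. indicator {0..1/2^j} q *\<^sub>R g q) \<in> borel_measurable borel"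
      using assms by (intro borel_measurable_continuous_on_indicator) auto
    then have "(\<lambda>q. kern m j q * (indicator {0..1/2^j} q *\<^sub>R g q)) \<in> borel_measurable borel"
      by measurable
    then show "(\<lambda>q. indicator {0..1/2^j} q *\<^sub>R (kern m j q * g q)) \<in> borel_measurable lborel"
      by (simp add: mult_ac)
    have "\<bar>kern m j q * g q\<bar> \<le> \<bar>3^m * 2^j * B\<bar>" if "q \<in> {0..1/2^j}" for q
      using mult_mono[OF abs_kern_le[of m j q] order_trans[OF B[OF that] abs_ge_self]] by (simp add: abs_mult)
    then show "AE q in lborel. norm (indicator {0..1/2^j} q *\<^sub>R (kern m j q * g q))
      \<le> norm (indicator {0..1/2^j} q *\<^sub>R (3^m * 2^j * B))"
      by (intro AE_I2) (auto simp: indicator_def)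
  qed
  moreover have "(\<lambda>q. indicator {0..1/2^j} q *\<^sub>R (kern m j q * g q)) = (\<lambda>q. kern m j q * g q)"
  proof
    fix q show "indicator {0..1/2^j} q *\<^sub>R (kern m j q * g q) = kern m j q * g q"
      using kern_eq_0[of q j m] by (cases "q \<in> {0..1/2^j}") auto
  qed
  ultimately show ?thesis by simp
qed

text \<open>The recursion mixes the levels \<open>j\<close> and \<open>Suc j\<close>, so the
  induction needs one \<open>c\<close> for all \<open>j\<close>. Step \<open>m\<close> multiplies it
  by \<open>1/2^n - 1/2^m\<close>, which vanishes for \<open>n = m\<close> and keeps moments zero
  that already are.\<close>

lemma kern_moment: "\<exists>c. (\<forall>j. (\<integral>q. kern m j q * q^n \<partial>lborel) = c / 2^(j*n)) \<and> (n < m \<longrightarrow> c = 0)"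
proof (induction m)
  case 0
  have "(\<integral>q. kern 0 j q * q^n \<partial>lborel) = (1 / real (Suc n)) / 2^(j*n)" for j
  proof -
    have "(\<integral>q. kern 0 j q * q^n \<partial>lborel) = 2^j * (\<integral>q. q^n * indicator {0..1/2^j} q \<partial>lborel)"
      by (subst integral_mult_right_zero[symmetric]) (auto intro!: Bochner_Integration.integral_cong simp: mult_ac)
    also have "(\<integral>q. q^n * indicator {0..1/2^j} q \<partial>lborel) = (1/2^j)^Suc n / real (Suc n)"
      by (subst integral_power) auto
    finally show ?thesis by (simp add: power_divide power_mult)
  qed
  then show ?case by blast
next
  case (Suc m)
  then obtain c where c: "\<And>j. (\<integral>q. kern m j q * q^n \<partial>lborel) = c / 2^(j*n)" "n < m \<Longrightarrow> c = 0" by blast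
  have i: "integrable lborel (\<lambda>q. kern m j q * q^n)" for j
    by (intro integrable_kern_times continuous_intros)
  have "(\<integral>q. kern (Suc m) j q * q^n \<partial>lborel) = (c * (1/2^n - 1/2^m)) / 2^(j*n)" for j
  proof -
    have "(\<integral>q. kern (Suc m) j q * q^n \<partial>lborel) =
      (\<integral>q. kern m (Suc j) q * q^n - kern m j q * q^n / 2^m \<partial>lborel)"
      by (intro Bochner_Integration.integral_cong) (auto simp: algebra_simps)
    also have "\<dots> = c / 2^(Suc j*n) - c / 2^(j*n) / 2^m"
      by (subst Bochner_Integration.integral_diff) (use i c in auto)
    also have "\<dots> = (c * (1/2^n - 1/2^m)) / 2^(j*n)" by (simp add: power_add field_simps)
    finally show ?thesis .
  qed
  moreover have "n < Suc m \<longrightarrow> c * (1/2^n - 1/2^m) = 0" using c(2) by (cases "n = m") auto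
  ultimately show ?case by blast
qed

lemma kern_moment_eq_0:
  assumes "n < m"
  shows "(\<integral>q. kern m j q * q^n \<partial>lborel) = 0"
  using kern_moment[of m n] assms by auto

lemma integral_abs_kern_le: "(\<integral>q. \<bar>kern m j q\<bar> \<partial>lborel) \<le> 3^m"
proof -
  have "(\<integral>q. \<bar>kern m j q\<bar> \<partial>lborel) \<le> (\<integral>q. 3^m * 2^j * indicator {0..1/2^j::real} q \<partial>lborel)"
    using integrable_kern_times[of j "\<lambda>_. 1" m]
    by (intro integral_mono abs_kern_le_indicator) (auto intro!: integrable_real_indicator)
  then show ?thesis by simp
qed

text \<open>Height of order \<open>2^j\<close> compensates support length \<open>1/2^j\<close>, so
  the total mass of the kernel is bounded independently of \<open>j\<close>.\<close>

lemma abs_integral_kern_times_le: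
  assumes g: "continuous_on {0..1/2^j} g" and E: "\<And>q. q \<in> {0..1/2^j} \<Longrightarrow> \<bar>g q\<bar> \<le> E"
  shows "\<bar>\<integral>q. kern m j q * g q \<partial>lborel\<bar> \<le> 3^m * E"
proof -
  have E0: "E \<ge> 0" using E[of 0] by simp
  have i: "integrable lborel (\<lambda>q. \<bar>kern m j q\<bar>)"
    using integrable_kern_times[of j "\<lambda>_. 1" m] by simp
  have "\<bar>\<integral>q. kern m j q * g q \<partial>lborel\<bar> \<le> (\<integral>q. \<bar>kern m j q * g q\<bar> \<partial>lborel)"
    by (rule integral_abs_bound)
  also have "\<dots> \<le> (\<integral>q. \<bar>kern m j q\<bar> * E \<partial>lborel)"
  proof (rule integral_mono)
    show "integrable lborel (\<lambda>q. \<bar>kern m j q * g q\<bar>)"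
      using integrable_kern_times[OF g] by simp
    show "\<bar>kern m j q * g q\<bar> \<le> \<bar>kern m j q\<bar> * E" for q
      using kern_eq_0[of q j m] E[of q] by (cases "q \<in> {0..1/2^j}") (auto simp: abs_mult intro: mult_left_mono)
  qed (use i in simp)
  also have "\<dots> = (\<integral>q. \<bar>kern m j q\<bar> \<partial>lborel) * E" using i by simp
  also have "\<dots> \<le> 3^m * E" using integral_abs_kern_le[of m j] E0 by (rule mult_right_mono)
  finally show ?thesis .
qed

text \<open>Repeated differentiation of \<open>(1 - z\<^sup>2) powr \<kappa>\<close> keeps the shape polynomial times power.\<close>

fun taylor_poly :: "real \<Rightarrow> nat \<Rightarrow> real poly" where
  "taylor_poly \<kappa> 0 = 1"
| "taylor_poly \<kappa> (Suc m) =
     pderiv (taylor_poly \<kappa> m) * [:1, 0, -1:] - [:0, 2 * (\<kappa> - real m):] * taylor_poly \<kappa> m"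

lemma taylor_poly_deriv:
  assumes "\<bar>z\<bar> < 1"
  shows "((\<lambda>z. poly (taylor_poly \<kappa> m) z * (1 - z\<^sup>2) powr (\<kappa> - real m)) has_real_derivative
     poly (taylor_poly \<kappa> (Suc m)) z * (1 - z\<^sup>2) powr (\<kappa> - real (Suc m))) (at z)"
proof -
  have pos: "1 - z\<^sup>2 > 0" using assms by (simp add: abs_square_less_1)
  have *: "(1 - z\<^sup>2) powr (\<kappa> - real m) = (1 - z\<^sup>2) powr (\<kappa> - real (Suc m)) * (1 - z\<^sup>2)"
    using pos powr_add[of "1 - z\<^sup>2" "\<kappa> - real (Suc m)" 1] by simp
  have **: "\<kappa> - real m - 1 = \<kappa> - real (Suc m)" by simp
  show ?thesis
    by (rule derivative_eq_intros poly_DERIV refl pos)+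
      (use pos in \<open>simp only: * ** poly_diff poly_mult taylor_poly.simps, simp add: algebra_simps power2_eq_square\<close>)
qed

text \<open>On \<open>[-1/2, 1/2]\<close> the critical points -1 and 1 are out of reach, so the
  derivative of order \<open>M\<close> is bounded by compactness and one \<open>B\<close> serves all
  pairs \<open>z\<close>, \<open>w\<close>.\<close>

lemma taylor_remainder_bound:
  "\<exists>B. \<forall>z w. \<bar>z\<bar> \<le> 1/2 \<longrightarrow> \<bar>w\<bar> \<le> 1/2 \<longrightarrow>
     \<bar>(1 - z\<^sup>2) powr \<kappa> - (\<Sum>m<M. poly (taylor_poly \<kappa> m) w * (1 - w\<^sup>2) powr (\<kappa> - real m) / fact m * (z - w)^m)\<bar>
       \<le> B * \<bar>z - w\<bar>^M"
proof -
  let ?D = "\<lambda>m z. poly (taylor_poly \<kappa> m) z * (1 - z\<^sup>2) powr (\<kappa> - real m)"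
  have lt: "\<bar>z\<bar> \<le> 1/2 \<Longrightarrow> \<bar>z\<bar> < 1" for z :: real by linarith
  have cont: "continuous_on {-1/2..1/2} (?D M)"
    by (rule DERIV_continuous_on[OF has_field_derivative_at_within[OF taylor_poly_deriv]])
      (auto simp: abs_less_iff)
  obtain B where B: "\<And>z. \<bar>z\<bar> \<le> 1/2 \<Longrightarrow> \<bar>?D M z\<bar> \<le> B"
    using compact_imp_bounded[OF compact_continuous_image[OF cont compact_Icc]]
    unfolding bounded_iff real_norm_def atLeastAtMost_iff abs_le_iff[of _ "1/2"] by fastforce
  have B0: "B \<ge> 0" using B[of 0] by linarith
  have "\<bar>(1 - z\<^sup>2) powr \<kappa> - (\<Sum>m<M. ?D m w / fact m * (z - w)^m)\<bar> \<le> B * \<bar>z - w\<bar>^M"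
    if "\<bar>z\<bar> \<le> 1/2" "\<bar>w\<bar> \<le> 1/2" for z w
  \<comment> \<open>\<open>Taylor\<close> asks for positive order and distinct points; the two
    excluded cases are immediate.\<close>
  proof (cases "M = 0 \<or> z = w")
    case True
    then show ?thesis
    proof
      assume "M = 0" then show ?thesis using B[OF that(1)] by simp
    next
      assume "z = w"
      then show ?thesis using B0 B[of z] that
        by (cases M) (auto simp: sum.lessThan_Suc_shift simp del: sum.lessThan_Suc)
    qed
  next
    case False
    have "\<exists>x. (if z < w then z < x \<and> x < w else w < x \<and> x < z) \<and>
      ?D 0 z = (\<Sum>m<M. ?D m w / fact m * (z - w)^m) + ?D M x / fact M * (z - w)^M"
      by (rule Taylor[where a="-1/2" and b="1/2"])
        (use False that in \<open>auto intro!: taylor_poly_deriv[simplified] simp: abs_le_iff\<close>)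
    then obtain x where x: "(if z < w then z < x \<and> x < w else w < x \<and> x < z)"
      "(1 - z\<^sup>2) powr \<kappa> - (\<Sum>m<M. ?D m w / fact m * (z - w)^m) = ?D M x / fact M * (z - w)^M"
      by auto
    have "\<bar>x\<bar> \<le> 1/2" using x(1) that by (auto split: if_splits)
    then have "\<bar>?D M x / fact M\<bar> \<le> B"
      using B[of x] frac_le[of "\<bar>?D M x\<bar>" "\<bar>?D M x\<bar>" 1 "fact M"] by (simp add: abs_mult)
    then show ?thesis unfolding x(2) abs_mult power_abs by (intro mult_right_mono) auto
  qed
  then show ?thesis by blast
qed

subsection \<open>Coordinates with two centres\<close>

lemma nn_integral_lborel_affine:
  fixes f :: "'a::euclidean_space \<Rightarrow> ennreal"
  assumes [measurable]: "f \<in> borel_measurable borel" and "c \<noteq> 0"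
  shows "(\<integral>\<^sup>+y. f y \<partial>lborel) = ennreal (\<bar>c\<bar>^DIM('a)) * (\<integral>\<^sup>+y. f (a + c *\<^sub>R y) \<partial>lborel)"
  by (subst lborel_affine[OF assms(2), of a])
    (simp add: nn_integral_density nn_integral_distr nn_integral_cmult)

lemma nn_integral_lborel_shift:
  fixes f :: "'a::euclidean_space \<Rightarrow> ennreal"
  assumes "f \<in> borel_measurable borel"
  shows "(\<integral>\<^sup>+y. f (a + y) \<partial>lborel) = (\<integral>\<^sup>+y. f y \<partial>lborel)"
  using nn_integral_lborel_affine[OF assms, of 1 a] by simp

text \<open>For a unit vector \<open>e\<close> this is the squared distance of \<open>y\<close> from
  the line through 0 along \<open>e\<close>.\<close>

definition perp_sq :: "'a::euclidean_space \<Rightarrow> 'a \<Rightarrow> real" where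
  "perp_sq e y = (norm y)\<^sup>2 - (y \<bullet> e)\<^sup>2"

lemma perp_sq_measurable [measurable]: "perp_sq e \<in> borel_measurable borel"
  unfolding perp_sq_def[abs_def] by measurable

lemma perp_sq_nonneg: "norm e = 1 \<Longrightarrow> 0 \<le> perp_sq e y"
  using Cauchy_Schwarz_ineq[of y e] by (simp add: perp_sq_def norm_eq_1 power2_norm_eq_inner)

lemma perp_sq_shift:
  assumes "norm e = 1"
  shows "perp_sq e (v *\<^sub>R e + y) = perp_sq e y"
  using assms unfolding perp_sq_def power2_norm_eq_inner
  by (simp add: inner_add_left inner_add_right norm_eq_1 inner_commute[of e y] power2_eq_square algebra_simps)

text \<open>Averaging over the translations along \<open>e\<close>, which leave \<open>perp_sq e\<close> invariant, splits off the
  coordinate \<open>y \<bullet> e\<close> without a choice of orthonormal basis.\<close>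

lemma nn_integral_slab:
  fixes e :: "'a::euclidean_space"
  assumes e: "norm e = 1"
    and F[measurable]: "(\<lambda>(v, q). F v q) \<in> borel_measurable (borel \<Otimes>\<^sub>M borel)"
  shows "(\<integral>\<^sup>+y. F (y \<bullet> e) (perp_sq e y) \<partial>lborel) =
    (\<integral>\<^sup>+y. indicator {y. y \<bullet> e \<in> {-1..0}} y * (\<integral>\<^sup>+v. F v (perp_sq e y) \<partial>lborel) \<partial>lborel)"
proof -
  have ee: "e \<bullet> e = 1" using e by (simp add: norm_eq_1)
  have F': "(\<lambda>v. F (f v) (g v)) \<in> borel_measurable M"
    if "f \<in> borel_measurable M" "g \<in> borel_measurable M" for f g and M :: "'c measure"
    using measurable_compose[OF measurable_Pair[OF that] F] by simp
  \<comment> \<open>Writes 1 as the length of the set of \<open>v\<close> with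
    \<open>0 \<le> v - y \<bullet> e \<le> 1\<close>. Once the integrals are exchanged, translating
    by \<open>v *\<^sub>R e\<close> turns this window into a fixed slab, and \<open>F\<close> is
    left to be integrated over a full line.\<close>
  have "(\<integral>\<^sup>+y. F (y \<bullet> e) (perp_sq e y) \<partial>lborel) =
      (\<integral>\<^sup>+y. (\<integral>\<^sup>+v. indicator {0..1} (v - y \<bullet> e) * F (y \<bullet> e) (perp_sq e y) \<partial>lborel) \<partial>(lborel :: 'a measure))"
  proof (rule nn_integral_cong)
    fix y :: 'a
    have "(\<integral>\<^sup>+v. indicator {0..1} (v - y \<bullet> e) * F (y \<bullet> e) (perp_sq e y) \<partial>lborel) =
       (\<integral>\<^sup>+v. indicator {y \<bullet> e..y \<bullet> e + 1} v * F (y \<bullet> e) (perp_sq e y) \<partial>lborel)"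
      by (intro nn_integral_cong) (auto simp: indicator_def)
    also have "\<dots> = F (y \<bullet> e) (perp_sq e y)"
      by (subst nn_integral_multc) auto
    finally show "F (y \<bullet> e) (perp_sq e y) =
      (\<integral>\<^sup>+v. indicator {0..1} (v - y \<bullet> e) * F (y \<bullet> e) (perp_sq e y) \<partial>lborel)" ..
  qed
  also have "\<dots> = (\<integral>\<^sup>+v. (\<integral>\<^sup>+y. indicator {0..1} (v - y \<bullet> e) * F (y \<bullet> e) (perp_sq e y) \<partial>(lborel :: 'a measure)) \<partial>lborel)"
    by (rule lborel_pair.Fubini'[symmetric]) (use F' in measurable)
  also have "\<dots> = (\<integral>\<^sup>+v. (\<integral>\<^sup>+y. indicator {0..1} (- (y \<bullet> e)) * F (v + y \<bullet> e) (perp_sq e y) \<partial>(lborel :: 'a measure)) \<partial>lborel)"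
  proof (rule nn_integral_cong)
    fix v :: real
    have "(\<integral>\<^sup>+y. indicator {0..1} (v - y \<bullet> e) * F (y \<bullet> e) (perp_sq e y) \<partial>(lborel :: 'a measure)) =
      (\<integral>\<^sup>+y. indicator {0..1} (v - (v *\<^sub>R e + y) \<bullet> e) * F ((v *\<^sub>R e + y) \<bullet> e) (perp_sq e (v *\<^sub>R e + y)) \<partial>(lborel :: 'a measure))"
      by (rule nn_integral_lborel_shift[symmetric]) (use F' in measurable)
    then show "(\<integral>\<^sup>+y. indicator {0..1} (v - y \<bullet> e) * F (y \<bullet> e) (perp_sq e y) \<partial>(lborel :: 'a measure)) =
      (\<integral>\<^sup>+y. indicator {0..1} (- (y \<bullet> e)) * F (v + y \<bullet> e) (perp_sq e y) \<partial>(lborel :: 'a measure))"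
      by (simp add: perp_sq_shift[OF e] inner_add_left ee)
  qed
  also have "\<dots> = (\<integral>\<^sup>+y. (\<integral>\<^sup>+v. indicator {0..1} (- (y \<bullet> e)) * F (v + y \<bullet> e) (perp_sq e y) \<partial>lborel) \<partial>(lborel :: 'a measure))"
    by (rule lborel_pair.Fubini') (use F' in measurable)
  also have "\<dots> = (\<integral>\<^sup>+y. indicator {y. y \<bullet> e \<in> {-1..0}} y * (\<integral>\<^sup>+v. F v (perp_sq e y) \<partial>lborel) \<partial>lborel)"
  proof (rule nn_integral_cong)
    fix y :: 'a
    have [measurable]: "(\<lambda>v. F v (perp_sq e y)) \<in> borel_measurable borel"
      by (rule F') auto
    have "(\<integral>\<^sup>+v. F (v + y \<bullet> e) (perp_sq e y) \<partial>lborel) = (\<integral>\<^sup>+v. F v (perp_sq e y) \<partial>lborel)"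
      using nn_integral_lborel_shift[of "\<lambda>v. F v (perp_sq e y)" "y \<bullet> e"] by (simp add: add.commute)
    moreover have "(\<lambda>v. F (v + y \<bullet> e) (perp_sq e y)) \<in> borel_measurable lborel"
      by measurable
    moreover have "indicator {0..1} (- (y \<bullet> e)) = (indicator {y. y \<bullet> e \<in> {-1..0}} y :: ennreal)"
      by (auto simp: indicator_def)
    ultimately show "(\<integral>\<^sup>+v. indicator {0..1} (- (y \<bullet> e)) * F (v + y \<bullet> e) (perp_sq e y) \<partial>lborel) =
      indicator {y. y \<bullet> e \<in> {-1..0}} y * (\<integral>\<^sup>+v. F v (perp_sq e y) \<partial>lborel)"
      by (simp add: nn_integral_cmult)
  qed
  finally show ?thesis .
qed

text \<open>The distribution function of \<open>perp_sq e\<close> on a slab of thickness 1: for a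
  unit vector, the volume of a solid cylinder of height 1 and radius \<open>sqrt q\<close> with axis
  \<open>e\<close>.\<close>

definition slab_volume :: "'a::euclidean_space \<Rightarrow> real \<Rightarrow> ennreal" where
  "slab_volume e q = emeasure lborel {y. y \<bullet> e \<in> {-1..0} \<and> perp_sq e y \<le> q}"

lemma slab_volume_le:
  fixes e :: "'a::euclidean_space"
  assumes "norm e = 1" "q \<ge> 0"
  shows "slab_volume e q \<le> emeasure lborel (cball (0::'a) (sqrt (1 + q)))"
  unfolding slab_volume_def
proof (intro emeasure_mono subsetI)
  fix y assume "y \<in> {y. y \<bullet> e \<in> {-1..0} \<and> perp_sq e y \<le> q}"
  then have "\<bar>y \<bullet> e\<bar> \<le> 1" "(norm y)\<^sup>2 \<le> q + (y \<bullet> e)\<^sup>2" by (auto simp: perp_sq_def)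
  then have "(norm y)\<^sup>2 \<le> 1 + q" using abs_le_square_iff[of "y \<bullet> e" 1] by simp
  then show "y \<in> cball 0 (sqrt (1 + q))" by (simp add: real_le_rsqrt)
qed auto

text \<open>A dilation by \<open>l\<close> multiplies volumes by \<open>l^d\<close> but also
  stretches the slab to thickness \<open>l\<close>. By \<open>nn_integral_slab\<close>, such a slab
  carries \<open>l\<close> times the volume of one of thickness 1, which leaves \<open>d - 1\<close>
  powers of \<open>l\<close>.\<close>

lemma slab_volume_scale:
  fixes e :: "'a::euclidean_space"
  assumes e: "norm e = 1" and "l > 0"
  shows "slab_volume e (l\<^sup>2 * q) = ennreal (l ^ (DIM('a) - 1)) * slab_volume e q"
proof -
  let ?F = "\<lambda>v q'. indicator {-l..0} v * indicator {..l\<^sup>2 * q} q' :: ennreal"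
  have "(\<integral>\<^sup>+y. ?F (y \<bullet> e) (perp_sq e y) \<partial>lborel) =
     ennreal (\<bar>l\<bar> ^ DIM('a)) * (\<integral>\<^sup>+y. ?F ((0 + l *\<^sub>R y) \<bullet> e) (perp_sq e (0 + l *\<^sub>R y)) \<partial>(lborel :: 'a measure))"
    by (rule nn_integral_lborel_affine) (use \<open>l > 0\<close> in auto)
  also have "(\<lambda>y. ?F ((0 + l *\<^sub>R y) \<bullet> e) (perp_sq e (0 + l *\<^sub>R y))) =
      (\<lambda>y. indicator {y. y \<bullet> e \<in> {-1..0} \<and> perp_sq e y \<le> q} y)"
  proof
    fix y
    have "l * (y \<bullet> e) \<ge> - l \<longleftrightarrow> y \<bullet> e \<ge> -1"
      using mult_le_cancel_left_pos[OF \<open>l > 0\<close>, of "-1" "y \<bullet> e"] by simp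
    moreover have "l * (y \<bullet> e) \<le> 0 \<longleftrightarrow> y \<bullet> e \<le> 0"
      using \<open>l > 0\<close> by (simp add: mult_le_0_iff)
    moreover have "perp_sq e (l *\<^sub>R y) = l\<^sup>2 * perp_sq e y"
      by (simp add: perp_sq_def power_mult_distrib algebra_simps)
    moreover have "l\<^sup>2 * perp_sq e y \<le> l\<^sup>2 * q \<longleftrightarrow> perp_sq e y \<le> q"
      using \<open>l > 0\<close> by simp
    ultimately show "?F ((0 + l *\<^sub>R y) \<bullet> e) (perp_sq e (0 + l *\<^sub>R y)) =
       indicator {y. y \<bullet> e \<in> {-1..0} \<and> perp_sq e y \<le> q} y"
      by (auto simp: indicator_def)
  qed
  also have "(\<integral>\<^sup>+y. indicator {y. y \<bullet> e \<in> {-1..0} \<and> perp_sq e y \<le> q} y \<partial>lborel) = slab_volume e q"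
    unfolding slab_volume_def by (rule nn_integral_indicator) measurable
  also have "(\<integral>\<^sup>+y. ?F (y \<bullet> e) (perp_sq e y) \<partial>lborel) =
    (\<integral>\<^sup>+y. indicator {y. y \<bullet> e \<in> {-1..0}} y * (\<integral>\<^sup>+v. ?F v (perp_sq e y) \<partial>lborel) \<partial>lborel)"
    by (rule nn_integral_slab[OF e]) measurable
  also have "\<dots> = (\<integral>\<^sup>+y. ennreal l * indicator {y. y \<bullet> e \<in> {-1..0} \<and> perp_sq e y \<le> l\<^sup>2 * q} y \<partial>lborel)"
  proof (rule nn_integral_cong)
    fix y
    have "(\<integral>\<^sup>+v. ?F v (perp_sq e y) \<partial>lborel) = ennreal l * indicator {..l\<^sup>2 * q} (perp_sq e y)"
      using \<open>l > 0\<close> by (subst nn_integral_multc) auto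
    then show "indicator {y. y \<bullet> e \<in> {-1..0}} y * (\<integral>\<^sup>+v. ?F v (perp_sq e y) \<partial>lborel) =
       ennreal l * indicator {y. y \<bullet> e \<in> {-1..0} \<and> perp_sq e y \<le> l\<^sup>2 * q} y"
      by (auto simp: indicator_def)
  qed
  also have "\<dots> = ennreal l * slab_volume e (l\<^sup>2 * q)"
    unfolding slab_volume_def by (subst nn_integral_cmult) auto
  finally have *: "ennreal l * slab_volume e (l\<^sup>2 * q) = ennreal (\<bar>l\<bar> ^ DIM('a)) * slab_volume e q" .
  have "\<bar>l\<bar> ^ DIM('a) = l * l ^ (DIM('a) - 1)"
    using \<open>l > 0\<close> by (simp add: power_eq_if[of _ "DIM('a)"])
  with * have "ennreal l * slab_volume e (l\<^sup>2 * q) = ennreal l * (ennreal (l ^ (DIM('a) - 1)) * slab_volume e q)"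
    using \<open>l > 0\<close> by (simp add: ennreal_mult mult.assoc)
  then show ?thesis
    using \<open>l > 0\<close> by (simp add: ennreal_mult_cancel_left)
qed

text \<open>The factor \<open>(d - 1)/2\<close> comes from differentiating
  \<open>q powr ((d - 1)/2)\<close>; it makes \<open>slab_const e * pow_weight\<close> the density
  of \<open>perp_sq e\<close> on the slab.\<close>

definition slab_const :: "'a::euclidean_space \<Rightarrow> real" where
  "slab_const e = (real DIM('a) - 1) / 2 * enn2real (slab_volume e 1)"

definition pow_weight :: "'a::euclidean_space itself \<Rightarrow> real \<Rightarrow> real" where
  "pow_weight T q = (if q > 0 then q powr ((real DIM('a) - 3) / 2) else 0)"

lemma pow_weight_measurable [measurable]: "pow_weight T \<in> borel_measurable borel"
  unfolding pow_weight_def[abs_def] by measurable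

lemma pow_weight_nonneg: "pow_weight T q \<ge> 0"
  by (simp add: pow_weight_def)

lemma slab_volume_finite:
  fixes e :: "'a::euclidean_space"
  assumes "norm e = 1" "q \<ge> 0"
  shows "slab_volume e q < \<infinity>"
  using slab_volume_le[OF assms] emeasure_lborel_cball_finite[of "0::'a" "sqrt (1 + q)"]
  by (rule le_less_trans)

lemma slab_const_nonneg: "DIM('a) \<ge> 2 \<Longrightarrow> slab_const (e::'a::euclidean_space) \<ge> 0"
  by (simp add: slab_const_def)

lemma slab_const_le:
  fixes e :: "'a::euclidean_space"
  assumes "norm e = 1"
  shows "slab_const e \<le> real DIM('a) * measure lborel (cball (0::'a) (sqrt 2))"
proof -
  have "enn2real (slab_volume e 1) \<le> measure lborel (cball (0::'a) (sqrt 2))"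
    using slab_volume_le[OF assms, of 1] emeasure_lborel_cball_finite[of "0::'a" "sqrt 2"]
    unfolding measure_def by (intro enn2real_mono) auto
  then show ?thesis unfolding slab_const_def by (intro mult_mono) (auto simp: field_simps)
qed

lemma slab_volume_eq:
  fixes e :: "'a::euclidean_space"
  assumes e: "norm e = 1" and d: "DIM('a) \<ge> 2" and q: "q \<ge> 0"
  shows "slab_volume e q = ennreal (enn2real (slab_volume e 1) * q powr ((real DIM('a) - 1) / 2))"
proof -
  have pos: "slab_volume e q = ennreal (enn2real (slab_volume e 1) * q powr ((real DIM('a) - 1) / 2))"
    if q: "q > 0" for q
  proof -
    have "slab_volume e q = ennreal (sqrt q ^ (DIM('a) - 1)) * slab_volume e 1"
      using slab_volume_scale[OF e, of "sqrt q" 1] q by simp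
    also have "sqrt q ^ (DIM('a) - 1) = q powr ((real DIM('a) - 1) / 2)"
    proof -
      have "sqrt q ^ (DIM('a) - 1) = sqrt q powr real (DIM('a) - 1)"
        by (rule powr_realpow[symmetric]) (use q in simp)
      also have "\<dots> = q powr (1/2 * real (DIM('a) - 1))"
        using q by (simp add: powr_half_sqrt[symmetric] powr_powr)
      finally show ?thesis using d by (simp add: of_nat_diff)
    qed
    also have "slab_volume e 1 = ennreal (enn2real (slab_volume e 1))"
      using slab_volume_finite[OF e, of 1] by (simp add: less_top)
    finally show ?thesis by (simp add: ennreal_mult'[symmetric] mult.commute)
  qed
  show ?thesis
  proof (cases "q = 0")
    case True
    have "slab_volume e 0 \<le> 0"
    proof (rule ennreal_le_epsilon)
      fix \<epsilon> :: real assume "\<epsilon> > 0"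
      let ?k = "(real DIM('a) - 1) / 2" and ?c = "enn2real (slab_volume e 1)"
      have k: "?k > 0" using d by simp
      have c: "?c \<ge> 0" by simp
      \<comment> \<open>\<open>x\<close> solves \<open>(?c + 1) * x powr ?k = \<epsilon>\<close>,
        the 1 guarding against division by zero. The value at 0 is approached through positive
        \<open>x\<close> because the scaling relation needs \<open>l > 0\<close>.\<close>
      define x where "x = (\<epsilon> / (?c + 1)) powr (1 / ?k)"
      have x: "x > 0" using \<open>\<epsilon> > 0\<close> c by (simp add: x_def add_nonneg_eq_0_iff)
      have "slab_volume e 0 \<le> slab_volume e x"
        unfolding slab_volume_def using x by (intro emeasure_mono) (auto intro: order_trans)
      also have "\<dots> = ennreal (?c * x powr ?k)" by (rule pos[OF x])
      also have "x powr ?k = (\<epsilon> / (?c + 1)) powr (1 / ?k * ?k)"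
        unfolding x_def by (rule powr_powr)
      also have "1 / ?k * ?k = 1" using k by (metis nonzero_eq_divide_eq less_irrefl)
      also have "(\<epsilon> / (?c + 1)) powr 1 = \<epsilon> / (?c + 1)" using \<open>\<epsilon> > 0\<close> c by simp
      also have "ennreal (?c * (\<epsilon> / (?c + 1))) \<le> ennreal \<epsilon>"
        using c \<open>\<epsilon> > 0\<close> by (intro ennreal_leI) (simp add: divide_le_eq add_pos_nonneg mult.commute algebra_simps)
      finally show "slab_volume e 0 \<le> 0 + ennreal \<epsilon>" by simp
    qed
    then show ?thesis using True by simp
  next
    case False
    then show ?thesis by (intro pos) (use q in simp)
  qed
qed

text \<open>Half-lines form an intersection-stable generator on which both measures are finite.
  There the left side is \<open>slab_volume\<close>, and the right side integrates its derivative
  back.\<close>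

lemma distr_perp_sq:
  fixes e :: "'a::euclidean_space"
  assumes e: "norm e = 1" and d: "DIM('a) \<ge> 2"
  shows "distr (density lborel (indicator {y. y \<bullet> e \<in> {-1..0}})) borel (perp_sq e) =
    density lborel (\<lambda>q. ennreal (slab_const e * pow_weight TYPE('a) q))" (is "?M = ?N")
proof (rule measure_eqI_generator_eq[where E="range (\<lambda>a::real. {..a})" and \<Omega>=UNIV and A="\<lambda>i. {..real i}"])
  let ?k = "(real DIM('a) - 3) / 2" and ?c = "enn2real (slab_volume e 1)"
  have k: "?k > -1" using d by simp
  have M: "emeasure ?M {..a} = slab_volume e a" for a
  proof -
    have s: "perp_sq e -` {..a} \<in> sets lborel"
      using measurable_sets_borel[OF perp_sq_measurable, of "{..a}" e] by simp
    have "emeasure ?M {..a} = (\<integral>\<^sup>+y. indicator {y. y \<bullet> e \<in> {-1..0}} y * indicator (perp_sq e -` {..a}) y \<partial>lborel)"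
      using s by (subst emeasure_distr, simp, simp, subst emeasure_density) auto
    also have "\<dots> = (\<integral>\<^sup>+y. indicator {y. y \<bullet> e \<in> {-1..0} \<and> perp_sq e y \<le> a} y \<partial>lborel)"
      by (intro nn_integral_cong) (auto simp: indicator_def)
    also have "\<dots> = slab_volume e a"
      unfolding slab_volume_def by (rule nn_integral_indicator) measurable
    finally show ?thesis .
  qed
  show "emeasure ?M X = emeasure ?N X" if "X \<in> range (\<lambda>a::real. {..a})" for X
  proof -
    obtain a where X: "X = {..a}" using \<open>X \<in> _\<close> by blast
    show ?thesis
    proof (cases "a \<ge> 0")
      case True
      have "emeasure ?N X = (\<integral>\<^sup>+q. ennreal (slab_const e * q powr ?k) * indicator {0..a} q \<partial>lborel)"
        unfolding X by (subst emeasure_density) (auto intro!: nn_integral_cong simp: indicator_def pow_weight_def)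
      also have "\<dots> = ennreal (slab_const e * (a powr (?k + 1) / (?k + 1)))"
        using has_integral_mult_right[OF has_integral_powr_from_0[OF k True], of "slab_const e"] d
        by (intro nn_integral_has_integral_lebesgue') (auto simp: slab_const_nonneg)
      also have "slab_const e * (a powr (?k + 1) / (?k + 1)) = ?c * a powr ((real DIM('a) - 1) / 2)"
      proof -
        have "?k + 1 = (real DIM('a) - 1) / 2" by (simp add: field_simps)
        moreover have "(real DIM('a) - 1) / 2 \<noteq> 0" using d by simp
        ultimately show ?thesis unfolding slab_const_def by (simp add: divide_simps)
      qed
      also have "ennreal \<dots> = slab_volume e a" by (rule slab_volume_eq[OF e d True, symmetric])
      finally show ?thesis using M X by simp
    next
      case False
      have "{y. y \<bullet> e \<in> {-1..0} \<and> perp_sq e y \<le> a} = {}"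
        using perp_sq_nonneg[OF e] False by (auto dest: order_trans)
      then have "slab_volume e a = 0" by (simp only: slab_volume_def emeasure_empty)
      moreover have "emeasure ?N X = (\<integral>\<^sup>+q. ennreal (slab_const e * pow_weight TYPE('a) q) * indicator {..a} q \<partial>lborel)"
        unfolding X by (rule emeasure_density) auto
      moreover have "\<dots> = (\<integral>\<^sup>+(q::real). 0 \<partial>lborel)"
        using False by (intro nn_integral_cong) (auto simp: indicator_def pow_weight_def)
      ultimately show ?thesis using M X by simp
    qed
  qed
  show "emeasure ?M {..real i} \<noteq> \<infinity>" for i
    using slab_volume_finite[OF e, of "real i"] M by simp
  show "Int_stable (range (\<lambda>a::real. {..a}))"
    by (auto simp: Int_stable_def)
  show "sets ?M = sigma_sets UNIV (range (\<lambda>a. {..a}))" "sets ?N = sigma_sets UNIV (range (\<lambda>a. {..a}))"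
    by (simp_all add: borel_eq_atMost)
  have "x \<in> (\<Union>i. {..real i})" for x :: real
    using real_arch_simple[of x] by (simp add: atMost_iff UN_iff)
  then show "(\<Union>i. {..real i}) = UNIV" by blast
  show "range (\<lambda>a::real. {..a}) \<subseteq> Pow UNIV" by simp
  show "range (\<lambda>i. {..real i}) \<subseteq> range (\<lambda>a::real. {..a})" by blast
qed

text \<open>Cylindrical coordinates about \<open>e\<close>, with the squared radius as a variable
  and the angular directions already integrated out.\<close>

lemma nn_integral_perp:
  fixes e :: "'a::euclidean_space"
  assumes e: "norm e = 1" and d: "DIM('a) \<ge> 2"
    and F[measurable]: "(\<lambda>(v, q). F v q) \<in> borel_measurable (borel \<Otimes>\<^sub>M borel)"
  shows "(\<integral>\<^sup>+y. F (y \<bullet> e) (perp_sq e y) \<partial>lborel) =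
    (\<integral>\<^sup>+v. (\<integral>\<^sup>+q. ennreal (slab_const e * pow_weight TYPE('a) q) * F v q \<partial>lborel) \<partial>lborel)"
proof -
  have F': "(\<lambda>v. F (f v) (g v)) \<in> borel_measurable M"
    if "f \<in> borel_measurable M" "g \<in> borel_measurable M" for f g and M :: "'c measure"
    using measurable_compose[OF measurable_Pair[OF that] F] by simp
  have [measurable]: "(\<lambda>q. \<integral>\<^sup>+v. F v q \<partial>lborel) \<in> borel_measurable borel"
    by (rule lborel.borel_measurable_nn_integral) (unfold case_prod_unfold, intro F'; measurable)
  have "(\<integral>\<^sup>+y. F (y \<bullet> e) (perp_sq e y) \<partial>lborel) =
    (\<integral>\<^sup>+y. indicator {y. y \<bullet> e \<in> {-1..0}} y * (\<integral>\<^sup>+v. F v (perp_sq e y) \<partial>lborel) \<partial>lborel)"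
    by (rule nn_integral_slab[OF e F])
  also have "\<dots> = (\<integral>\<^sup>+q. (\<integral>\<^sup>+v. F v q \<partial>lborel)
      \<partial>distr (density lborel (indicator {y. y \<bullet> e \<in> {-1..0}})) borel (perp_sq e))"
    by (subst nn_integral_distr, simp, simp, subst nn_integral_density) auto
  also have "\<dots> = (\<integral>\<^sup>+q. ennreal (slab_const e * pow_weight TYPE('a) q) * (\<integral>\<^sup>+v. F v q \<partial>lborel) \<partial>lborel)"
    unfolding distr_perp_sq[OF e d] by (subst nn_integral_density) auto
  also have "\<dots> = (\<integral>\<^sup>+q. (\<integral>\<^sup>+v. ennreal (slab_const e * pow_weight TYPE('a) q) * F v q \<partial>lborel) \<partial>lborel)"
    by (intro nn_integral_cong nn_integral_cmult[symmetric]) measurable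
  also have "\<dots> = (\<integral>\<^sup>+v. (\<integral>\<^sup>+q. ennreal (slab_const e * pow_weight TYPE('a) q) * F v q \<partial>lborel) \<partial>lborel)"
    by (rule lborel_pair.Fubini') (unfold case_prod_unfold, intro borel_measurable_times_ennreal F'; measurable)
  finally show ?thesis .
qed

text \<open>With \<open>\<alpha> = |y - x|^2 - t^2\<close>,
  \<open>\<beta> = |y - x'|^2 - t^2\<close> and \<open>r = |x - x'|\<close>, the quotient is the
  coordinate of \<open>y - x\<close> along the line through the centres, so the argument of
  \<open>pow_weight\<close> is the squared distance of \<open>y\<close> from that line.\<close>

definition two_center_weight :: "'a::euclidean_space itself \<Rightarrow> real \<Rightarrow> real \<Rightarrow> real \<Rightarrow> real \<Rightarrow> real" where
  "two_center_weight T t r \<alpha> \<beta> = pow_weight T (\<alpha> + t\<^sup>2 - ((\<alpha> - \<beta> + r\<^sup>2) / (2 * r))\<^sup>2)"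

text \<open>Put the origin at \<open>x\<close> and let the axis point to \<open>x'\<close>. For a
  fixed axial coordinate \<open>v\<close>, \<open>\<alpha>\<close> is a shift of the squared radius;
  for fixed \<open>\<alpha>\<close>, \<open>\<beta> = \<alpha> - 2 * r * v + r^2\<close> is affine
  in \<open>v\<close>, which contributes the Jacobian \<open>1 / (2 * r)\<close>.\<close>

lemma nn_integral_two_centers:
  fixes x x' :: "'a::euclidean_space"
  assumes d: "DIM('a) \<ge> 2" and r: "r = dist x x'" "r > 0"
    and F[measurable]: "(\<lambda>(\<alpha>, \<beta>). F \<alpha> \<beta>) \<in> borel_measurable (borel \<Otimes>\<^sub>M borel)"
  shows "(\<integral>\<^sup>+y. F ((dist y x)\<^sup>2 - t\<^sup>2) ((dist y x')\<^sup>2 - t\<^sup>2) \<partial>lborel) =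
    (\<integral>\<^sup>+\<alpha>. (\<integral>\<^sup>+\<beta>. ennreal (slab_const ((x' - x) /\<^sub>R r) / (2 * r) * two_center_weight TYPE('a) t r \<alpha> \<beta>) * F \<alpha> \<beta> \<partial>lborel) \<partial>lborel)"
proof -
  define e where "e = (x' - x) /\<^sub>R r"
  have e: "norm e = 1" using r by (simp add: e_def dist_norm norm_minus_commute)
  have re: "r *\<^sub>R e = x' - x" using r by (simp add: e_def)
  let ?k = "slab_const e" and ?w = "pow_weight TYPE('a)"
  have F': "(\<lambda>v. F (f v) (g v)) \<in> borel_measurable M"
    if "f \<in> borel_measurable M" "g \<in> borel_measurable M" for f g and M :: "'c measure"
    using measurable_compose[OF measurable_Pair[OF that] F] by simp
  have k0: "?k \<ge> 0" by (rule slab_const_nonneg[OF d])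
  have "(\<integral>\<^sup>+y. F ((dist y x)\<^sup>2 - t\<^sup>2) ((dist y x')\<^sup>2 - t\<^sup>2) \<partial>lborel) =
      (\<integral>\<^sup>+y. F ((dist (x + y) x)\<^sup>2 - t\<^sup>2) ((dist (x + y) x')\<^sup>2 - t\<^sup>2) \<partial>lborel)"
    by (rule nn_integral_lborel_shift[symmetric]) (use F' in measurable)
  also have "\<dots> = (\<integral>\<^sup>+y. F (perp_sq e y + (y \<bullet> e)\<^sup>2 - t\<^sup>2) (perp_sq e y + (y \<bullet> e - r)\<^sup>2 - t\<^sup>2) \<partial>lborel)"
  proof (rule nn_integral_cong)
    fix y
    have 1: "(dist (x + y) x)\<^sup>2 = perp_sq e y + (y \<bullet> e)\<^sup>2" by (simp add: dist_norm perp_sq_def)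
    have "x + y - x' = y - r *\<^sub>R e" using re by (simp add: algebra_simps)
    then have "dist (x + y) x' = norm (y - r *\<^sub>R e)" by (simp only: dist_norm)
    moreover have "(norm (y - r *\<^sub>R e))\<^sup>2 = (norm y)\<^sup>2 - 2 * r * (y \<bullet> e) + r\<^sup>2"
      using e unfolding power2_norm_eq_inner
      by (simp add: norm_eq_1 inner_diff_left inner_diff_right inner_commute[of e y] power2_eq_square algebra_simps)
    ultimately have 2: "(dist (x + y) x')\<^sup>2 = perp_sq e y + (y \<bullet> e - r)\<^sup>2"
      by (simp add: perp_sq_def power2_eq_square algebra_simps)
    show "F ((dist (x + y) x)\<^sup>2 - t\<^sup>2) ((dist (x + y) x')\<^sup>2 - t\<^sup>2) =
       F (perp_sq e y + (y \<bullet> e)\<^sup>2 - t\<^sup>2) (perp_sq e y + (y \<bullet> e - r)\<^sup>2 - t\<^sup>2)"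
      unfolding 1 2 ..
  qed
  also have "\<dots> = (\<integral>\<^sup>+v. (\<integral>\<^sup>+q. ennreal (?k * ?w q) * F (q + v\<^sup>2 - t\<^sup>2) (q + (v - r)\<^sup>2 - t\<^sup>2) \<partial>lborel) \<partial>lborel)"
    by (rule nn_integral_perp[OF e d, of "\<lambda>v q. F (q + v\<^sup>2 - t\<^sup>2) (q + (v - r)\<^sup>2 - t\<^sup>2)"])
      (unfold case_prod_unfold, intro F'; measurable)
  also have "\<dots> = (\<integral>\<^sup>+v. (\<integral>\<^sup>+\<alpha>. ennreal (?k * ?w (\<alpha> + t\<^sup>2 - v\<^sup>2)) * F \<alpha> (\<alpha> - 2 * r * v + r\<^sup>2) \<partial>lborel) \<partial>lborel)"
  proof (rule nn_integral_cong)
    fix v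
    let ?G = "\<lambda>q. ennreal (?k * ?w q) * F (q + v\<^sup>2 - t\<^sup>2) (q + (v - r)\<^sup>2 - t\<^sup>2)"
    have "(\<integral>\<^sup>+q. ?G q \<partial>lborel) = (\<integral>\<^sup>+\<alpha>. ?G ((t\<^sup>2 - v\<^sup>2) + \<alpha>) \<partial>lborel)"
      by (rule nn_integral_lborel_shift[symmetric]) (intro borel_measurable_times_ennreal F'; measurable)
    also have "\<dots> = (\<integral>\<^sup>+\<alpha>. ennreal (?k * ?w (\<alpha> + t\<^sup>2 - v\<^sup>2)) * F \<alpha> (\<alpha> - 2 * r * v + r\<^sup>2) \<partial>lborel)"
      by (intro nn_integral_cong) (simp add: algebra_simps power2_eq_square)
    finally show "(\<integral>\<^sup>+q. ?G q \<partial>lborel) = (\<integral>\<^sup>+\<alpha>. ennreal (?k * ?w (\<alpha> + t\<^sup>2 - v\<^sup>2)) * F \<alpha> (\<alpha> - 2 * r * v + r\<^sup>2) \<partial>lborel)" .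
  qed
  also have "\<dots> = (\<integral>\<^sup>+\<alpha>. (\<integral>\<^sup>+v. ennreal (?k * ?w (\<alpha> + t\<^sup>2 - v\<^sup>2)) * F \<alpha> (\<alpha> - 2 * r * v + r\<^sup>2) \<partial>lborel) \<partial>lborel)"
    by (rule lborel_pair.Fubini') (unfold case_prod_unfold, intro borel_measurable_times_ennreal F'; measurable)
  also have "\<dots> = (\<integral>\<^sup>+\<alpha>. (\<integral>\<^sup>+\<beta>. ennreal (?k / (2 * r) * two_center_weight TYPE('a) t r \<alpha> \<beta>) * F \<alpha> \<beta> \<partial>lborel) \<partial>lborel)"
  proof (rule nn_integral_cong)
    fix \<alpha>
    let ?G = "\<lambda>v. ennreal (?k * ?w (\<alpha> + t\<^sup>2 - v\<^sup>2)) * F \<alpha> (\<alpha> - 2 * r * v + r\<^sup>2)"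
    have G[measurable]: "?G \<in> borel_measurable borel"
      by (intro borel_measurable_times_ennreal F'; measurable)
    have "(\<integral>\<^sup>+v. ?G v \<partial>lborel) = ennreal \<bar>- 1 / (2 * r)\<bar> * (\<integral>\<^sup>+\<beta>. ?G ((\<alpha> + r\<^sup>2) / (2 * r) + (- 1 / (2 * r)) * \<beta>) \<partial>lborel)"
      by (rule nn_integral_real_affine[OF G]) (use r in simp)
    also have "\<dots> = (\<integral>\<^sup>+\<beta>. ennreal \<bar>- 1 / (2 * r)\<bar> * ?G ((\<alpha> + r\<^sup>2) / (2 * r) + (- 1 / (2 * r)) * \<beta>) \<partial>lborel)"
      by (rule nn_integral_cmult[symmetric], rule measurable_compose[OF _ G]) simp
    also have "\<dots> = (\<integral>\<^sup>+\<beta>. ennreal (?k / (2 * r) * two_center_weight TYPE('a) t r \<alpha> \<beta>) * F \<alpha> \<beta> \<partial>lborel)"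
    proof (rule nn_integral_cong)
      fix \<beta>
      have a: "(\<alpha> + r\<^sup>2) / (2 * r) + (- 1 / (2 * r)) * \<beta> = (\<alpha> - \<beta> + r\<^sup>2) / (2 * r)"
        using r by (simp add: field_simps)
      have b: "\<alpha> - 2 * r * ((\<alpha> - \<beta> + r\<^sup>2) / (2 * r)) + r\<^sup>2 = \<beta>" using r by (simp add: field_simps)
      have c: "\<bar>- 1 / (2 * r)\<bar> = 1 / (2 * r)" using r by simp
      have "ennreal (1 / (2 * r)) * ennreal (?k * ?w (\<alpha> + t\<^sup>2 - ((\<alpha> - \<beta> + r\<^sup>2) / (2 * r))\<^sup>2)) =
         ennreal (?k / (2 * r) * two_center_weight TYPE('a) t r \<alpha> \<beta>)"
        using r k0 by (subst ennreal_mult'[symmetric]) (auto simp: two_center_weight_def)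
      then show "ennreal \<bar>- 1 / (2 * r)\<bar> * ?G ((\<alpha> + r\<^sup>2) / (2 * r) + (- 1 / (2 * r)) * \<beta>) =
        ennreal (?k / (2 * r) * two_center_weight TYPE('a) t r \<alpha> \<beta>) * F \<alpha> \<beta>"
        unfolding a b c by (simp add: mult.assoc[symmetric])
    qed
    finally show "(\<integral>\<^sup>+v. ?G v \<partial>lborel) =
      (\<integral>\<^sup>+\<beta>. ennreal (?k / (2 * r) * two_center_weight TYPE('a) t r \<alpha> \<beta>) * F \<alpha> \<beta> \<partial>lborel)" .
  qed
  finally show ?thesis unfolding e_def .
qed

subsection \<open>Correlation of two kernels\<close>

text \<open>On the support of the kernel the weight is
  \<open>a powr \<kappa> * (1 - (z \<beta>)^2) powr \<kappa>\<close> with \<open>z\<close> affine in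
  \<open>\<beta>\<close> and of slope of order \<open>1/r\<close>. The kernel annihilates the Taylor
  polynomial of degree below \<open>M\<close>, and over a support of length \<open>1/2^j\<close> the
  remainder is of order \<open>(1 / (2^j * r))^M\<close>.\<close>

lemma two_center_weight_kern_bound:
  fixes T :: "'a::euclidean_space itself" and t :: real
  assumes t: "t > 0"
  shows "\<exists>C\<ge>0. \<forall>j r \<alpha>. 0 < r \<longrightarrow> r \<le> t/2 \<longrightarrow> 1/2^j \<le> r * t / 2 \<longrightarrow> \<alpha> \<in> {0..1/2^j} \<longrightarrow>
    \<bar>\<integral>\<beta>. kern M j \<beta> * two_center_weight T t r \<alpha> \<beta> \<partial>lborel\<bar> \<le> C * (1 / (2^j * r))^M"
proof -
  define \<kappa> where "\<kappa> = (real DIM('a) - 3) / 2"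
  obtain B where B: "\<And>z w. \<bar>z\<bar> \<le> 1/2 \<Longrightarrow> \<bar>w\<bar> \<le> 1/2 \<Longrightarrow>
     \<bar>(1 - z\<^sup>2) powr \<kappa> - (\<Sum>m<M. poly (taylor_poly \<kappa> m) w * (1 - w\<^sup>2) powr (\<kappa> - real m) / fact m * (z - w)^m)\<bar>
       \<le> B * \<bar>z - w\<bar>^M"
    using taylor_remainder_bound[of \<kappa> M] by blast
  have B0: "B \<ge> 0"
  proof -
    have "0 \<le> B * \<bar>1/2 - 0\<bar>^M" by (rule order_trans[OF abs_ge_zero B]) auto
    then show ?thesis using mult_neg_pos[of B "\<bar>1/2 - 0\<bar>^M"] by force
  qed
  \<comment> \<open>Bounds \<open>a powr \<kappa>\<close> for
    \<open>t^2 \<le> a \<le> t^2 + 1\<close>: the first summand serves negative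
    \<open>\<kappa>\<close>, as in dimension 2, and the second
    \<open>\<kappa> \<ge> 0\<close>.\<close>
  define A where "A = (t\<^sup>2) powr \<kappa> + (t\<^sup>2 + 1) powr \<kappa>"
  have "\<bar>\<integral>\<beta>. kern M j \<beta> * two_center_weight T t r \<alpha> \<beta> \<partial>lborel\<bar> \<le> A * (3^M * (B / (2 * t)^M)) * (1 / (2^j * r))^M"
    if r: "0 < r" "r \<le> t/2" and j: "1/2^j \<le> r * t / 2" and \<alpha>: "\<alpha> \<in> {0..1/2^j}" for j :: nat and r \<alpha> :: real
  proof -
    let ?\<delta> = "1/2^j :: real"
    define a where "a = \<alpha> + t\<^sup>2"
    have d1: "?\<delta> \<le> 1" by (simp add: field_simps)
    have a: "a > 0" "t\<^sup>2 \<le> a" "a \<le> t\<^sup>2 + 1"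
      using \<alpha> d1 zero_less_power[OF t, of 2] unfolding a_def atLeastAtMost_iff by linarith+
    have sa: "sqrt a \<ge> t" using a t by (simp add: real_le_rsqrt)
    then have sa0: "sqrt a > 0" using t by linarith
    have aA: "a powr \<kappa> \<le> A"
    proof (cases "\<kappa> \<ge> 0")
      case True
      have "a powr \<kappa> \<le> (t\<^sup>2 + 1) powr \<kappa>" using a True by (intro powr_mono2) auto
      then show ?thesis unfolding A_def by (simp add: add_increasing)
    next
      case False
      have "a powr \<kappa> \<le> (t\<^sup>2) powr \<kappa>" using a False t by (intro powr_mono2') auto
      then show ?thesis unfolding A_def by (simp add: add_increasing2)
    qed
    define z where "z = (\<lambda>\<beta>. (\<alpha> - \<beta> + r\<^sup>2) / (2 * r) / sqrt a)"
    \<comment> \<open>The condition on \<open>j\<close> bounds \<open>|\<alpha> - \<beta>|\<close>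
      and the condition on \<open>r\<close> bounds \<open>r^2\<close>, each by
      \<open>r * t / 2\<close>. Since \<open>sqrt a \<ge> t\<close>, division by
      \<open>2 * r * sqrt a\<close> leaves at most 1/2.\<close>
    have zle: "\<bar>z \<beta>\<bar> \<le> 1/2" if "\<beta> \<in> {0..?\<delta>}" for \<beta>
    proof -
      have "\<bar>\<alpha> - \<beta>\<bar> \<le> ?\<delta>" using that \<alpha> by auto
      then have "\<bar>\<alpha> - \<beta>\<bar> \<le> r * (t/2)" using j by linarith
      moreover have "r\<^sup>2 \<le> r * (t/2)" using r by (simp add: power2_eq_square)
      ultimately have "\<bar>\<alpha> - \<beta> + r\<^sup>2\<bar> \<le> r * t" using abs_triangle_ineq[of "\<alpha> - \<beta>" "r\<^sup>2"] abs_of_nonneg[of "r\<^sup>2"] by simp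
      also have "\<dots> \<le> r * sqrt a" using sa r by simp
      finally show ?thesis using r sa0 by (simp add: z_def field_simps abs_mult)
    qed
    \<comment> \<open>Expansion about \<open>z 0\<close>, the value at \<open>\<beta> = 0\<close>:
      the powers of \<open>z \<beta> - z 0\<close> are then multiples of the monomials
      \<open>\<beta>^m\<close>, whose moments vanish.\<close>
    define c where "c = (\<lambda>m. poly (taylor_poly \<kappa> m) (z 0) * (1 - (z 0)\<^sup>2) powr (\<kappa> - real m) / fact m)"
    let ?P = "\<lambda>\<beta>. \<Sum>m<M. c m * (- 1 / (2 * r * sqrt a))^m * \<beta>^m"
    have zdiff: "z \<beta> - z 0 = - 1 / (2 * r * sqrt a) * \<beta>" for \<beta>
      using r sa0 by (simp add: z_def field_simps)
    have rem: "\<bar>(1 - (z \<beta>)\<^sup>2) powr \<kappa> - ?P \<beta>\<bar> \<le> B / (2 * t)^M * (1 / (2^j * r))^M" if b: "\<beta> \<in> {0..?\<delta>}" for \<beta>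
    proof -
      have "\<bar>(1 - (z \<beta>)\<^sup>2) powr \<kappa> - (\<Sum>m<M. c m * (z \<beta> - z 0)^m)\<bar> \<le> B * \<bar>z \<beta> - z 0\<bar>^M"
        unfolding c_def using B[OF zle[OF b] zle, of 0] by simp
      also have "(\<Sum>m<M. c m * (z \<beta> - z 0)^m) = ?P \<beta>"
        unfolding zdiff by (simp only: power_mult_distrib mult.assoc)
      also have "B * \<bar>z \<beta> - z 0\<bar>^M \<le> B * (?\<delta> / (2 * t * r))^M"
      proof (intro mult_left_mono[OF _ B0] power_mono)
        have "\<bar>z \<beta> - z 0\<bar> = \<beta> / (2 * sqrt a * r)"
          unfolding zdiff using r sa0 b by (simp add: abs_mult)
        also have "\<dots> \<le> ?\<delta> / (2 * t * r)"
          using b r sa t by (intro frac_le mult_right_mono) auto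
        finally show "\<bar>z \<beta> - z 0\<bar> \<le> ?\<delta> / (2 * t * r)" .
      qed simp
      also have "B * (?\<delta> / (2 * t * r))^M = B / (2 * t)^M * (1 / (2^j * r))^M"
        by (simp add: power_divide power_mult_distrib)
      finally show ?thesis .
    qed
    have z1: "1 - (z \<beta>)\<^sup>2 > 0" if "\<beta> \<in> {0..?\<delta>}" for \<beta>
      using zle[OF that] abs_square_less_1[of "z \<beta>"] by simp
    have weq: "kern M j \<beta> * two_center_weight T t r \<alpha> \<beta> = a powr \<kappa> * (kern M j \<beta> * (1 - (z \<beta>)\<^sup>2) powr \<kappa>)" for \<beta>
    proof (cases "\<beta> \<in> {0..?\<delta>}")
      case True
      have "a - ((\<alpha> - \<beta> + r\<^sup>2) / (2 * r))\<^sup>2 = a * (1 - (z \<beta>)\<^sup>2)"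
        using a(1) r by (simp add: z_def power_divide algebra_simps)
      then have "two_center_weight T t r \<alpha> \<beta> = a powr \<kappa> * (1 - (z \<beta>)\<^sup>2) powr \<kappa>"
        using z1[OF True] a(1)
        by (simp add: two_center_weight_def pow_weight_def a_def[symmetric] \<kappa>_def[symmetric] powr_mult)
      then show ?thesis by simp
    qed (simp add: kern_eq_0)
    have zc: "continuous_on {0..?\<delta>} z" unfolding z_def using r sa0 by (intro continuous_intros) auto
    have gc: "continuous_on {0..?\<delta>} (\<lambda>\<beta>. (1 - (z \<beta>)\<^sup>2) powr \<kappa>)"
      using z1 by (intro continuous_intros zc) (auto simp: less_imp_neq)
    have Pc: "continuous_on {0..?\<delta>} ?P" by (intro continuous_intros)
    have "(\<integral>\<beta>. kern M j \<beta> * ?P \<beta> \<partial>lborel) = (\<integral>\<beta>. (\<Sum>m<M. c m * (- 1 / (2 * r * sqrt a))^m * (kern M j \<beta> * \<beta>^m)) \<partial>lborel)"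
      by (intro Bochner_Integration.integral_cong) (simp_all add: sum_distrib_left mult_ac)
    also have "\<dots> = (\<Sum>m<M. c m * (- 1 / (2 * r * sqrt a))^m * (\<integral>\<beta>. kern M j \<beta> * \<beta>^m \<partial>lborel))"
      by (subst Bochner_Integration.integral_sum)
        (auto intro!: integrable_mult_right integrable_kern_times continuous_intros)
    also have "\<dots> = 0" by (simp add: kern_moment_eq_0)
    finally have P0: "(\<integral>\<beta>. kern M j \<beta> * ?P \<beta> \<partial>lborel) = 0" .
    have "(\<integral>\<beta>. kern M j \<beta> * two_center_weight T t r \<alpha> \<beta> \<partial>lborel) =
        a powr \<kappa> * (\<integral>\<beta>. kern M j \<beta> * (1 - (z \<beta>)\<^sup>2) powr \<kappa> \<partial>lborel)"
      unfolding weq by simp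
    also have "(\<integral>\<beta>. kern M j \<beta> * (1 - (z \<beta>)\<^sup>2) powr \<kappa> \<partial>lborel) =
       (\<integral>\<beta>. kern M j \<beta> * (1 - (z \<beta>)\<^sup>2) powr \<kappa> - kern M j \<beta> * ?P \<beta> \<partial>lborel)"
      using P0 Bochner_Integration.integral_diff[OF integrable_kern_times[OF gc] integrable_kern_times[OF Pc]] by simp
    also have "\<dots> = (\<integral>\<beta>. kern M j \<beta> * ((1 - (z \<beta>)\<^sup>2) powr \<kappa> - ?P \<beta>) \<partial>lborel)"
      by (simp only: right_diff_distrib)
    finally have "\<bar>\<integral>\<beta>. kern M j \<beta> * two_center_weight T t r \<alpha> \<beta> \<partial>lborel\<bar> =
      a powr \<kappa> * \<bar>\<integral>\<beta>. kern M j \<beta> * ((1 - (z \<beta>)\<^sup>2) powr \<kappa> - ?P \<beta>) \<partial>lborel\<bar>" by (simp add: abs_mult)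
    also have "\<dots> \<le> A * (3^M * (B / (2 * t)^M * (1 / (2^j * r))^M))"
      by (intro mult_mono aA abs_integral_kern_times_le rem continuous_intros gc) (auto simp: A_def)
    finally show ?thesis by (simp add: mult.assoc)
  qed
  moreover have "A * (3^M * (B / (2 * t)^M)) \<ge> 0" using B0 t by (simp add: A_def)
  ultimately show ?thesis by blast
qed

section \<open>Volumes of thin shells\<close>

lemma measure_annulus_le:
  fixes y :: "'a::euclidean_space"
  assumes "0 \<le> a" "a \<le> b"
  shows "measure lborel (cball y b - ball y a) \<le>
    unit_ball_vol (real DIM('a)) * (real DIM('a) * b ^ (DIM('a) - 1) * (b - a))"
proof -
  have pow: "b^n - a^n \<le> real n * b^(n-1) * (b - a)" for n
  proof (induction n)
    case (Suc n)
    have "b^Suc n - a^Suc n = b * (b^n - a^n) + a^n * (b - a)" by (simp add: algebra_simps)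
    also have "\<dots> \<le> b * (real n * b^(n-1) * (b - a)) + b^n * (b - a)"
      using assms Suc by (intro add_mono mult_left_mono mult_right_mono power_mono) auto
    also have "\<dots> = real (Suc n) * b^n * (b - a)"
      by (cases n) (simp_all add: algebra_simps)
    finally show ?case by simp
  qed simp
  have "measure lborel (cball y b - ball y a) = measure lborel (cball y b) - measure lborel (ball y a)"
    using assms emeasure_lborel_cball_finite[of y b] emeasure_lborel_ball_finite[of y a]
    by (intro measure_Diff) auto
  also have "\<dots> = unit_ball_vol (real DIM('a)) * (b^DIM('a) - a^DIM('a))"
    using assms by (simp add: content_cball content_ball algebra_simps)
  also have "\<dots> \<le> unit_ball_vol (real DIM('a)) * (real DIM('a) * b ^ (DIM('a) - 1) * (b - a))"
    by (intro mult_left_mono pow) simp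
  finally show ?thesis .
qed

text \<open>Sampling \<open>|y - x|\<^sup>2 - t\<^sup>2\<close> instead of \<open>|y - x| - t\<close> makes all substitutions for two centres linear.\<close>

definition shell_kern :: "nat \<Rightarrow> nat \<Rightarrow> real \<Rightarrow> 'a::euclidean_space \<Rightarrow> 'a \<Rightarrow> real" where
  "shell_kern m j t x y = kern m j ((dist y x)\<^sup>2 - t\<^sup>2)"

definition shell :: "nat \<Rightarrow> real \<Rightarrow> 'a::euclidean_space \<Rightarrow> 'a set" where
  "shell j t x = {y. (dist y x)\<^sup>2 - t\<^sup>2 \<in> {0..1/2^j}}"

lemma shell_measurable [measurable]: "shell j t x \<in> sets borel"
  unfolding shell_def by measurable

lemma shell_kern_measurable [measurable]: "shell_kern m j t x \<in> borel_measurable borel"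
  unfolding shell_kern_def[abs_def] by measurable

lemma abs_shell_kern_le: "\<bar>shell_kern m j t x y\<bar> \<le> 3^m * 2^j * indicator (shell j t x) y"
  using abs_kern_le_indicator[of m j "(dist y x)\<^sup>2 - t\<^sup>2"]
  by (simp add: shell_kern_def shell_def indicator_def)

lemma shell_outer_radius:
  assumes "t > 0"
  shows "sqrt (t\<^sup>2 + 1/2^j) \<le> t + 1 / (2^j * t)" "sqrt (t\<^sup>2 + 1/2^j) \<le> t + 1"
proof -
  have "(t + 1 / (2^j * t))\<^sup>2 = t\<^sup>2 + 2 / 2^j + (1 / (2^j * t))\<^sup>2"
    using assms by (simp add: power2_eq_square field_simps)
  then have "t\<^sup>2 + 1/2^j \<le> (t + 1 / (2^j * t))\<^sup>2" by (simp add: field_simps)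
  then show "sqrt (t\<^sup>2 + 1/2^j) \<le> t + 1 / (2^j * t)"
    using assms by (intro real_le_lsqrt) auto
  have "(1::real) / 2^j \<le> 1" by (simp add: field_simps)
  moreover have "(t + 1)\<^sup>2 = t\<^sup>2 + 2 * t + 1" by (simp add: power2_eq_square algebra_simps)
  ultimately have "t\<^sup>2 + 1/2^j \<le> (t + 1)\<^sup>2" using assms by linarith
  then show "sqrt (t\<^sup>2 + 1/2^j) \<le> t + 1"
    using assms by (intro real_le_lsqrt) auto
qed

lemma shell_subset_annulus:
  assumes "t > 0"
  shows "shell j t x \<subseteq> cball x (sqrt (t\<^sup>2 + 1/2^j)) - ball x t"
proof
  fix y assume "y \<in> shell j t x"
  then have "t\<^sup>2 \<le> (dist y x)\<^sup>2" "(dist y x)\<^sup>2 \<le> t\<^sup>2 + 1/2^j" by (auto simp: shell_def)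
  then have "t \<le> dist y x" "dist y x \<le> sqrt (t\<^sup>2 + 1/2^j)"
    using assms by (auto intro: power2_le_imp_le real_le_rsqrt)
  then show "y \<in> cball x (sqrt (t\<^sup>2 + 1/2^j)) - ball x t" by (auto simp: dist_commute)
qed

text \<open>The annulus bound for outer radius at most \<open>t + 1\<close> and width at most
  \<open>1 / (2^j * t)\<close>, with the factor \<open>1/2^j\<close> taken out.\<close>

definition shell_vol_const :: "'a::euclidean_space itself \<Rightarrow> real \<Rightarrow> real" where
  "shell_vol_const T t = unit_ball_vol (real DIM('a)) * (real DIM('a) * (t + 1) ^ (DIM('a) - 1) * (1 / t))"

lemma measure_shell_le:
  fixes x :: "'a::euclidean_space"
  assumes "t > 0"
  shows "measure lborel (shell j t x) \<le> shell_vol_const TYPE('a) t / 2^j"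
proof -
  let ?b = "sqrt (t\<^sup>2 + 1/2^j)"
  have b: "t \<le> ?b" by (rule real_le_rsqrt) simp
  have "measure lborel (shell j t x) \<le> measure lborel (cball x ?b - ball x t)"
  proof (rule measure_mono_fmeasurable[OF shell_subset_annulus[OF assms]])
    show "cball x ?b - ball x t \<in> fmeasurable lborel"
      by (intro fmeasurable.Diff fmeasurableI emeasure_lborel_cball_finite emeasure_lborel_ball_finite) auto
  qed simp
  also have "\<dots> \<le> unit_ball_vol (real DIM('a)) * (real DIM('a) * ?b ^ (DIM('a) - 1) * (?b - t))"
    using assms b by (intro measure_annulus_le) auto
  also have "\<dots> \<le> unit_ball_vol (real DIM('a)) * (real DIM('a) * (t + 1) ^ (DIM('a) - 1) * (1 / (2^j * t)))"
    using shell_outer_radius[OF assms, of j] b assms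
    by (intro mult_left_mono mult_mono power_mono) auto
  finally show ?thesis by (simp add: shell_vol_const_def mult_ac)
qed

lemma emeasure_shell_finite:
  assumes "t > 0"
  shows "emeasure lborel (shell j t x) < \<infinity>"
  using emeasure_mono[of "shell j t x" "cball x (sqrt (t\<^sup>2 + 1/2^j))" lborel] shell_subset_annulus[OF assms]
    emeasure_lborel_cball_finite[of x "sqrt (t\<^sup>2 + 1/2^j)"]
  by (auto intro: le_less_trans)

lemma shell_vol_const_nonneg: "t > 0 \<Longrightarrow> shell_vol_const T t \<ge> 0"
  by (simp add: shell_vol_const_def)

lemma integrable_shell_indicator: "t > 0 \<Longrightarrow> integrable lborel (indicator (shell j t x) :: _ \<Rightarrow> real)"
  using emeasure_shell_finite by (intro integrable_real_indicator) auto

lemma integrable_shell_kern_mult: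
  assumes t: "t > 0"
  shows "integrable lborel (\<lambda>y. shell_kern m j t x y * shell_kern m j t x' y)"
proof (rule Bochner_Integration.integrable_bound)
  show "integrable lborel (\<lambda>y. (3^m * 2^j)\<^sup>2 * indicator (shell j t x) y :: real)"
    using integrable_shell_indicator[OF t] by (rule integrable_mult_right)
  show "AE y in lborel. norm (shell_kern m j t x y * shell_kern m j t x' y)
      \<le> norm ((3^m * 2^j)\<^sup>2 * indicator (shell j t x) y :: real)"
  proof (rule AE_I2)
    fix y
    have "\<bar>shell_kern m j t x' y\<bar> \<le> 3^m * 2^j"
      unfolding shell_kern_def by (rule abs_kern_le)
    then have "\<bar>shell_kern m j t x y\<bar> * \<bar>shell_kern m j t x' y\<bar> \<le> (3^m * 2^j * indicator (shell j t x) y) * (3^m * 2^j)"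
      by (intro mult_mono abs_shell_kern_le) auto
    then show "norm (shell_kern m j t x y * shell_kern m j t x' y) \<le> norm ((3^m * 2^j)\<^sup>2 * indicator (shell j t x) y :: real)"
      by (simp add: abs_mult power2_eq_square mult_ac)
  qed
qed measurable

definition kern_corr :: "nat \<Rightarrow> nat \<Rightarrow> real \<Rightarrow> 'a::euclidean_space \<Rightarrow> 'a \<Rightarrow> real" where
  "kern_corr m j t x x' = (\<integral>y. shell_kern m j t x y * shell_kern m j t x' y \<partial>lborel)"

text \<open>Two kernels of size \<open>3^m * 2^j\<close> on a shell of volume of order
  \<open>1/2^j\<close>. This is for centres too close to each other for the moments to help.\<close>

lemma kern_corr_trivial_bound:
  fixes x x' :: "'a::euclidean_space"
  assumes t: "t > 0"
  shows "\<bar>kern_corr m j t x x'\<bar> \<le> 9^m * shell_vol_const TYPE('a) t * 2^j"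
proof -
  have "\<bar>kern_corr m j t x x'\<bar> \<le> (\<integral>y. \<bar>shell_kern m j t x y * shell_kern m j t x' y\<bar> \<partial>lborel)"
    unfolding kern_corr_def by (rule integral_abs_bound)
  also have "\<dots> \<le> (\<integral>y. (3^m * 2^j)\<^sup>2 * indicator (shell j t x) y \<partial>lborel)"
  proof (rule integral_mono)
    show "integrable lborel (\<lambda>y. \<bar>shell_kern m j t x y * shell_kern m j t x' y\<bar>)"
      by (intro integrable_abs integrable_shell_kern_mult t)
    show "integrable lborel (\<lambda>y. (3^m * 2^j)\<^sup>2 * indicator (shell j t x) y :: real)"
      using integrable_shell_indicator[OF t] by (rule integrable_mult_right)
    fix y
    have "\<bar>shell_kern m j t x' y\<bar> \<le> 3^m * 2^j"
      unfolding shell_kern_def by (rule abs_kern_le)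
    then have "\<bar>shell_kern m j t x y\<bar> * \<bar>shell_kern m j t x' y\<bar> \<le> (3^m * 2^j * indicator (shell j t x) y) * (3^m * 2^j)"
      by (intro mult_mono abs_shell_kern_le) auto
    then show "\<bar>shell_kern m j t x y * shell_kern m j t x' y\<bar> \<le> (3^m * 2^j)\<^sup>2 * indicator (shell j t x) y"
      by (simp add: abs_mult power2_eq_square mult_ac)
  qed
  also have "\<dots> = (3^m * 2^j)\<^sup>2 * measure lborel (shell j t x)" by simp
  also have "\<dots> \<le> (3^m * 2^j)\<^sup>2 * (shell_vol_const TYPE('a) t / 2^j)"
    by (intro mult_left_mono measure_shell_le t) simp
  also have "\<dots> = 9^m * shell_vol_const TYPE('a) t * 2^j"
  proof -
    have "(9::real)^m = 3^m * 3^m" by (simp flip: power_mult_distrib)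
    then show ?thesis by (simp add: power2_eq_square)
  qed
  finally show ?thesis .
qed

text \<open>The two-centre formula is available for nonnegative integrands, while the kernels change
  sign. Applied to indicators it becomes an identity between measures, which carries over to
  integrable functions; Fubini then separates the variables.\<close>

lemma kern_corr_eq:
  fixes x x' :: "'a::euclidean_space"
  assumes t: "t > 0" and d: "DIM('a) \<ge> 2" and r: "r = dist x x'" "r > 0"
  defines "c \<equiv> slab_const ((x' - x) /\<^sub>R r) / (2 * r)"
  shows "kern_corr m j t x x' =
     c * (\<integral>\<alpha>. kern m j \<alpha> * (\<integral>\<beta>. kern m j \<beta> * two_center_weight TYPE('a) t r \<alpha> \<beta> \<partial>lborel) \<partial>lborel)"
proof -
  let ?w = "two_center_weight TYPE('a) t r"
  let ?T = "\<lambda>y. ((dist y x)\<^sup>2 - t\<^sup>2, (dist y x')\<^sup>2 - t\<^sup>2)"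
  let ?L = "lborel :: real measure"
  let ?K = "\<lambda>p. kern m j (fst p) * kern m j (snd p)"
  let ?W = "\<lambda>p. c * ?w (fst p) (snd p)"
  have c0: "c \<ge> 0" unfolding c_def using slab_const_nonneg[OF d] r by simp
  have w0: "?w \<alpha> \<beta> \<ge> 0" for \<alpha> \<beta> by (simp add: two_center_weight_def pow_weight_nonneg)
  have W0: "?W p \<ge> 0" for p using c0 w0 by simp
  have sets: "sets (?L \<Otimes>\<^sub>M ?L) = sets (borel \<Otimes>\<^sub>M borel)" by (intro sets_pair_measure_cong) auto
  have Tm': "?T \<in> lborel \<rightarrow>\<^sub>M ?L \<Otimes>\<^sub>M ?L"
    unfolding measurable_cong_sets[OF refl sets] by measurable
  have Km': "?K \<in> borel_measurable (?L \<Otimes>\<^sub>M ?L)" by measurable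
  have Wm': "?W \<in> borel_measurable (?L \<Otimes>\<^sub>M ?L)"
    unfolding two_center_weight_def by measurable
  have D: "distr lborel (?L \<Otimes>\<^sub>M ?L) ?T = density (?L \<Otimes>\<^sub>M ?L) (\<lambda>p. ennreal (?W p))"
  proof (rule measure_eqI)
    fix A assume "A \<in> sets (distr lborel (?L \<Otimes>\<^sub>M ?L) ?T)"
    then have A': "A \<in> sets (?L \<Otimes>\<^sub>M ?L)" by simp
    then have A[measurable]: "A \<in> sets (borel \<Otimes>\<^sub>M borel)" by (simp only: sets)
    have iA: "(indicator A :: _ \<Rightarrow> ennreal) \<in> borel_measurable (?L \<Otimes>\<^sub>M ?L)"
      using A' by (rule borel_measurable_indicator)
    have "emeasure (distr lborel (?L \<Otimes>\<^sub>M ?L) ?T) A = (\<integral>\<^sup>+p. indicator A p \<partial>distr lborel (?L \<Otimes>\<^sub>M ?L) ?T)"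
      using A' by (subst nn_integral_indicator) auto
    also have "\<dots> = (\<integral>\<^sup>+y. indicator A (?T y) \<partial>lborel)"
      by (rule nn_integral_distr[OF Tm']) (use iA in simp)
    also have "\<dots> = (\<integral>\<^sup>+\<alpha>. (\<integral>\<^sup>+\<beta>. ennreal (c * ?w \<alpha> \<beta>) * indicator A (\<alpha>, \<beta>) \<partial>lborel) \<partial>lborel)"
      unfolding c_def by (rule nn_integral_two_centers[OF d r, of "\<lambda>\<alpha> \<beta>. indicator A (\<alpha>, \<beta>)"]) simp
    also have "\<dots> = (\<integral>\<^sup>+\<alpha>. (\<integral>\<^sup>+\<beta>. ennreal (?W (\<alpha>, \<beta>)) * indicator A (\<alpha>, \<beta>) \<partial>lborel) \<partial>lborel)"
      by simp
    also have "\<dots> = (\<integral>\<^sup>+p. ennreal (?W p) * indicator A p \<partial>(?L \<Otimes>\<^sub>M ?L))"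
      by (rule lborel.nn_integral_fst) (intro borel_measurable_times_ennreal iA measurable_compose[OF Wm'] measurable_ennreal)
    also have "\<dots> = emeasure (density (?L \<Otimes>\<^sub>M ?L) (\<lambda>p. ennreal (?W p))) A"
      by (rule emeasure_density[OF measurable_compose[OF Wm' measurable_ennreal] A', symmetric])
    finally show "emeasure (distr lborel (?L \<Otimes>\<^sub>M ?L) ?T) A = \<dots>" .
  qed simp
  have corr: "kern_corr m j t x x' = (\<integral>y. ?K (?T y) \<partial>lborel)"
    by (simp add: kern_corr_def shell_kern_def)
  have "integrable lborel (\<lambda>y. ?K (?T y))"
    using integrable_shell_kern_mult[OF t, of m j x x'] by (simp add: shell_kern_def)
  then have "integrable (distr lborel (?L \<Otimes>\<^sub>M ?L) ?T) ?K"
    by (simp only: integrable_distr_eq[OF Tm' Km'])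
  then have int: "integrable (?L \<Otimes>\<^sub>M ?L) (\<lambda>p. ?W p *\<^sub>R ?K p)"
    unfolding D integrable_density[OF Km' Wm' AE_I2[OF W0]] .
  have "kern_corr m j t x x' = (\<integral>p. ?K p \<partial>distr lborel (?L \<Otimes>\<^sub>M ?L) ?T)"
    unfolding corr by (rule integral_distr[OF Tm' Km', symmetric])
  also have "\<dots> = (\<integral>p. ?W p *\<^sub>R ?K p \<partial>(?L \<Otimes>\<^sub>M ?L))"
    unfolding D by (rule integral_density[OF Km' Wm' AE_I2[OF W0]])
  also have "\<dots> = (\<integral>\<alpha>. (\<integral>\<beta>. ?W (\<alpha>, \<beta>) *\<^sub>R ?K (\<alpha>, \<beta>) \<partial>lborel) \<partial>lborel)"
    by (rule lborel_pair.integral_fst'[OF int, symmetric])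
  also have "\<dots> = (\<integral>\<alpha>. c * (kern m j \<alpha> * (\<integral>\<beta>. kern m j \<beta> * ?w \<alpha> \<beta> \<partial>lborel)) \<partial>lborel)"
  proof (rule Bochner_Integration.integral_cong[OF refl])
    fix \<alpha>
    have "(\<integral>\<beta>. ?W (\<alpha>, \<beta>) *\<^sub>R ?K (\<alpha>, \<beta>) \<partial>lborel) =
      (\<integral>\<beta>. (c * kern m j \<alpha>) * (kern m j \<beta> * ?w \<alpha> \<beta>) \<partial>lborel)"
      by (intro Bochner_Integration.integral_cong) (auto simp: mult_ac)
    then show "(\<integral>\<beta>. ?W (\<alpha>, \<beta>) *\<^sub>R ?K (\<alpha>, \<beta>) \<partial>lborel) =
       c * (kern m j \<alpha> * (\<integral>\<beta>. kern m j \<beta> * ?w \<alpha> \<beta> \<partial>lborel))"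
      by (simp add: mult.assoc)
  qed
  finally show ?thesis by simp
qed

text \<open>With \<open>R = 2^j * dist x x'\<close>, the moments in \<open>\<beta>\<close> gain
  \<open>1/R^M\<close>, and the Jacobian \<open>1/r = 2^j / R\<close> supplies the last power. The
  \<open>\<alpha>\<close> integral is estimated by absolute values. For small \<open>R\<close> the
  trivial bound suffices.\<close>

lemma kern_corr_bound:
  assumes t: "t > 0" and d: "DIM('a::euclidean_space) \<ge> 2"
  shows "\<exists>C\<ge>0. \<forall>j (x::'a) x'. dist x x' \<le> t/2 \<longrightarrow>
     \<bar>kern_corr M j t x x'\<bar> \<le> C * 2^j / (1 + 2^j * dist x x')^Suc M"
proof -
  obtain C where C: "C \<ge> 0" "\<And>j r \<alpha>. 0 < r \<Longrightarrow> r \<le> t/2 \<Longrightarrow> 1/2^j \<le> r * t / 2 \<Longrightarrow> \<alpha> \<in> {0..1/2^j} \<Longrightarrow>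
    \<bar>\<integral>\<beta>. kern M j \<beta> * two_center_weight TYPE('a) t r \<alpha> \<beta> \<partial>lborel\<bar> \<le> C * (1 / (2^j * r))^M"
    using two_center_weight_kern_bound[OF t, where 'a='a and M=M] by blast
  define K where "K = real DIM('a) * measure lborel (cball (0::'a) (sqrt 2))"
  have K0: "K \<ge> 0" by (simp add: K_def)
  define D where "D = K / 2 * (C * 3^M)"
  define E where "E = 9^M * shell_vol_const TYPE('a) t"
  have D0: "D \<ge> 0" using K0 C by (simp add: D_def)
  have E0: "E \<ge> 0" by (simp add: E_def shell_vol_const_nonneg[OF t])
  have "\<bar>kern_corr M j t x x'\<bar> \<le> (D * (1 + t/2)^Suc M + E * (1 + 2/t)^Suc M) * 2^j / (1 + 2^j * dist x x')^Suc M"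
    if rt: "dist x x' \<le> t/2" for j and x x' :: 'a
  proof -
    define r where "r = dist x x'"
    define R where "R = 2^j * r"
    have R0: "R \<ge> 0" by (simp add: R_def r_def)
    show ?thesis
    \<comment> \<open>The threshold \<open>2/t\<close> is the condition
      \<open>1/2^j \<le> r * t / 2\<close> of the moment bound, rewritten for
      \<open>R\<close>.\<close>
    proof (cases "R \<ge> 2/t")
      case True
      then have Rpos: "R > 0" using t by (smt (verit) divide_pos_pos)
      then have r0: "r > 0" by (simp add: R_def zero_less_mult_iff)
      have j: "1/2^j \<le> r * t / 2" using True t by (simp add: R_def field_simps)
      let ?s = "slab_const ((x' - x) /\<^sub>R r)"
      let ?I = "\<lambda>\<alpha>. (\<integral>\<beta>. kern M j \<beta> * two_center_weight TYPE('a) t r \<alpha> \<beta> \<partial>lborel)"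
      have ne: "norm ((x' - x) /\<^sub>R r) = 1" using r0 by (simp add: r_def dist_norm norm_minus_commute)
      have "\<bar>\<integral>\<alpha>. kern M j \<alpha> * ?I \<alpha> \<partial>lborel\<bar> \<le> (\<integral>\<alpha>. C * (1/R)^M * \<bar>kern M j \<alpha>\<bar> \<partial>lborel)"
      proof (rule order_trans[OF integral_abs_bound integral_mono_AE'])
        show "integrable lborel (\<lambda>\<alpha>. C * (1/R)^M * \<bar>kern M j \<alpha>\<bar>)"
          using integrable_kern_times[of j "\<lambda>_. 1" M] by simp
        show "AE \<alpha> in lborel. \<bar>kern M j \<alpha> * ?I \<alpha>\<bar> \<le> C * (1/R)^M * \<bar>kern M j \<alpha>\<bar>"
        proof (rule AE_I2)
          fix \<alpha>
          show "\<bar>kern M j \<alpha> * ?I \<alpha>\<bar> \<le> C * (1/R)^M * \<bar>kern M j \<alpha>\<bar>"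
          proof (cases "\<alpha> \<in> {0..1/2^j}")
            case True
            have "\<bar>?I \<alpha>\<bar> \<le> C * (1/R)^M"
              using C(2)[OF r0 _ j True] rt by (simp add: r_def R_def)
            then show ?thesis by (simp add: abs_mult mult.commute[of "\<bar>kern M j \<alpha>\<bar>"] mult_right_mono)
          qed (simp add: kern_eq_0)
        qed
      qed (use C(1) Rpos in auto)
      also have "\<dots> = C * (1/R)^M * (\<integral>\<alpha>. \<bar>kern M j \<alpha>\<bar> \<partial>lborel)" by simp
      also have "\<dots> \<le> C * (1/R)^M * 3^M"
        using C(1) Rpos by (intro mult_left_mono integral_abs_kern_le) auto
      finally have I: "\<bar>\<integral>\<alpha>. kern M j \<alpha> * ?I \<alpha> \<partial>lborel\<bar> \<le> C * (1/R)^M * 3^M" .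
      have "\<bar>kern_corr M j t x x'\<bar> = ?s / (2 * r) * \<bar>\<integral>\<alpha>. kern M j \<alpha> * ?I \<alpha> \<partial>lborel\<bar>"
        using kern_corr_eq[OF t d r_def r0] r0 slab_const_nonneg[OF d] by (simp add: abs_mult)
      also have "\<dots> \<le> K / (2 * r) * (C * (1/R)^M * 3^M)"
        using slab_const_le[OF ne] r0 I K0 by (intro mult_mono divide_right_mono) (auto simp: K_def)
      also have "\<dots> = D * 2^j / R^Suc M"
        using r0 by (simp add: D_def R_def power_divide)
      also have "\<dots> \<le> D * 2^j * ((1 + t/2)^Suc M / (1 + R)^Suc M)"
      proof -
        have "1 \<le> R * t / 2" using True t by (simp add: field_simps)
        then have "1 + R \<le> (1 + t/2) * R" by (simp add: algebra_simps)
        then have "(1 + R)^Suc M \<le> ((1 + t/2) * R)^Suc M" using R0 by (intro power_mono) auto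
        then have "(1 + R)^Suc M \<le> (1 + t/2)^Suc M * R^Suc M" by (simp only: power_mult_distrib)
        then have "1 / R^Suc M \<le> (1 + t/2)^Suc M / (1 + R)^Suc M"
          using Rpos by (simp add: divide_simps del: power_Suc) (simp add: mult_ac)
        then have "D * 2^j * (1 / R^Suc M) \<le> D * 2^j * ((1 + t/2)^Suc M / (1 + R)^Suc M)"
          using D0 by (intro mult_left_mono) auto
        then show ?thesis by simp
      qed
      also have "\<dots> \<le> (D * (1 + t/2)^Suc M + E * (1 + 2/t)^Suc M) * 2^j / (1 + R)^Suc M"
        using E0 t R0 by (simp add: divide_right_mono algebra_simps del: power_Suc)
      finally show ?thesis by (simp add: R_def r_def)
    next
      case False
      have "\<bar>kern_corr M j t x x'\<bar> \<le> E * 2^j * 1"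
        using kern_corr_trivial_bound[OF t, of M j x x'] by (simp add: E_def)
      also have "\<dots> \<le> E * 2^j * ((1 + 2/t)^Suc M / (1 + R)^Suc M)"
      proof (intro mult_left_mono)
        have "(1 + R)^Suc M \<le> (1 + 2/t)^Suc M" using False R0 by (intro power_mono) auto
        then show "1 \<le> (1 + 2/t)^Suc M / (1 + R)^Suc M"
          using R0 by (simp add: le_divide_eq del: power_Suc) 
      qed (use E0 in auto)
      also have "\<dots> \<le> (D * (1 + t/2)^Suc M + E * (1 + 2/t)^Suc M) * 2^j / (1 + R)^Suc M"
        using D0 t R0 by (simp add: divide_right_mono algebra_simps del: power_Suc)
      finally show ?thesis by (simp add: R_def r_def)
    qed
  qed
  moreover have "D * (1 + t/2)^Suc M + E * (1 + 2/t)^Suc M \<ge> 0" using D0 E0 t by simp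
  ultimately show ?thesis by blast
qed

subsection \<open>Counting separated points with large averages\<close>

definition separated :: "real \<Rightarrow> 'a::metric_space set \<Rightarrow> bool" where
  "separated \<delta> P \<longleftrightarrow> (\<forall>x\<in>P. \<forall>y\<in>P. x \<noteq> y \<longrightarrow> \<delta> \<le> dist x y)"

lemma separated_subset: "separated \<delta> P \<Longrightarrow> Q \<subseteq> P \<Longrightarrow> separated \<delta> Q"
  by (auto simp: separated_def)

lemma card_separated_volume:
  fixes P :: "'a::euclidean_space set"
  assumes "finite P" "separated \<delta> P" "\<delta> > 0"
    and A: "A \<in> fmeasurable lborel" "\<And>x. x \<in> P \<Longrightarrow> ball x (\<delta>/2) \<subseteq> A"
  shows "real (card P) * (unit_ball_vol (real DIM('a)) * (\<delta>/2) ^ DIM('a)) \<le> measure lborel A"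
proof -
  have "ball x (\<delta>/2) \<inter> ball y (\<delta>/2) = {}" if "x \<in> P" "y \<in> P" "x \<noteq> y" for x y
  proof -
    have "\<delta> \<le> dist x y" using that assms(2) by (auto simp: separated_def)
    then show ?thesis by (intro disjoint_ballI) simp
  qed
  then have dis: "disjoint_family_on (\<lambda>x. ball x (\<delta>/2)) P"
    by (auto simp: disjoint_family_on_def)
  have "real (card P) * (unit_ball_vol (real DIM('a)) * (\<delta>/2) ^ DIM('a)) = (\<Sum>x\<in>P. measure lborel (ball x (\<delta>/2)))"
    using assms(3) by (simp add: content_ball)
  also have "\<dots> = measure lborel (\<Union>x\<in>P. ball x (\<delta>/2))"
    using assms(1) dis emeasure_lborel_ball_finite
    by (intro measure_finite_Union[symmetric]) (auto simp: less_top[symmetric])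
  also have "\<dots> \<le> measure lborel A"
    using A by (intro measure_mono_fmeasurable) (auto intro!: borel_open open_UN)
  finally show ?thesis .
qed

lemma card_separated_cball:
  fixes P :: "'a::euclidean_space set"
  assumes "finite P" "separated \<delta> P" "\<delta> > 0" "R \<ge> 0" "P \<subseteq> cball x (R * \<delta>)"
  shows "real (card P) \<le> (2 * R + 1) ^ DIM('a)"
proof -
  let ?V = "unit_ball_vol (real DIM('a))"
  have V: "?V > 0" by simp
  have "real (card P) * (?V * (\<delta>/2) ^ DIM('a)) \<le> measure lborel (ball x ((R + 1/2) * \<delta>))"
  proof (rule card_separated_volume[OF assms(1-3)])
    show "ball x ((R + 1/2) * \<delta>) \<in> fmeasurable lborel"
      by (intro fmeasurableI emeasure_lborel_ball_finite) auto
    fix y assume "y \<in> P"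
    then have "dist x y \<le> R * \<delta>" using assms(5) by auto
    moreover have "dist x w \<le> dist x y + dist y w" for w by (rule dist_triangle)
    ultimately have "dist x w < R * \<delta> + \<delta>/2" if "dist y w < \<delta>/2" for w
      using that by (meson add_le_less_mono le_less_trans)
    then show "ball y (\<delta>/2) \<subseteq> ball x ((R + 1/2) * \<delta>)"
      by (auto simp: algebra_simps)
  qed
  also have "\<dots> = ?V * ((2 * R + 1) * (\<delta>/2)) ^ DIM('a)"
    using assms by (simp add: content_ball field_simps)
  also have "\<dots> = (2 * R + 1) ^ DIM('a) * (?V * (\<delta>/2) ^ DIM('a))"
    by (simp only: power_mult_distrib mult_ac)
  finally show ?thesis using V assms(3) by (simp add: mult_le_cancel_right)
qed

text \<open>A volume count: the centres whose shell contains \<open>y\<close> lie in an annulus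
  about \<open>y\<close>. The disjoint balls of radius \<open>1/2^j / 2\<close> around them lie in
  an annulus whose width is still comparable to \<open>1/2^j\<close>, so there are no more of them
  than along a hypersurface.\<close>

lemma card_separated_shell:
  assumes t: "t > 0"
  shows "\<exists>C\<ge>0. \<forall>j P (y::'a::euclidean_space). finite P \<longrightarrow> separated (1/2^j) P \<longrightarrow>
     real (card {x\<in>P. y \<in> shell j t x}) \<le> C * 2^(j * (DIM('a) - 1))"
proof -
  let ?d = "DIM('a)"
  let ?V = "unit_ball_vol (real ?d)"
  define C where "C = real ?d * (t + 2)^(?d - 1) * (1/t + 1) * 2^?d"
  have C0: "C \<ge> 0" using t by (simp add: C_def)
  have "real (card {x\<in>P. y \<in> shell j t x}) \<le> C * 2^(j * (?d - 1))"
    if P: "finite P" "separated (1/2^j) P" for j and P and y :: 'a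
  proof -
    define \<delta> :: real where "\<delta> = 1/2^j"
    have \<delta>: "\<delta> > 0" "\<delta> \<le> 1" by (auto simp: \<delta>_def field_simps)
    \<comment> \<open>The maximum matters when \<open>t\<close> is smaller than
      \<open>\<delta>/2\<close>; the annulus bound asks for a nonnegative inner radius.\<close>
    define a where "a = max 0 (t - \<delta>/2)"
    define b where "b = sqrt (t\<^sup>2 + \<delta>) + \<delta>/2"
    have tb: "t \<le> sqrt (t\<^sup>2 + \<delta>)" using \<delta> by (intro real_le_rsqrt) simp
    have ab: "0 \<le> a" "a \<le> b" using tb \<delta> t by (auto simp: a_def b_def)
    have "sqrt (t\<^sup>2 + \<delta>) \<le> t + \<delta> / t" "sqrt (t\<^sup>2 + \<delta>) \<le> t + 1"
      using shell_outer_radius[OF t, of j] by (auto simp: \<delta>_def)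
    moreover have "t - \<delta>/2 \<le> a" by (simp add: a_def)
    ultimately have b2: "b \<le> t + 2" "b - a \<le> \<delta> * (1/t + 1)"
      using \<delta> by (auto simp: b_def distrib_left)
    let ?Q = "{x\<in>P. y \<in> shell j t x}"
    have V: "?V > 0" by simp
    have "real (card ?Q) * (?V * (\<delta>/2) ^ ?d) \<le> measure lborel (cball y b - ball y a)"
    proof (rule card_separated_volume)
      show "finite ?Q" "separated \<delta> ?Q" using P by (auto simp: \<delta>_def intro: separated_subset)
      show "cball y b - ball y a \<in> fmeasurable lborel"
        by (intro fmeasurable.Diff fmeasurableI emeasure_lborel_cball_finite emeasure_lborel_ball_finite) auto
      fix x assume "x \<in> ?Q"
      then have "y \<in> shell j t x" by simp
      then have "y \<in> cball x (sqrt (t\<^sup>2 + 1/2^j)) - ball x t" using shell_subset_annulus[OF t] by blast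
      then have xy: "t \<le> dist x y" "dist x y \<le> sqrt (t\<^sup>2 + \<delta>)" by (auto simp: \<delta>_def)
      show "ball x (\<delta>/2) \<subseteq> cball y b - ball y a"
      proof
        fix w assume "w \<in> ball x (\<delta>/2)"
        then have w: "dist x w < \<delta>/2" by simp
        have "dist y w \<le> dist x y + dist x w" "dist x y \<le> dist y w + dist x w"
          using dist_triangle3[of y w x] dist_triangle3[of x y w] by (auto simp: dist_commute)
        then show "w \<in> cball y b - ball y a" using w xy zero_le_dist[of y w]
          by (auto simp: a_def b_def less_max_iff_disj)
      qed
    qed (fact \<delta>(1))
    also have "\<dots> \<le> ?V * (real ?d * b ^ (?d - 1) * (b - a))"
      by (rule measure_annulus_le[OF ab])
    also have "\<dots> \<le> ?V * (real ?d * (t + 2) ^ (?d - 1) * (\<delta> * (1/t + 1)))"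
      using b2 ab t by (intro mult_left_mono mult_mono power_mono) auto
    also have "\<dots> = (C / \<delta>^(?d - 1)) * (?V * (\<delta>/2) ^ ?d)"
    proof -
      have "\<delta>^?d = \<delta> * \<delta>^(?d - 1)" by (simp add: power_eq_if[of _ ?d])
      then have "(\<delta>/2)^?d = \<delta> * \<delta>^(?d - 1) / 2^?d" by (simp add: power_divide)
      then show ?thesis using \<delta> by (simp add: C_def)
    qed
    finally have "real (card ?Q) * (?V * (\<delta>/2) ^ ?d) \<le> (C / \<delta>^(?d - 1)) * (?V * (\<delta>/2) ^ ?d)" .
    moreover have "?V * (\<delta>/2) ^ ?d > 0" using V \<delta> by simp
    ultimately have "real (card ?Q) \<le> C / \<delta>^(?d - 1)" by (simp only: mult_le_cancel_right_pos)
    also have "\<dots> = C * 2^(j * (?d - 1))" by (simp add: \<delta>_def power_divide power_mult)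
    finally show ?thesis .
  qed
  with C0 show ?thesis by blast
qed

text \<open>Points are grouped by the integer part \<open>n\<close> of
  \<open>dist x x' / \<delta>\<close>. Each group is counted by a whole ball, giving at most
  \<open>(3 * (n + 1))^d\<close> points, so the exponent \<open>d + 2\<close> leaves the series of
  \<open>1/(n + 1)^2\<close>. This is where the number \<open>d + 1\<close> of moments comes
  from.\<close>

lemma sum_separated_decay:
  fixes P :: "'a::euclidean_space set"
  assumes P: "finite P" "separated \<delta> P" "\<delta> > 0"
  shows "(\<Sum>x'\<in>P. 1 / (1 + dist x x' / \<delta>)^(DIM('a) + 2)) \<le> 3^DIM('a) * (\<Sum>n. 1 / (real (Suc n))\<^sup>2)"
proof -
  let ?d = "DIM('a)"
  define g where "g x' = nat \<lfloor>dist x x' / \<delta>\<rfloor>" for x'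
  define N where "N = Max (g ` P \<union> {0})"
  have gN: "g ` P \<subseteq> {..N}" unfolding N_def using P by auto
  have g: "real (g x') \<le> dist x x' / \<delta>" "dist x x' / \<delta> \<le> real (g x') + 1" for x'
  proof -
    have "0 \<le> dist x x' / \<delta>" using P by simp
    then show "real (g x') \<le> dist x x' / \<delta>" "dist x x' / \<delta> \<le> real (g x') + 1"
      unfolding g_def by (simp_all add: of_nat_nat)
  qed
  have summ: "summable (\<lambda>n. 1 / (real (Suc n))\<^sup>2)"
    using inverse_power_summable[of 2, where 'a=real] by (subst summable_Suc_iff) (simp add: inverse_eq_divide)
  have "(\<Sum>x'\<in>P. 1 / (1 + dist x x' / \<delta>)^(?d + 2)) =
     (\<Sum>n\<in>{..N}. \<Sum>x'\<in>{x'\<in>P. g x' = n}. 1 / (1 + dist x x' / \<delta>)^(?d + 2))"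
    by (rule sum.group[symmetric]) (use P gN in auto)
  also have "\<dots> \<le> (\<Sum>n\<in>{..N}. 3^?d * (1 / (real (Suc n))\<^sup>2))"
  proof (rule sum_mono)
    fix n
    let ?Q = "{x'\<in>P. g x' = n}"
    have "(\<Sum>x'\<in>?Q. 1 / (1 + dist x x' / \<delta>)^(?d + 2)) \<le> real (card ?Q) * (1 / (real (Suc n))^(?d + 2))"
    proof (rule sum_bounded_above)
      fix x' assume "x' \<in> ?Q"
      then have "real (Suc n) \<le> 1 + dist x x' / \<delta>" using g(1)[of x'] by simp
      then show "1 / (1 + dist x x' / \<delta>)^(?d + 2) \<le> 1 / (real (Suc n))^(?d + 2)"
        by (intro divide_left_mono power_mono mult_pos_pos zero_less_power) auto
    qed
    also have "real (card ?Q) \<le> (2 * real (Suc n) + 1) ^ ?d"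
    proof (rule card_separated_cball[where x=x and \<delta>=\<delta>])
      show "?Q \<subseteq> cball x (real (Suc n) * \<delta>)"
        using g(2) P by (auto simp: divide_le_eq algebra_simps)
    qed (use P in \<open>auto intro: separated_subset\<close>)
    also have "\<dots> \<le> (3 * real (Suc n)) ^ ?d" by (intro power_mono) auto
    also have "(3 * real (Suc n)) ^ ?d * (1 / (real (Suc n))^(?d + 2)) = 3^?d * (1 / (real (Suc n))\<^sup>2)"
      by (simp add: power_mult_distrib power_add power2_eq_square del: of_nat_Suc)
    finally show "(\<Sum>x'\<in>?Q. 1 / (1 + dist x x' / \<delta>)^(?d + 2)) \<le> 3^?d * (1 / (real (Suc n))\<^sup>2)"
      by (simp add: mult_right_mono divide_right_mono)
  qed
  also have "\<dots> = 3^?d * (\<Sum>n\<in>{..N}. 1 / (real (Suc n))\<^sup>2)" by (simp add: sum_distrib_left)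
  also have "\<dots> \<le> 3^?d * (\<Sum>n. 1 / (real (Suc n))\<^sup>2)"
    by (intro mult_left_mono sum_le_suminf summ) auto
  finally show ?thesis .
qed

lemma integrable_mult_shell_kern:
  fixes h :: "'a::euclidean_space \<Rightarrow> real"
  assumes h: "integrable lborel h"
  shows "integrable lborel (\<lambda>y. h y * shell_kern m j t x y)"
proof (rule Bochner_Integration.integrable_bound)
  show "integrable lborel (\<lambda>y. h y * (3^m * 2^j))" using h by (rule integrable_mult_left)
  have "\<bar>shell_kern m j t x y\<bar> \<le> 3^m * 2^j" for y
    unfolding shell_kern_def by (rule abs_kern_le)
  then show "AE y in lborel. norm (h y * shell_kern m j t x y) \<le> norm (h y * (3^m * 2^j))"
    by (intro AE_I2) (auto simp: abs_mult intro!: mult_left_mono)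
qed (use h in measurable)

text \<open>Duality: pair \<open>h1 + h2\<close> with the signed sum \<open>g\<close> of the kernels at the points of \<open>P\<close>. Against \<open>h1\<close>, the
  bound on the \<open>L\<^sup>2\<close> norm of \<open>g\<close> enters through a weighted AM-GM inequality; against \<open>h2\<close>, its supremum.\<close>

lemma card_large_values:
  assumes t: "t > 0" and d: "DIM('a::euclidean_space) \<ge> 2"
  shows "\<exists>C\<ge>0. \<forall>j z P lam (h1::'a \<Rightarrow> real) h2. finite P \<longrightarrow> separated (1/2^j) P \<longrightarrow> P \<subseteq> ball z (t/4) \<longrightarrow> lam > 0 \<longrightarrow>
     integrable lborel h1 \<longrightarrow> integrable lborel (\<lambda>y. (h1 y)\<^sup>2) \<longrightarrow> integrable lborel h2 \<longrightarrow> (\<forall>y. h2 y \<ge> 0) \<longrightarrow>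
     (\<forall>x\<in>P. lam \<le> \<bar>\<integral>y. (h1 y + h2 y) * shell_kern (DIM('a) + 1) j t x y \<partial>lborel\<bar>) \<longrightarrow>
     real (card P) \<le> C * (2^j / lam\<^sup>2 * (\<integral>y. (h1 y)\<^sup>2 \<partial>lborel) + 2^(j * DIM('a)) / lam * (\<integral>y. h2 y \<partial>lborel))"
proof -
  let ?d = "DIM('a)"
  define M where "M = ?d + 1"
  obtain C1 where C1: "C1 \<ge> 0" "\<And>j (x::'a) x'. dist x x' \<le> t/2 \<Longrightarrow>
     \<bar>kern_corr M j t x x'\<bar> \<le> C1 * 2^j / (1 + 2^j * dist x x')^Suc M"
    using kern_corr_bound[OF t d, of M] by blast
  obtain C2 where C2: "C2 \<ge> 0" "\<And>j P (y::'a). finite P \<Longrightarrow> separated (1/2^j) P \<Longrightarrow>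
     real (card {x\<in>P. y \<in> shell j t x}) \<le> C2 * 2^(j * (?d - 1))"
    using card_separated_shell[OF t, where 'a='a] by blast
  define Z where "Z = 3^?d * (\<Sum>n. 1 / (real (Suc n))\<^sup>2)"
  have Z0: "Z \<ge> 0"
  proof -
    have "0 \<le> (\<Sum>x'\<in>({}::'a set). 1 / (1 + dist 0 x' / 1)^(?d + 2))" by simp
    also have "\<dots> \<le> Z" unfolding Z_def by (rule sum_separated_decay) (auto simp: separated_def)
    finally show ?thesis .
  qed
  \<comment> \<open>The summand 1 keeps \<open>Q\<close> positive even if \<open>C1\<close> is 0;
    the weighted inequality below divides by it.\<close>
  define Q where "Q = C1 * Z + 1"
  have Q1: "Q > 0" using C1 Z0 by (simp add: Q_def add_nonneg_pos)
  define R where "R = 3^M * C2"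
  have R0: "R \<ge> 0" using C2 by (simp add: R_def)
  have "real (card P) \<le> (Q + 2 * R) * (2^j / lam\<^sup>2 * (\<integral>y. (h1 y)\<^sup>2 \<partial>lborel) + 2^(j * ?d) / lam * (\<integral>y. h2 y \<partial>lborel))"
    if P: "finite P" "separated (1/2^j) P" "P \<subseteq> ball z (t/4)" and l: "lam > 0"
      and h: "integrable lborel h1" "integrable lborel (\<lambda>y. (h1 y)\<^sup>2)" "integrable lborel h2" "\<forall>y. h2 y \<ge> 0"
      and big: "\<forall>x\<in>P. lam \<le> \<bar>\<integral>y. (h1 y + h2 y) * shell_kern M j t x y \<partial>lborel\<bar>"
    for j z P lam and h1 h2 :: "'a \<Rightarrow> real"
  proof -
    let ?k = "shell_kern M j t"
    let ?N = "real (card P)"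
    define \<epsilon> where "\<epsilon> x = sgn (\<integral>y. (h1 y + h2 y) * ?k x y \<partial>lborel)" for x
    have \<epsilon>1: "\<bar>\<epsilon> x\<bar> \<le> 1" for x by (simp add: \<epsilon>_def sgn_if)
    define g where "g y = (\<Sum>x\<in>P. \<epsilon> x * ?k x y)" for y
    have gm[measurable]: "g \<in> borel_measurable borel" unfolding g_def[abs_def] by measurable
    have ig: "integrable lborel (\<lambda>y. f y * g y)" if "integrable lborel f" for f
    proof -
      have "(\<lambda>y. f y * g y) = (\<lambda>y. \<Sum>x\<in>P. \<epsilon> x * (f y * ?k x y))"
        by (simp add: g_def sum_distrib_left mult_ac)
      then show ?thesis using integrable_mult_shell_kern[OF that] by simp
    qed
    have gg: "(\<lambda>y. (g y)\<^sup>2) = (\<lambda>y. \<Sum>x\<in>P. \<Sum>x'\<in>P. (\<epsilon> x * \<epsilon> x') * (?k x y * ?k x' y))"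
      by (simp add: g_def power2_eq_square sum_product mult_ac)
    have ig2: "integrable lborel (\<lambda>y. (g y)\<^sup>2)"
      unfolding gg
      by (intro Bochner_Integration.integrable_sum integrable_mult_right integrable_shell_kern_mult t)
    \<comment> \<open>Expanding the square gives the correlation matrix, whose absolute row sums are
      at most \<open>Q * 2^j\<close>. The points lie in a ball of radius \<open>t/4\<close>, so
      their distances satisfy the condition of the correlation bound.\<close>
    have g2: "(\<integral>y. (g y)\<^sup>2 \<partial>lborel) \<le> ?N * (Q * 2^j)"
    proof -
      have "(\<integral>y. (g y)\<^sup>2 \<partial>lborel) = (\<Sum>x\<in>P. \<Sum>x'\<in>P. (\<epsilon> x * \<epsilon> x') * kern_corr M j t x x')"
        unfolding gg kern_corr_def
        by (simp add: Bochner_Integration.integral_sum Bochner_Integration.integrable_sum integrable_shell_kern_mult t)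
      also have "\<dots> \<le> (\<Sum>x\<in>P. Q * 2^j)"
      proof (rule sum_mono)
        fix x assume x: "x \<in> P"
        have "(\<Sum>x'\<in>P. (\<epsilon> x * \<epsilon> x') * kern_corr M j t x x') \<le>
          (\<Sum>x'\<in>P. C1 * 2^j * (1 / (1 + dist x x' / (1/2^j))^(?d + 2)))"
        proof (rule sum_mono)
          fix x' assume "x' \<in> P"
          then have "dist x x' \<le> t/2" using x P(3) dist_triangle3[of x x' z]
            by (auto simp: subset_iff dist_commute) (smt (verit) dist_commute field_sum_of_halves mem_ball)
          then have "\<bar>kern_corr M j t x x'\<bar> \<le> C1 * 2^j * (1 / (1 + dist x x' / (1/2^j))^(?d + 2))"
            using C1(2)[of x x' j] by (simp add: M_def mult.commute)
          moreover have "(\<epsilon> x * \<epsilon> x') * kern_corr M j t x x' \<le> \<bar>kern_corr M j t x x'\<bar>"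
          proof -
            have "\<bar>\<epsilon> x * \<epsilon> x'\<bar> \<le> 1" using \<epsilon>1 by (simp add: abs_mult mult_le_one)
            then have "\<bar>(\<epsilon> x * \<epsilon> x') * kern_corr M j t x x'\<bar> \<le> \<bar>kern_corr M j t x x'\<bar>"
              by (subst abs_mult) (simp add: mult_left_le_one_le)
            then show ?thesis by linarith
          qed
          ultimately show "(\<epsilon> x * \<epsilon> x') * kern_corr M j t x x' \<le> C1 * 2^j * (1 / (1 + dist x x' / (1/2^j))^(?d + 2))"
            by linarith
        qed
        also have "\<dots> = C1 * 2^j * (\<Sum>x'\<in>P. 1 / (1 + dist x x' / (1/2^j))^(?d + 2))"
          by (simp only: sum_distrib_left)
        also have "\<dots> \<le> C1 * 2^j * Z"
          unfolding Z_def using P C1 by (intro mult_left_mono sum_separated_decay) auto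
        also have "\<dots> \<le> Q * 2^j" by (simp add: Q_def algebra_simps)
        finally show "(\<Sum>x'\<in>P. (\<epsilon> x * \<epsilon> x') * kern_corr M j t x x') \<le> Q * 2^j" .
      qed
      finally show ?thesis by simp
    qed
    \<comment> \<open>Each kernel is of size \<open>2^j\<close> on its own shell, and of order
      \<open>2^(j * (d - 1))\<close> shells at most pass through \<open>y\<close>.\<close>
    have gle: "g y \<le> R * 2^(j * ?d)" for y
    proof -
      have "g y \<le> (\<Sum>x\<in>P. 3^M * 2^j * indicator (shell j t x) y)"
        unfolding g_def
      proof (rule sum_mono)
        fix x
        have "\<epsilon> x * ?k x y \<le> \<bar>\<epsilon> x\<bar> * \<bar>?k x y\<bar>" by (metis abs_ge_self abs_mult)
        also have "\<dots> \<le> 1 * \<bar>?k x y\<bar>" using \<epsilon>1 by (intro mult_right_mono) auto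
        finally show "\<epsilon> x * ?k x y \<le> 3^M * 2^j * indicator (shell j t x) y"
          using abs_shell_kern_le[of M j t x y] by linarith
      qed
      also have "\<dots> = 3^M * 2^j * real (card {x\<in>P. y \<in> shell j t x})"
        using P(1) by (simp add: sum_distrib_left[symmetric] indicator_def Int_def)
      also have "\<dots> \<le> 3^M * 2^j * (C2 * 2^(j * (?d - 1)))"
        using C2 P by (intro mult_left_mono) auto
      also have "\<dots> = R * 2^(j * ?d)"
      proof -
        have "j * ?d = j + j * (?d - 1)" using d by (simp add: algebra_simps diff_mult_distrib2)
        then show ?thesis by (simp add: R_def power_add)
      qed
      finally show ?thesis .
    qed
    have "lam * ?N = (\<Sum>x\<in>P. lam)" by simp
    also have "\<dots> \<le> (\<Sum>x\<in>P. \<epsilon> x * (\<integral>y. (h1 y + h2 y) * ?k x y \<partial>lborel))"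
      by (rule sum_mono) (use big in \<open>auto simp: \<epsilon>_def abs_sgn mult.commute\<close>)
    also have "\<dots> = (\<integral>y. (h1 y + h2 y) * g y \<partial>lborel)"
    proof -
      have "(\<lambda>y. (h1 y + h2 y) * g y) = (\<lambda>y. \<Sum>x\<in>P. \<epsilon> x * ((h1 y + h2 y) * ?k x y))"
        by (simp add: g_def sum_distrib_left mult_ac)
      then show ?thesis
        using integrable_mult_shell_kern[OF Bochner_Integration.integrable_add[OF h(1,3)]]
        by (simp add: Bochner_Integration.integral_sum)
    qed
    also have "\<dots> = (\<integral>y. h1 y * g y \<partial>lborel) + (\<integral>y. h2 y * g y \<partial>lborel)"
      using ig[OF h(1)] ig[OF h(3)] by (simp add: distrib_right)
    also have "(\<integral>y. h2 y * g y \<partial>lborel) \<le> (\<integral>y. h2 y * (R * 2^(j * ?d)) \<partial>lborel)"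
      using ig[OF h(3)] h gle by (intro integral_mono mult_left_mono) auto
    \<comment> \<open>The weight \<open>Q * 2^j / lam\<close> is tuned so that the bound on the
      square integral of \<open>g\<close> turns the second term into at most
      \<open>lam * ?N / 2\<close>, which the left side absorbs.\<close>
    also have "(\<integral>y. h1 y * g y \<partial>lborel) \<le>
       (\<integral>y. (Q * 2^j / (2 * lam)) * (h1 y)\<^sup>2 + (lam / (2 * Q * 2^j)) * (g y)\<^sup>2 \<partial>lborel)"
    proof (rule integral_mono)
      show "integrable lborel (\<lambda>y. h1 y * g y)" by (rule ig[OF h(1)])
      show "integrable lborel (\<lambda>y. (Q * 2^j / (2 * lam)) * (h1 y)\<^sup>2 + (lam / (2 * Q * 2^j)) * (g y)\<^sup>2)"
        using h(2) ig2 by simp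
      fix y
      define q where "q = Q * 2^j / lam"
      have q: "q > 0" using Q1 l by (simp add: q_def)
      have "0 \<le> (q * h1 y - g y)\<^sup>2 / (2 * q)" using q by simp
      also have "\<dots> = q / 2 * (h1 y)\<^sup>2 + 1 / (2 * q) * (g y)\<^sup>2 - h1 y * g y"
        using q by (simp add: power2_eq_square field_simps)
      finally have "h1 y * g y \<le> q / 2 * (h1 y)\<^sup>2 + 1 / (2 * q) * (g y)\<^sup>2" by simp
      moreover have "q / 2 = Q * 2^j / (2 * lam)" by (simp add: q_def)
      moreover have "1 / (2 * q) = lam / (2 * Q * 2^j)" by (simp add: q_def)
      ultimately show "h1 y * g y \<le> (Q * 2^j / (2 * lam)) * (h1 y)\<^sup>2 + (lam / (2 * Q * 2^j)) * (g y)\<^sup>2"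
        by simp
    qed
    also have "\<dots> = (Q * 2^j / (2 * lam)) * (\<integral>y. (h1 y)\<^sup>2 \<partial>lborel) + (lam / (2 * Q * 2^j)) * (\<integral>y. (g y)\<^sup>2 \<partial>lborel)"
      using h(2) ig2 by simp
    also have "(lam / (2 * Q * 2^j)) * (\<integral>y. (g y)\<^sup>2 \<partial>lborel) \<le> (lam / (2 * Q * 2^j)) * (?N * (Q * 2^j))"
      using g2 l Q1 by (intro mult_left_mono) auto
    also have "(lam / (2 * Q * 2^j)) * (?N * (Q * 2^j)) = lam * ?N / 2" using Q1 by simp
    also have "(\<integral>y. h2 y * (R * 2^(j * ?d)) \<partial>lborel) = R * 2^(j * ?d) * (\<integral>y. h2 y \<partial>lborel)" by simp
    finally have *: "lam * ?N \<le> Q * 2^j / (2 * lam) * (\<integral>y. (h1 y)\<^sup>2 \<partial>lborel) + lam * ?N / 2 + R * 2^(j * ?d) * (\<integral>y. h2 y \<partial>lborel)"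
      by simp
    have aux: "x \<le> 2 * (a + b)" if "x \<le> a + x / 2 + b" for x a b :: real
      using that by (simp add: field_simps)
    define A1 where "A1 = (\<integral>y. (h1 y)\<^sup>2 \<partial>lborel)"
    define A2 where "A2 = (\<integral>y. h2 y \<partial>lborel)"
    have A0: "A1 \<ge> 0" "A2 \<ge> 0" using h by (auto simp: A1_def A2_def)
    have "lam * ?N \<le> 2 * (Q * 2^j / (2 * lam) * A1 + R * 2^(j * ?d) * A2)"
      unfolding A1_def A2_def by (rule aux[OF *])
    then have "?N \<le> 2 * (Q * 2^j / (2 * lam) * A1 + R * 2^(j * ?d) * A2) / lam"
      using l by (simp add: le_divide_eq mult.commute)
    also have "\<dots> = Q * (2^j / lam\<^sup>2 * A1) + 2 * R * (2^(j * ?d) / lam * A2)"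
      using l by (simp add: power2_eq_square field_simps)
    also have "\<dots> \<le> (Q + 2 * R) * (2^j / lam\<^sup>2 * A1) + (Q + 2 * R) * (2^(j * ?d) / lam * A2)"
      using Q1 R0 A0 l by (intro add_mono mult_right_mono) auto
    finally show ?thesis unfolding A1_def A2_def by (simp add: distrib_left)
  qed
  moreover have "Q + 2 * R \<ge> 0" using Q1 R0 by simp
  ultimately show ?thesis unfolding M_def by blast
qed

section \<open>From counting to covers of small content\<close>

lemma summable_power4_geometric:
  assumes q: "0 < q" "q < (1::real)"
  shows "summable (\<lambda>j. real j ^ 4 * q ^ j)"
proof -
  \<comment> \<open>The eighth root splits \<open>q^n\<close> into two factors
    \<open>r^(4 * n)\<close>: one makes \<open>(n * r^n)^4\<close> bounded, the other remains as a
    convergent geometric series.\<close>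
  define r where "r = q powr (1/8)"
  have r: "0 < r" "r < 1" using q using powr_less_mono2[of "1/8" q 1] by (auto simp: r_def)
  have "r powr 8 = q" using q by (simp add: r_def powr_powr)
  then have r8: "r^8 = q" using r powr_realpow[of r 8] by simp
  have "(\<lambda>n. real n * r^n) \<longlonglongrightarrow> 0" using r by (intro powser_times_n_limit_0) simp
  then obtain K where K: "\<And>n. norm (real n * r^n) \<le> K"
    using convergent_imp_Bseq[of "\<lambda>n. real n * r^n"] by (auto simp: convergent_def Bseq_def)
  show ?thesis
  proof (rule summable_comparison_test')
    show "summable (\<lambda>n. K^4 * (r^4)^n)"
      using r by (intro summable_mult summable_geometric) (simp add: power_less_one_iff)
    fix n
    have "real n ^ 4 * q ^ n = (real n * r^n)^4 * (r^4)^n"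
      unfolding r8[symmetric] by (simp add: power_mult_distrib power_mult[symmetric] power_add[symmetric])
    moreover have "(real n * r^n)^4 \<le> K^4"
      using K[of n] r by (intro power_mono) auto
    ultimately show "norm (real n ^ 4 * q ^ n) \<le> K^4 * (r^4)^n"
      using q r by (simp add: mult_right_mono)
  qed
qed

text \<open>Truncation at height \<open>H\<close> interpolates: the low part has
  \<open>h1^2 \<le> H powr (2 - p) * h powr p\<close>, the high part
  \<open>h2 \<le> H powr (1 - p) * h powr p\<close>. With \<open>H = 2^(j * (d - 1))\<close> the
  exponents \<open>1 + (d - 1) * (2 - p)\<close> and \<open>d + (d - 1) * (1 - p)\<close> agree, and
  \<open>l \<le> 1\<close> merges \<open>1/l\<close> into \<open>1/l^2\<close>.\<close>

lemma card_large_values_Lp: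
  assumes t: "t > 0" and d: "DIM('a::euclidean_space) \<ge> 2" and p: "1 \<le> p" "p \<le> (2::real)"
    and h: "integrable lborel h" "integrable lborel (\<lambda>y. h y powr p)" "\<And>y::'a. h y \<ge> 0"
  shows "\<exists>C\<ge>0. \<forall>j z P l. finite P \<longrightarrow> separated (1/2^j) P \<longrightarrow> P \<subseteq> ball z (t/4) \<longrightarrow> 0 < l \<longrightarrow> l \<le> 1 \<longrightarrow>
     (\<forall>x\<in>P. l \<le> \<bar>\<integral>y. h y * shell_kern (DIM('a) + 1) j t x y \<partial>lborel\<bar>) \<longrightarrow>
     real (card P) \<le> C / l\<^sup>2 * (2 powr (real DIM('a) - (p - 1) * (real DIM('a) - 1)))^j"
proof -
  let ?d = "DIM('a)"
  let ?e = "real ?d - (p - 1) * (real ?d - 1)"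
  obtain C where C: "C \<ge> 0" "\<And>j z P l (h1::'a \<Rightarrow> real) h2. finite P \<Longrightarrow> separated (1/2^j) P \<Longrightarrow> P \<subseteq> ball z (t/4) \<Longrightarrow> l > 0 \<Longrightarrow>
     integrable lborel h1 \<Longrightarrow> integrable lborel (\<lambda>y. (h1 y)\<^sup>2) \<Longrightarrow> integrable lborel h2 \<Longrightarrow> (\<forall>y. h2 y \<ge> 0) \<Longrightarrow>
     (\<forall>x\<in>P. l \<le> \<bar>\<integral>y. (h1 y + h2 y) * shell_kern (?d + 1) j t x y \<partial>lborel\<bar>) \<Longrightarrow>
     real (card P) \<le> C * (2^j / l\<^sup>2 * (\<integral>y. (h1 y)\<^sup>2 \<partial>lborel) + 2^(j * ?d) / l * (\<integral>y. h2 y \<partial>lborel))"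
    using card_large_values[OF t d] by blast
  define I where "I = (\<integral>y. h y powr p \<partial>lborel)"
  have I0: "I \<ge> 0" by (simp add: I_def)
  have hm[measurable]: "h \<in> borel_measurable borel" using h(1) by (simp add: borel_measurable_integrable)
  have "real (card P) \<le> (2 * C * I) / l\<^sup>2 * (2 powr ?e)^j"
    if P: "finite P" "separated (1/2^j) P" "P \<subseteq> ball z (t/4)" and l: "0 < l" "l \<le> 1"
      and big: "\<forall>x\<in>P. l \<le> \<bar>\<integral>y. h y * shell_kern (?d + 1) j t x y \<partial>lborel\<bar>" for j z P l
  proof -
    \<comment> \<open>The height at which the \<open>L\<^sup>2\<close> and the \<open>L\<^sup>1\<close> bound balance.\<close>
    define H :: real where "H = 2 powr (real j * (real ?d - 1))"
    have H: "H > 0" by (simp add: H_def)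
    define h1 where "h1 y = (if h y \<le> H then h y else 0)" for y
    define h2 where "h2 y = (if h y \<le> H then 0 else h y)" for y
    have hh: "h1 y + h2 y = h y" for y by (simp add: h1_def h2_def)
    have h1m[measurable]: "h1 \<in> borel_measurable borel" unfolding h1_def[abs_def] by measurable
    have h2m[measurable]: "h2 \<in> borel_measurable borel" unfolding h2_def[abs_def] by measurable
    have ih1: "integrable lborel h1"
      by (rule Bochner_Integration.integrable_bound[OF h(1)]) (use h(3) in \<open>auto simp: h1_def\<close>)
    have ih2: "integrable lborel h2"
      by (rule Bochner_Integration.integrable_bound[OF h(1)]) (use h(3) in \<open>auto simp: h2_def\<close>)
    have b1: "(h1 y)\<^sup>2 \<le> H powr (2 - p) * h y powr p" for y
    proof (cases "h y \<le> H \<and> h y > 0")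
      case True
      then have "(h1 y)\<^sup>2 = h y powr (2 - p) * h y powr p"
        by (simp add: h1_def powr_add[symmetric])
      also have "\<dots> \<le> H powr (2 - p) * h y powr p"
        using True p by (intro mult_right_mono powr_mono2) auto
      finally show ?thesis .
    next
      case False
      then have "h1 y = 0" using h(3)[of y] by (auto simp: h1_def)
      then show ?thesis by simp
    qed
    have b2: "h2 y \<le> H powr (1 - p) * h y powr p" for y
    proof (cases "h y \<le> H")
      case False
      then have pos: "h y > 0" using H by simp
      have "h2 y = h y powr (1 - p) * h y powr p"
        using False pos by (simp add: h2_def powr_add[symmetric])
      also have "\<dots> \<le> H powr (1 - p) * h y powr p"
        using False H p by (intro mult_right_mono powr_mono2') auto
      finally show ?thesis .
    qed (simp add: h2_def)
    have ih1s: "integrable lborel (\<lambda>y. (h1 y)\<^sup>2)"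
      by (rule Bochner_Integration.integrable_bound[OF integrable_mult_right[OF h(2), of "H powr (2 - p)"]])
        (use b1 in auto)
    have i1: "(\<integral>y. (h1 y)\<^sup>2 \<partial>lborel) \<le> H powr (2 - p) * I"
    proof -
      have "(\<integral>y. (h1 y)\<^sup>2 \<partial>lborel) \<le> (\<integral>y. H powr (2 - p) * h y powr p \<partial>lborel)"
        using ih1s h(2) b1 by (intro integral_mono) auto
      then show ?thesis by (simp add: I_def)
    qed
    have i2: "(\<integral>y. h2 y \<partial>lborel) \<le> H powr (1 - p) * I"
    proof -
      have "(\<integral>y. h2 y \<partial>lborel) \<le> (\<integral>y. H powr (1 - p) * h y powr p \<partial>lborel)"
        using ih2 h(2) b2 by (intro integral_mono) auto
      then show ?thesis by (simp add: I_def)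
    qed
    have e1: "2^j * H powr (2 - p) = (2 powr ?e)^j"
    proof -
      have "2^j * H powr (2 - p) = 2 powr (real j + real j * (real ?d - 1) * (2 - p))"
        by (simp add: H_def powr_add powr_realpow powr_powr)
      also have "real j + real j * (real ?d - 1) * (2 - p) = ?e * real j" by (simp add: algebra_simps)
      also have "2 powr (?e * real j) = (2 powr ?e)^j" by (simp add: powr_powr[symmetric] powr_realpow)
      finally show ?thesis .
    qed
    have e2: "2^(j * ?d) * H powr (1 - p) = (2 powr ?e)^j"
    proof -
      have "(2::real)^(j * ?d) = 2 powr (real j * real ?d)" by (simp add: powr_realpow[symmetric])
      then have "2^(j * ?d) * H powr (1 - p) = 2 powr (real j * real ?d + real j * (real ?d - 1) * (1 - p))"
        by (simp add: H_def powr_add powr_powr)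
      also have "real j * real ?d + real j * (real ?d - 1) * (1 - p) = ?e * real j" by (simp add: algebra_simps)
      also have "2 powr (?e * real j) = (2 powr ?e)^j" by (simp add: powr_powr[symmetric] powr_realpow)
      finally show ?thesis .
    qed
    have "real (card P) \<le> C * (2^j / l\<^sup>2 * (\<integral>y. (h1 y)\<^sup>2 \<partial>lborel) + 2^(j * ?d) / l * (\<integral>y. h2 y \<partial>lborel))"
    proof (rule C(2)[OF P l(1) ih1 ih1s ih2])
      show "\<forall>y. h2 y \<ge> 0" using h(3) by (simp add: h2_def)
      show "\<forall>x\<in>P. l \<le> \<bar>\<integral>y. (h1 y + h2 y) * shell_kern (?d + 1) j t x y \<partial>lborel\<bar>"
        unfolding hh by (rule big)
    qed
    also have "\<dots> \<le> C * (2^j / l\<^sup>2 * (H powr (2 - p) * I) + 2^(j * ?d) / l * (H powr (1 - p) * I))"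
      using C(1) i1 i2 l by (intro mult_left_mono add_mono) auto
    also have "\<dots> = C * I * (2^j * H powr (2 - p)) / l\<^sup>2 + C * I * (2^(j * ?d) * H powr (1 - p)) / l"
      by (simp add: algebra_simps)
    also have "\<dots> = C * I * (2 powr ?e)^j * (1 / l\<^sup>2 + 1 / l)" unfolding e1 e2 by (simp add: algebra_simps)
    also have "\<dots> \<le> C * I * (2 powr ?e)^j * (1 / l\<^sup>2 + 1 / l\<^sup>2)"
    proof -
      have "l\<^sup>2 \<le> l" using l by (simp add: power2_eq_square mult_left_le)
      then have "1 / l \<le> 1 / l\<^sup>2" using l by (intro divide_left_mono) auto
      then show ?thesis using C(1) I0 by (intro mult_left_mono add_mono) auto
    qed
    finally show ?thesis by (simp add: mult_ac)
  qed
  moreover have "2 * C * I \<ge> 0" using C I0 by simp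
  ultimately show ?thesis by blast
qed

text \<open>Turns a count into a cover. Bounded cardinalities provide a separated set of greatest
  size, and a point farther than \<open>\<delta>\<close> from all of it could still be
  added.\<close>

lemma separated_maximal:
  fixes B :: "'a::metric_space set"
  assumes bd: "\<And>P. finite P \<Longrightarrow> P \<subseteq> B \<Longrightarrow> separated \<delta> P \<Longrightarrow> real (card P) \<le> N" and "\<delta> > 0"
  obtains P where "finite P" "P \<subseteq> B" "real (card P) \<le> N" "B \<subseteq> (\<Union>x\<in>P. cball x \<delta>)"
proof -
  let ?S = "{P. finite P \<and> P \<subseteq> B \<and> separated \<delta> P}"
  have "\<exists>P. P \<in> ?S \<and> (\<forall>Q. Q \<in> ?S \<longrightarrow> card Q \<le> card P)"
  proof (rule ex_has_greatest_nat[where P="\<lambda>P. P \<in> ?S" and k="{}" and b="Suc (nat \<lceil>N\<rceil>)"])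
    show "{} \<in> ?S" by (simp add: separated_def)
    show "\<forall>Q. Q \<in> ?S \<longrightarrow> card Q < Suc (nat \<lceil>N\<rceil>)"
    proof (intro allI impI)
      fix Q assume "Q \<in> ?S"
      then have "real (card Q) \<le> N" by (intro bd) auto
      then show "card Q < Suc (nat \<lceil>N\<rceil>)" by linarith
    qed
  qed
  then obtain P where P: "finite P" "P \<subseteq> B" "separated \<delta> P" "\<And>Q. Q \<in> ?S \<Longrightarrow> card Q \<le> card P" by blast
  have "B \<subseteq> (\<Union>x\<in>P. cball x \<delta>)"
  proof (rule ccontr)
    assume "\<not> B \<subseteq> (\<Union>x\<in>P. cball x \<delta>)"
    then obtain b where "b \<in> B" "b \<notin> (\<Union>x\<in>P. cball x \<delta>)" by blast
    then have b: "b \<in> B" "\<And>x. x \<in> P \<Longrightarrow> dist x b > \<delta>" by (auto simp: not_le[symmetric])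
    have "b \<notin> P" using b(2)[of b] \<open>\<delta> > 0\<close> by auto
    moreover have "insert b P \<in> ?S"
      using P b by (auto simp: separated_def dist_commute intro: less_imp_le)
    ultimately show False using P(4)[of "insert b P"] P(1) by simp
  qed
  then show ?thesis using that P bd by blast
qed

definition shell_avg :: "nat \<Rightarrow> nat \<Rightarrow> real \<Rightarrow> ('a::euclidean_space \<Rightarrow> real) \<Rightarrow> 'a \<Rightarrow> real" where
  "shell_avg m j t h x = (\<integral>y. h y * shell_kern m j t x y \<partial>lborel)"

lemma shell_avg_Suc:
  assumes "integrable lborel h"
  shows "shell_avg (Suc m) j t h x = shell_avg m (Suc j) t h x - shell_avg m j t h x / 2^m"
proof -
  have "shell_avg (Suc m) j t h x = (\<integral>y. h y * shell_kern m (Suc j) t x y - h y * shell_kern m j t x y / 2^m \<partial>lborel)"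
    unfolding shell_avg_def
    by (intro Bochner_Integration.integral_cong) (simp_all add: shell_kern_def algebra_simps)
  also have "\<dots> = shell_avg m (Suc j) t h x - shell_avg m j t h x / 2^m"
    unfolding shell_avg_def using integrable_mult_shell_kern[OF assms]
    by (subst Bochner_Integration.integral_diff) auto
  finally show ?thesis .
qed

text \<open>The recursion is undone from level \<open>Suc m\<close> down to level 1 with ratios
  \<open>1/2^k\<close>, \<open>k \<ge> 1\<close>, which preserves summability. The last ratio is 1,
  so level 0 merely has summable increments, which still makes it bounded.\<close>

lemma shell_avg_bounded:
  assumes h: "integrable lborel h" and small: "\<And>j. j \<ge> J \<Longrightarrow> \<bar>shell_avg (Suc m) j t h x\<bar> \<le> 1 / (real (Suc j))\<^sup>2"
  shows "\<exists>B. \<forall>j. \<bar>shell_avg 0 j t h x\<bar> \<le> B"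
proof -
  have "summable (\<lambda>n. 1 / (real (Suc n))\<^sup>2)"
    using inverse_power_summable[of 2, where 'a=real] by (subst summable_Suc_iff) (simp add: inverse_eq_divide)
  then have "summable (\<lambda>j. \<bar>shell_avg (Suc m) j t h x\<bar>)"
    by (rule summable_comparison_test') (use small in auto)
  then have "summable (\<lambda>j. \<bar>shell_avg 1 j t h x\<bar>)"
  proof (induction m)
    case (Suc m)
    have "summable (\<lambda>j. \<bar>shell_avg (Suc m) j t h x\<bar>)"
    proof (rule summable_of_summable_recurrence[of "1 / 2^Suc m"])
      have "(1::real) < 2^Suc m" by (rule one_less_power) auto
      then show "(1::real) / 2^Suc m < 1" by (simp add: divide_less_eq del: power_Suc)
      show "summable (\<lambda>j. \<bar>shell_avg (Suc m) (Suc j) t h x - 1 / 2^Suc m * shell_avg (Suc m) j t h x\<bar>)"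
        using Suc.prems unfolding shell_avg_Suc[OF h, of "Suc m"] by simp
    qed simp
    then show ?case by (rule Suc.IH)
  qed simp
  then have s: "summable (\<lambda>j. \<bar>shell_avg 0 (Suc j) t h x - shell_avg 0 j t h x\<bar>)"
    using shell_avg_Suc[OF h, of 0] by simp
  have "\<bar>shell_avg 0 j t h x\<bar> \<le> \<bar>shell_avg 0 0 t h x\<bar> + (\<Sum>i<j. \<bar>shell_avg 0 (Suc i) t h x - shell_avg 0 i t h x\<bar>)" for j
    by (induction j) auto
  moreover have "(\<Sum>i<j. \<bar>shell_avg 0 (Suc i) t h x - shell_avg 0 i t h x\<bar>) \<le>
     (\<Sum>i. \<bar>shell_avg 0 (Suc i) t h x - shell_avg 0 i t h x\<bar>)" for j
    using s by (intro sum_le_suminf) auto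
  ultimately have "\<bar>shell_avg 0 j t h x\<bar> \<le> \<bar>shell_avg 0 0 t h x\<bar> + (\<Sum>i. \<bar>shell_avg 0 (Suc i) t h x - shell_avg 0 i t h x\<bar>)" for j
    by (meson add_left_mono order_trans)
  then show ?thesis by blast
qed

text \<open>A point with unbounded averages is bad for arbitrarily large \<open>j\<close>. The level
  \<open>1/(j + 1)^2\<close> enters the count squared and inverted, hence the factor
  \<open>(j + 1)^4\<close>; against balls of radius \<open>1/2^j\<close> it is beaten by the gap
  between \<open>s\<close> and the critical exponent.\<close>

lemma content_null_unbounded_shell_avg:
  assumes t: "t > 0" and d: "DIM('a::euclidean_space) \<ge> 2" and p: "1 \<le> p" "p \<le> (2::real)"
    and h: "integrable lborel h" "integrable lborel (\<lambda>y. h y powr p)" "\<And>y::'a. h y \<ge> 0"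
    and s: "s > real DIM('a) - (p - 1) * (real DIM('a) - 1)"
  shows "content_null s {x \<in> ball z (t/4). \<not> (\<exists>B. \<forall>j. \<bar>shell_avg 0 j t h x\<bar> \<le> B)}" (is "content_null s ?E")
proof -
  let ?d = "DIM('a)"
  let ?e = "real ?d - (p - 1) * (real ?d - 1)"
  have e1: "?e \<ge> 1"
  proof -
    have "(p - 1) * (real ?d - 1) \<le> 1 * (real ?d - 1)" using p d by (intro mult_right_mono) auto
    then show ?thesis by simp
  qed
  obtain C where C: "C \<ge> 0" "\<And>j z P l. finite P \<Longrightarrow> separated (1/2^j) P \<Longrightarrow> P \<subseteq> ball z (t/4) \<Longrightarrow> 0 < l \<Longrightarrow> l \<le> 1 \<Longrightarrow>
     (\<forall>x\<in>P. l \<le> \<bar>\<integral>y. h y * shell_kern (?d + 1) j t x y \<partial>lborel\<bar>) \<Longrightarrow>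
     real (card P) \<le> C / l\<^sup>2 * (2 powr ?e)^j"
    using card_large_values_Lp[OF t d p h] by blast
  define bad where "bad j = {x \<in> ball z (t/4). \<bar>shell_avg (?d + 1) j t h x\<bar> > 1 / (real (Suc j))\<^sup>2}" for j
  define N where "N j = C * real (Suc j)^4 * (2 powr ?e)^j" for j
  have bound: "real (card P) \<le> N j" if "finite P" "P \<subseteq> bad j" "separated (1/2^j) P" for P j
  proof -
    have "real (card P) \<le> C / (1 / (real (Suc j))\<^sup>2)\<^sup>2 * (2 powr ?e)^j"
    proof (rule C(2)[OF that(1,3)])
      show "P \<subseteq> ball z (t/4)" "\<forall>x\<in>P. 1 / (real (Suc j))\<^sup>2 \<le> \<bar>\<integral>y. h y * shell_kern (?d + 1) j t x y \<partial>lborel\<bar>"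
        using that(2) by (auto simp: bad_def shell_avg_def intro: less_imp_le)
      have "(real (Suc j))\<^sup>2 \<ge> 1" by (intro one_le_power) auto
      then show "1 / (real (Suc j))\<^sup>2 \<le> 1" by (simp add: divide_le_eq del: of_nat_Suc)
    qed simp
    also have "\<dots> = N j" by (simp add: N_def power_divide del: of_nat_Suc)
    finally show ?thesis .
  qed
  have "\<exists>P. finite P \<and> P \<subseteq> bad j \<and> real (card P) \<le> N j \<and> bad j \<subseteq> (\<Union>x\<in>P. cball x (1/2^j))" for j
    by (rule separated_maximal[where B="bad j" and \<delta>="1/2^j" and N="N j"]) (use bound in auto)
  then obtain P where P: "\<And>j. finite (P j)" "\<And>j. real (card (P j)) \<le> N j" "\<And>j. bad j \<subseteq> (\<Union>x\<in>P j. cball x (1/2^j))"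
    by metis
  show ?thesis
  proof (rule content_null_limsup_cballs[where P=P and r="\<lambda>j. 1/2^j"])
    show "s > 0" using e1 s by simp
    show "summable (\<lambda>j. real (card (P j)) * (2 * (1 / 2^j)) powr s)"
    proof (rule summable_comparison_test')
      define q where "q = 2 powr (?e - s)"
      have q: "0 < q" "q < 1" using s by (auto simp: q_def powr_less_one)
      have "summable (\<lambda>j. real j ^ 4 * q ^ j)" by (rule summable_power4_geometric[OF q])
      \<comment> \<open>Writing \<open>q ^ Suc j\<close> and dividing by \<open>q\<close> makes this
        a shifted copy of the preceding series.\<close>
      then show "summable (\<lambda>j. C * 2 powr s / q * (real (Suc j)^4 * q ^ Suc j))"
        by (intro summable_mult) (simp only: summable_Suc_iff[of "\<lambda>j. real j ^ 4 * q ^ j"])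
      fix j :: nat
      have "(2 * (1 / 2^j)) powr s = 2 powr s * (2 powr (- s))^j"
      proof -
        have "2 * (1 / 2^j) = (2::real) powr (1 - real j)" by (simp add: powr_diff powr_realpow)
        then have "(2 * (1 / 2^j)) powr s = 2 powr (s + (- s) * real j)"
          by (simp add: powr_powr algebra_simps)
        also have "\<dots> = 2 powr s * (2 powr (- s)) powr real j" by (simp only: powr_add powr_powr)
        finally show ?thesis by (simp add: powr_realpow)
      qed
      moreover have "(2 powr ?e)^j * (2 powr (- s))^j = q^j"
        by (simp add: q_def power_mult_distrib[symmetric] powr_add[symmetric])
      moreover have "real (card (P j)) * (2 * (1 / 2^j)) powr s \<le> N j * (2 * (1 / 2^j)) powr s"
        by (intro mult_right_mono P(2)) simp
      ultimately have "real (card (P j)) * (2 * (1 / 2^j)) powr s \<le> C * 2 powr s * (real (Suc j)^4 * q^j)"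
        by (simp add: N_def mult_ac)
      then show "norm (real (card (P j)) * (2 * (1 / 2^j)) powr s) \<le> C * 2 powr s / q * (real (Suc j)^4 * q ^ Suc j)"
        using q by simp
    qed
    fix J
    show "?E \<subseteq> (\<Union>j\<in>{J..}. \<Union>x\<in>P j. cball x (1 / 2^j))"
    proof
      fix x assume x: "x \<in> ?E"
      have "\<exists>j\<ge>J. \<not> \<bar>shell_avg (Suc ?d) j t h x\<bar> \<le> 1 / (real (Suc j))\<^sup>2"
        using shell_avg_bounded[OF h(1), of J ?d t x] x by blast
      then obtain j where "j \<ge> J" "x \<in> bad j" using x by (auto simp: bad_def not_le)
      then show "x \<in> (\<Union>j\<in>{J..}. \<Union>x\<in>P j. cball x (1 / 2^j))" using P(3)[of j] by blast
    qed
  qed (use P(1) in auto)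
qed

subsection \<open>Majorants and the spherical average\<close>

text \<open>The supremum of the \<open>g m\<close> is \<open>G powr (1/p)\<close>, where \<open>G\<close> sums the indicators of open sets \<open>U n\<close> that
  contain \<open>{x. n < \<bar>f x\<bar> powr p}\<close> with small excess. It may be infinite on a null set, where \<open>h\<close> is junk.\<close>

lemma exists_continuous_majorants:
  fixes f :: "'a::euclidean_space \<Rightarrow> real"
  assumes D: "open D" "bounded D" and p: "1 \<le> p"
    and f: "f \<in> borel_measurable lebesgue"
    and fin: "(\<integral>\<^sup>+x. ennreal (\<bar>f x\<bar> powr p) * indicator D x \<partial>lebesgue) < \<infinity>"
  obtains g h where
    "\<And>m::nat. continuous_on UNIV (g m)" "\<And>m x. 0 \<le> g m x" "\<And>m x. g m x \<le> g (Suc m) x"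
    "\<And>x. x \<in> D \<Longrightarrow> ennreal (f x) \<le> (SUP m. ennreal (g m x))"
    "\<And>x. 0 \<le> h x" "integrable lborel h" "integrable lborel (\<lambda>x::'a. h x powr p)"
    "AE x in lborel. \<forall>m. g m x \<le> h x"
proof -
  note f[measurable]
  have Dm[measurable]: "D \<in> sets borel" using D(1) by (rule borel_open)
  have DL[measurable]: "D \<in> sets lebesgue" using Dm by auto
  have Dfin: "emeasure lborel D < \<infinity>" using D(2) by (rule emeasure_bounded_finite)
  define F where "F x = \<bar>f x\<bar> powr p" for x
  define B where "B n = {x. real n < F x} \<inter> D" for n :: nat
  have Bm: "B n \<in> sets lebesgue" for n
  proof -
    have "{x \<in> space lebesgue. real n < F x} \<in> sets lebesgue" unfolding F_def by measurable
    then show ?thesis unfolding B_def using Dm by (intro sets.Int) auto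
  qed
  \<comment> \<open>On \<open>D\<close> the sum counts the \<open>n\<close> with
    \<open>n < F x\<close>, so it is the ceiling of \<open>F x\<close>. The surplus 1 is integrable
    because \<open>D\<close> is bounded.\<close>
  have Bsum: "(\<Sum>n. indicator (B n) x :: ennreal) \<le> (ennreal (F x) + 1) * indicator D x" for x
  proof (cases "x \<in> D")
    case True
    define k where "k = nat \<lceil>F x\<rceil>"
    have F0: "F x \<ge> 0" by (simp add: F_def)
    have "x \<in> B n \<longleftrightarrow> n < k" for n unfolding B_def k_def using True by auto linarith+
    then have "(\<Sum>n. indicator (B n) x :: ennreal) = (\<Sum>n<k. 1)"
      by (subst suminf_finite[of "{..<k}"]) (auto simp: indicator_def)
    also have "\<dots> = ennreal (real k)" by (simp add: ennreal_of_nat_eq_real_of_nat)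
    also have "\<dots> \<le> ennreal (F x + 1)"
    proof (rule ennreal_leI)
      have "real k = of_int \<lceil>F x\<rceil>" using F0 by (simp add: k_def)
      then show "real k \<le> F x + 1" by linarith
    qed
    finally show ?thesis using True F0 by simp
  qed (simp add: B_def)
  have "\<exists>U. open U \<and> B n \<subseteq> U \<and> U - B n \<in> lmeasurable \<and> emeasure lebesgue (U - B n) < ennreal ((1/2)^n)" for n
    by (rule sets_lebesgue_outer_open[OF Bm, of "(1/2)^n" n]) auto
  then obtain U' where U': "\<And>n. open (U' n)" "\<And>n. B n \<subseteq> U' n" "\<And>n. U' n - B n \<in> lmeasurable"
     "\<And>n. emeasure lebesgue (U' n - B n) < ennreal ((1/2)^n)" by metis
  \<comment> \<open>Cutting down to the bounded set \<open>D\<close> makes the complements nonempty,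
    as \<open>infdist\<close> from an empty set would be 0 by convention, and lets the majorant
    vanish outside \<open>D\<close>.\<close>
  define U where "U n = U' n \<inter> D" for n
  have U: "open (U n)" "B n \<subseteq> U n" "U n \<subseteq> D" for n
    using U'(1,2) D(1) by (auto simp: U_def B_def)
  have Um[measurable]: "U n \<in> sets borel" for n using U(1) by (rule borel_open)
  have Uem: "emeasure lborel (U n) \<le> emeasure lebesgue (B n) + ennreal ((1/2)^n)" for n
  proof -
    have "emeasure lborel (U n) = emeasure lebesgue (U n)" by (simp add: emeasure_completion)
    also have "\<dots> \<le> emeasure lebesgue (B n \<union> (U' n - B n))"
      by (intro emeasure_mono sets.Un Bm fmeasurableD[OF U'(3)]) (auto simp: U_def)
    also have "\<dots> \<le> emeasure lebesgue (B n) + emeasure lebesgue (U' n - B n)"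
      by (intro emeasure_subadditive Bm fmeasurableD[OF U'(3)])
    also have "\<dots> \<le> emeasure lebesgue (B n) + ennreal ((1/2)^n)"
      using U'(4)[of n] by (intro add_left_mono) simp
    finally show ?thesis .
  qed
  define G where "G x = (\<Sum>n. indicator (U n) x :: ennreal)" for x
  have Gm[measurable]: "G \<in> borel_measurable borel" unfolding G_def[abs_def] by measurable
  have Gfin: "(\<integral>\<^sup>+x. G x \<partial>lborel) < \<infinity>"
  proof -
    have "(\<integral>\<^sup>+x. G x \<partial>lborel) = (\<Sum>n. emeasure lborel (U n))"
      unfolding G_def by (subst nn_integral_suminf) auto
    also have "\<dots> \<le> (\<Sum>n. emeasure lebesgue (B n) + ennreal ((1/2)^n))"
      by (intro suminf_le Uem) auto
    also have "\<dots> = (\<Sum>n. emeasure lebesgue (B n)) + (\<Sum>n. ennreal ((1/2)^n))"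
      by (intro suminf_add[symmetric]) auto
    also have "(\<Sum>n. ennreal ((1/2)^n)) = ennreal 2"
      using geometric_sums[of "1/2::real"] by (intro suminf_ennreal_eq) auto
    also have "(\<Sum>n. emeasure lebesgue (B n)) = (\<integral>\<^sup>+x. (\<Sum>n. indicator (B n) x) \<partial>lebesgue)"
      using Bm by (subst nn_integral_suminf) auto
    also have "\<dots> \<le> (\<integral>\<^sup>+x. (ennreal (F x) + 1) * indicator D x \<partial>lebesgue)"
      by (intro nn_integral_mono Bsum)
    also have "\<dots> = (\<integral>\<^sup>+x. ennreal (F x) * indicator D x + indicator D x \<partial>lebesgue)"
      by (simp add: distrib_right)
    also have "\<dots> = (\<integral>\<^sup>+x. ennreal (F x) * indicator D x \<partial>lebesgue) + emeasure lborel D"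
      unfolding F_def using Dm by (subst nn_integral_add) (auto simp: emeasure_completion)
    finally have "(\<integral>\<^sup>+x. G x \<partial>lborel) \<le>
        (\<integral>\<^sup>+x. ennreal (F x) * indicator D x \<partial>lebesgue) + emeasure lborel D + ennreal 2"
      by (simp add: add_right_mono)
    also have "\<dots> < \<infinity>" using fin Dfin unfolding F_def by simp
    finally show ?thesis .
  qed
  \<comment> \<open>Continuous ramps that increase with \<open>m\<close> to the indicator of the
    open set \<open>U n\<close>.\<close>
  define T where "T m n x = min 1 (real m * infdist x (- U n))" for m n x
  have T0: "0 \<le> T m n x" for m n x by (simp add: T_def infdist_nonneg)
  have Tind: "T m n x \<le> indicator (U n) x" for m n x
    by (cases "x \<in> U n") (auto simp: T_def)
  have Tmono: "T m n x \<le> T (Suc m) n x" for m n x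
    unfolding T_def by (intro min.mono mult_right_mono infdist_nonneg) auto
  define Gm where "Gm m x = (\<Sum>n<m. T m n x)" for m x
  have Gm0: "0 \<le> Gm m x" for m x unfolding Gm_def by (intro sum_nonneg T0)
  have Gmc: "continuous_on UNIV (Gm m)" for m
    unfolding Gm_def[abs_def] T_def by (intro continuous_intros)
  have Gmmono: "Gm m x \<le> Gm (Suc m) x" for m x
    unfolding Gm_def using T0 Tmono by (simp add: add_increasing2 sum_mono)
  have GmG: "ennreal (Gm m x) \<le> G x" for m x
  proof -
    have "ennreal (Gm m x) = (\<Sum>n<m. ennreal (T m n x))"
      unfolding Gm_def using T0 by (simp add: sum_ennreal)
    also have "\<dots> \<le> (\<Sum>n<m. indicator (U n) x)"
    proof (rule sum_mono)
      fix n show "ennreal (T m n x) \<le> indicator (U n) x"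
        using ennreal_leI[OF Tind[of m n x]] by (simp add: ennreal_indicator)
    qed
    also have "\<dots> \<le> G x" unfolding G_def by (intro sum_le_suminf) auto
    finally show ?thesis .
  qed
  \<comment> \<open>Finitely many of the sets \<open>U n\<close> already add up to at least
    \<open>F x\<close>, and from some common \<open>m\<close> on all their ramps equal 1 at
    \<open>x\<close>.\<close>
  have GmF: "\<exists>m. F x \<le> Gm m x" if x: "x \<in> D" for x
  proof -
    define k where "k = nat \<lceil>F x\<rceil>"
    have xU: "x \<in> U n" if "n < k" for n
    proof -
      have "x \<in> B n" using that x unfolding B_def k_def by auto linarith
      then show ?thesis using U(2) by blast
    qed
    have "\<exists>m. real m * infdist x (- U n) \<ge> 1" if "n < k" for n
    proof -
      have "- U n \<noteq> {}"
      proof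
        assume "- U n = {}"
        then have "U n = UNIV" by blast
        then have "bounded (UNIV :: 'a set)" using bounded_subset[OF D(2) U(3)[of n]] by simp
        then show False using not_bounded_UNIV by blast
      qed
      then have "infdist x (- U n) > 0"
        using U(1) xU[OF that] by (intro infdist_pos_not_in_closed) (auto simp: open_closed)
      then obtain m where "real m * infdist x (- U n) > 1" using reals_Archimedean3 by blast
      then show ?thesis by (auto intro: less_imp_le)
    qed
    then obtain \<mu> where \<mu>: "\<And>n. n < k \<Longrightarrow> real (\<mu> n) * infdist x (- U n) \<ge> 1" by metis
    define m where "m = Max (insert k (\<mu> ` {..<k}))"
    have mk: "k \<le> m" "\<And>n. n < k \<Longrightarrow> \<mu> n \<le> m" by (auto simp: m_def)
    have T1: "T m n x = 1" if "n < k" for n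
    proof -
      have "real (\<mu> n) * infdist x (- U n) \<le> real m * infdist x (- U n)"
        using mk(2)[OF that] by (intro mult_right_mono infdist_nonneg) auto
      then show ?thesis using \<mu>[OF that] by (simp add: T_def)
    qed
    have "F x \<le> real k" unfolding k_def by linarith
    also have "real k = (\<Sum>n<k. T m n x)" using T1 by simp
    also have "\<dots> \<le> Gm m x" unfolding Gm_def using mk(1) T0 by (intro sum_mono2) auto
    finally show ?thesis by blast
  qed
  define g where "g m x = Gm m x powr (1/p)" for m x
  define h where "h x = enn2real (G x) powr (1/p)" for x
  have hp: "h x powr p = enn2real (G x)" for x using p by (simp add: h_def powr_powr)
  have iG: "integrable lborel (\<lambda>x. enn2real (G x))"
  proof (rule integrableI_bounded)
    have "(\<integral>\<^sup>+x. ennreal (norm (enn2real (G x))) \<partial>lborel) \<le> (\<integral>\<^sup>+x. G x \<partial>lborel)"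
      by (intro nn_integral_mono) (simp add: ennreal_enn2real_if)
    then show "(\<integral>\<^sup>+x. ennreal (norm (enn2real (G x))) \<partial>lborel) < \<infinity>" using Gfin by simp
  qed measurable
  show ?thesis
  proof (rule that[of g h])
    show "continuous_on UNIV (g m)" for m
      unfolding g_def[abs_def] using p Gm0 by (intro continuous_on_powr' Gmc continuous_on_const) auto
    show "0 \<le> g m x" for m x by (simp add: g_def)
    show "g m x \<le> g (Suc m) x" for m x
      unfolding g_def using p by (intro powr_mono2 Gmmono Gm0) auto
    show "ennreal (f x) \<le> (SUP m. ennreal (g m x))" if x: "x \<in> D" for x
    proof -
      obtain m where m: "F x \<le> Gm m x" using GmF[OF x] by blast
      have "f x \<le> \<bar>f x\<bar>" by simp
      also have "\<bar>f x\<bar> = F x powr (1/p)" using p by (simp add: F_def powr_powr)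
      also have "\<dots> \<le> g m x" unfolding g_def using p m by (intro powr_mono2) (auto simp: F_def)
      finally have "ennreal (f x) \<le> ennreal (g m x)" by (rule ennreal_leI)
      also have "\<dots> \<le> (SUP m. ennreal (g m x))" by (rule SUP_upper) simp
      finally show ?thesis .
    qed
    show "0 \<le> h x" for x by (simp add: h_def)
    show "integrable lborel (\<lambda>x. h x powr p)" unfolding hp by (rule iG)
    \<comment> \<open>Here \<open>h \<le> 1 + h powr p\<close> on the bounded set \<open>D\<close>,
      and \<open>h\<close> vanishes elsewhere.\<close>
    show "integrable lborel h"
    proof (rule Bochner_Integration.integrable_bound)
      show "integrable lborel (\<lambda>x. indicator D x + enn2real (G x))"
        using Dfin iG by (intro Bochner_Integration.integrable_add integrable_real_indicator) auto
      show "h \<in> borel_measurable lborel" unfolding h_def[abs_def] by measurable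
      show "AE x in lborel. norm (h x) \<le> norm (indicator D x + enn2real (G x))"
      proof (rule AE_I2)
        fix x
        show "norm (h x) \<le> norm (indicator D x + enn2real (G x))"
        proof (cases "x \<in> D")
          case True
          have "h x \<le> 1 + enn2real (G x)"
          proof (cases "enn2real (G x) \<le> 1")
            case True
            then have "h x \<le> 1" unfolding h_def using p by (intro powr_le1) auto
            then show ?thesis by (simp add: add_increasing2)
          next
            case False
            then have "h x \<le> enn2real (G x) powr 1" unfolding h_def using p by (intro powr_mono) auto
            then show ?thesis using False by simp
          qed
          then show ?thesis using True by (simp add: h_def)
        next
          case False
          then have "indicator (U n) x = (0::ennreal)" for n using U(3)[of n] by (auto simp: indicator_def)
          then have "G x = 0" by (simp add: G_def)
          then show ?thesis by (simp add: h_def)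
        qed
      qed
    qed
    have "AE x in lborel. G x \<noteq> \<infinity>"
      using Gfin by (intro nn_integral_PInf_AE) auto
    then show "AE x in lborel. \<forall>m. g m x \<le> h x"
    proof eventually_elim
      case (elim x)
      show ?case
      proof
        fix m
        have "ennreal (Gm m x) \<le> ennreal (enn2real (G x))"
          using GmG[of m x] elim by (simp add: ennreal_enn2real_if)
        then have "Gm m x \<le> enn2real (G x)" by (simp add: ennreal_le_iff)
        then show "g m x \<le> h x" unfolding g_def h_def using p Gm0 by (intro powr_mono2) auto
      qed
    qed
  qed
qed

text \<open>Polar coordinates are only needed for functions of the direction, where they are a scaling identity.\<close>

lemma nn_integral_sgn_annulus:
  fixes k :: "'a::euclidean_space \<Rightarrow> real"
  assumes k[measurable]: "(\<lambda>w. k (sgn w)) \<in> borel_measurable borel" and K: "\<And>v. norm v = 1 \<Longrightarrow> k v \<le> K"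
    and ab: "0 < a" "a \<le> b"
  shows "(\<integral>\<^sup>+w. ennreal (k (sgn w)) * indicator (ball 0 b - ball 0 a) w \<partial>lborel) =
    ennreal (b^DIM('a) - a^DIM('a)) * (\<integral>\<^sup>+w. ennreal (k (sgn w)) * indicator (ball 0 1 - {0}) w \<partial>lborel)"
proof -
  let ?d = "DIM('a)"
  define I where "I r = (\<integral>\<^sup>+w. ennreal (k (sgn w)) * indicator (ball 0 r - {0}) (w::'a) \<partial>lborel)" for r
  have scale: "I r = ennreal (r^?d) * I 1" if "r > 0" for r
  proof -
    have [measurable]: "ball (0::'a) r - {0} \<in> sets borel" by auto
    have m: "(\<lambda>w. ennreal (k (sgn w)) * indicator (ball 0 r - {0}) w) \<in> borel_measurable borel"
      by measurable
    have "I r = ennreal (\<bar>r\<bar>^?d) * (\<integral>\<^sup>+w. ennreal (k (sgn (0 + r *\<^sub>R w))) * indicator (ball 0 r - {0}) (0 + r *\<^sub>R w) \<partial>(lborel::'a measure))"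
      unfolding I_def by (rule nn_integral_lborel_affine[OF m]) (use that in simp)
    also have "(\<lambda>w. ennreal (k (sgn (0 + r *\<^sub>R w))) * indicator (ball 0 r - {0}) (0 + r *\<^sub>R w)) =
       (\<lambda>w. ennreal (k (sgn w)) * indicator (ball 0 1 - {0}) (w::'a))"
      using that by (auto simp: fun_eq_iff sgn_scaleR indicator_def)
    finally show ?thesis using that by (simp add: I_def)
  qed
  \<comment> \<open>Finiteness, the purpose of the bound \<open>K\<close>, is what allows the
    contribution of the inner ball to be cancelled in \<open>ennreal\<close>.\<close>
  have fin: "I 1 < \<infinity>"
  proof -
    have "I 1 \<le> (\<integral>\<^sup>+w. ennreal K * indicator (ball 0 1) (w::'a) \<partial>lborel)"
      unfolding I_def by (intro nn_integral_mono) (auto simp: indicator_def norm_sgn intro!: ennreal_leI K)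
    also have "\<dots> = ennreal K * emeasure lborel (ball (0::'a) 1)" by (subst nn_integral_cmult_indicator) auto
    also have "\<dots> < \<infinity>" using emeasure_lborel_ball_finite[of "0::'a" 1] by (simp add: ennreal_mult_less_top)
    finally show ?thesis .
  qed
  let ?X = "\<integral>\<^sup>+w. ennreal (k (sgn w)) * indicator (ball 0 b - ball 0 a) (w::'a) \<partial>lborel"
  have [measurable]: "ball (0::'a) a - {0} \<in> sets borel" "ball (0::'a) b - ball 0 a \<in> sets borel" by auto
  have "I b = (\<integral>\<^sup>+w. ennreal (k (sgn w)) * indicator (ball 0 a - {0}) w +
      ennreal (k (sgn w)) * indicator (ball 0 b - ball 0 a) (w::'a) \<partial>lborel)"
    unfolding I_def
  proof (rule nn_integral_cong)
    fix w :: 'a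
    have "(indicator (ball 0 b - {0}) w :: ennreal) = indicator (ball 0 a - {0}) w + indicator (ball 0 b - ball 0 a) w"
      using ab by (auto simp: indicator_def)
    then show "ennreal (k (sgn w)) * indicator (ball 0 b - {0}) w =
      ennreal (k (sgn w)) * indicator (ball 0 a - {0}) w + ennreal (k (sgn w)) * indicator (ball 0 b - ball 0 a) w"
      by (simp only: distrib_left)
  qed
  also have "\<dots> = I a + ?X"
    unfolding I_def by (rule nn_integral_add) measurable
  finally have "I b = I a + ?X" .
  moreover have "I a = ennreal (a^?d) * I 1" "I b = ennreal (b^?d) * I 1"
    using ab by (intro scale; linarith)+
  ultimately have "ennreal (b^?d) * I 1 = ennreal (a^?d) * I 1 + ?X" by metis
  moreover have "ennreal (b^?d) = ennreal (a^?d) + ennreal (b^?d - a^?d)"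
  proof -
    have "0 \<le> a^?d" "0 \<le> b^?d - a^?d" using ab by (auto intro: power_mono)
    then show ?thesis by (metis ennreal_plus diff_add_cancel add.commute)
  qed
  ultimately have eq: "ennreal (a^?d) * I 1 + ennreal (b^?d - a^?d) * I 1 = ennreal (a^?d) * I 1 + ?X"
    by (simp only: distrib_right)
  have "ennreal (a^?d) * I 1 \<noteq> top" using fin by (simp add: ennreal_mult_eq_top_iff)
  then have "ennreal (b^?d - a^?d) * I 1 = ?X" using eq by (metis ennreal_add_left_cancel infinity_ennreal_def)
  then show ?thesis unfolding I_def by simp
qed

lemma nn_integral_sphere_measure:
  fixes k :: "'a::euclidean_space \<Rightarrow> ennreal"
  assumes [measurable]: "k \<in> borel_measurable borel"
  shows "(\<integral>\<^sup>+y. k y \<partial>sphere_measure) =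
    of_nat DIM('a) * (\<integral>\<^sup>+w. k (sgn w) * indicator (ball 0 1 - {0}) w \<partial>lborel)"
proof -
  have km: "k \<in> borel_measurable (restrict_space borel (sphere 0 1))"
    by (intro measurable_restrict_space1) simp
  have "(\<integral>\<^sup>+y. k y \<partial>sphere_measure) = of_nat DIM('a) *
     (\<integral>\<^sup>+w. k (sgn w) \<partial>restrict_space lborel (ball 0 1 - {0}))"
    unfolding sphere_measure_def using km
    by (simp add: nn_integral_scale_measure nn_integral_distr[OF sgn_measurable_sphere])
  also have "(\<integral>\<^sup>+w. k (sgn w) \<partial>restrict_space lborel (ball 0 1 - {0})) =
     (\<integral>\<^sup>+w. k (sgn w) * indicator (ball 0 1 - {0}) w \<partial>lborel)"
    by (rule nn_integral_restrict_space) auto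
  finally show ?thesis .
qed

text \<open>By uniform continuity, on a thin enough shell \<open>g\<close> differs by less than 1
  from its value at the radial projection, so the shell average of \<open>g + 1\<close> dominates
  the spherical one. The added 1 costs \<open>shell_vol_const\<close>. Although \<open>j\<close>
  depends on \<open>g\<close>, the constants do not.\<close>

lemma shell_avg_ge_sphere_average:
  fixes g h :: "'a::euclidean_space \<Rightarrow> real"
  assumes t: "t > 0" and d: "DIM('a) \<ge> 2"
    and g: "continuous_on UNIV g" "\<And>y. 0 \<le> g y"
    and h: "integrable lborel h" "\<And>y. 0 \<le> h y" "AE y in lborel. g y \<le> h y"
  shows "\<exists>j. ennreal (t^(DIM('a) - 2)) * (\<integral>\<^sup>+w. ennreal (g (x - t *\<^sub>R sgn w)) * indicator (ball 0 1 - {0}) w \<partial>lborel)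
     \<le> ennreal (shell_avg 0 j t h x + shell_vol_const TYPE('a) t)"
proof -
  let ?d = "DIM('a)"
  let ?k = "\<lambda>v. g (x - t *\<^sub>R v)"
  have gm[measurable]: "g \<in> borel_measurable borel" using g(1) by (rule borel_measurable_continuous_onI)
  have "(\<lambda>w::'a. w /\<^sub>R norm w) \<in> borel_measurable borel" by measurable
  then have sgnm[measurable]: "(sgn :: 'a \<Rightarrow> 'a) \<in> borel_measurable borel"
    by (simp add: sgn_div_norm[abs_def])
  have "continuous_on (cball x (t + 1)) g" using g(1) by (rule continuous_on_subset) simp
  then have "uniformly_continuous_on (cball x (t + 1)) g" by (intro compact_uniformly_continuous) auto
  then obtain e where e: "e > 0" "\<And>u v. u \<in> cball x (t + 1) \<Longrightarrow> v \<in> cball x (t + 1) \<Longrightarrow> dist u v < e \<Longrightarrow> dist (g u) (g v) < 1"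
    unfolding uniformly_continuous_on_def by (metis zero_less_one)
  obtain K where K: "\<And>u. u \<in> cball x (t + 1) \<Longrightarrow> \<bar>g u\<bar> \<le> K"
    using compact_imp_bounded[OF compact_continuous_image[OF \<open>continuous_on (cball x (t + 1)) g\<close> compact_cball]]
    unfolding bounded_iff by (metis imageI real_norm_def)
  have "e * t > 0" using e t by simp
  \<comment> \<open>The shell has thickness at most \<open>1 / (2^j * t)\<close>, which this choice
    makes smaller than \<open>e\<close>.\<close>
  then obtain j where j: "(1/2::real)^j < e * t" using real_arch_pow_inv[of "e * t" "1/2"] by auto
  define b where "b = sqrt (t\<^sup>2 + 1/2^j)"
  have b: "t \<le> b" "b \<le> t + 1" "b - t < e" "b\<^sup>2 = t\<^sup>2 + 1/2^j"
  proof -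
    show "t \<le> b" unfolding b_def by (rule real_le_rsqrt) simp
    show "b \<le> t + 1" unfolding b_def by (rule shell_outer_radius[OF t])
    show "b\<^sup>2 = t\<^sup>2 + 1/2^j" by (simp add: b_def)
    have "1 / (2^j * t) < e" using j t by (simp add: field_simps power_one_over)
    then show "b - t < e" using shell_outer_radius(1)[OF t, of j] unfolding b_def by linarith
  qed
  let ?A = "ball (0::'a) b - ball 0 t"
  have Am[measurable]: "?A \<in> sets borel" by auto
  have ann: "?k (sgn w) \<le> g (x - w) + 1" "x - w \<in> shell j t x" if "w \<in> ?A" for w
  proof -
    have w: "t \<le> norm w" "norm w < b" using that by auto
    then have w0: "w \<noteq> 0" using t by auto
    have "w - t *\<^sub>R sgn w = (norm w - t) *\<^sub>R sgn w"
      using w0 by (simp add: sgn_div_norm algebra_simps)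
    then have "norm (w - t *\<^sub>R sgn w) = norm w - t"
      using w w0 by (simp add: norm_sgn)
    then have "dist (x - w) (x - t *\<^sub>R sgn w) < e"
      using w b by (simp add: dist_norm norm_minus_commute)
    then have "dist (g (x - w)) (g (x - t *\<^sub>R sgn w)) < 1"
      using w w0 b t by (intro e(2)) (auto simp: dist_norm norm_sgn)
    then show "?k (sgn w) \<le> g (x - w) + 1" by (simp add: dist_real_def)
    have "t\<^sup>2 \<le> (norm w)\<^sup>2" "(norm w)\<^sup>2 \<le> b\<^sup>2" using w t by (auto intro: power_mono)
    then show "x - w \<in> shell j t x" using b(4) by (simp add: shell_def dist_norm)
  qed
  let ?J = "\<integral>\<^sup>+w. ennreal (?k (sgn w)) * indicator (ball 0 1 - {0}) (w::'a) \<partial>lborel"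
  \<comment> \<open>The normalisation \<open>2^j\<close> matches the volume from below:
    \<open>b^d - t^d \<ge> t^(d - 2) * (b^2 - t^2)\<close>, and \<open>b^2 - t^2\<close> is exactly
    \<open>1/2^j\<close>.\<close>
  have "t^(?d - 2) \<le> 2^j * (b^?d - t^?d)"
  proof -
    have dd: "?d = (?d - 2) + 2" using d by simp
    have "t^(?d - 2) * b\<^sup>2 \<le> b^(?d - 2) * b\<^sup>2" using t b by (intro mult_right_mono power_mono) auto
    also have "\<dots> = b^?d" by (metis dd power_add)
    finally have "t^(?d - 2) * (t\<^sup>2 + 1/2^j) \<le> b^?d" using b(4) by simp
    moreover have "t^(?d - 2) * t\<^sup>2 = t^?d" by (metis dd power_add)
    ultimately have "t^(?d - 2) / 2^j \<le> b^?d - t^?d" by (simp add: distrib_left)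
    then show ?thesis by (simp add: field_simps)
  qed
  then have "ennreal (t^(?d - 2)) * ?J \<le> ennreal (2^j * (b^?d - t^?d)) * ?J"
    by (intro mult_right_mono ennreal_leI) auto
  also have "\<dots> = ennreal (2^j) * (ennreal (b^?d - t^?d) * ?J)"
    using b t by (subst ennreal_mult) (auto simp: mult.assoc intro: power_mono)
  also have "ennreal (b^?d - t^?d) * ?J = (\<integral>\<^sup>+w. ennreal (?k (sgn w)) * indicator ?A w \<partial>lborel)"
  proof (rule nn_integral_sgn_annulus[symmetric, where K=K])
    show "?k v \<le> K" if "norm v = 1" for v
    proof -
      have "x - t *\<^sub>R v \<in> cball x (t + 1)" using that t by (simp add: dist_norm)
      then show ?thesis using K[of "x - t *\<^sub>R v"] by linarith
    qed
  qed (use t b in \<open>auto intro!: measurable_compose[OF _ gm]\<close>)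
  also have "ennreal (2^j) * (\<integral>\<^sup>+w. ennreal (?k (sgn w)) * indicator ?A w \<partial>lborel) \<le>
      ennreal (2^j) * (\<integral>\<^sup>+w. ennreal ((g (x - w) + 1) * indicator (shell j t x) (x - w)) \<partial>lborel)"
    by (intro mult_left_mono nn_integral_mono) (use ann in \<open>auto simp: indicator_def intro!: ennreal_leI\<close>)
  also have "(\<integral>\<^sup>+w. ennreal ((g (x - w) + 1) * indicator (shell j t x) (x - w)) \<partial>lborel) =
      (\<integral>\<^sup>+y. ennreal ((g y + 1) * indicator (shell j t x) y) \<partial>lborel)"
    using nn_integral_lborel_affine[of "\<lambda>y. ennreal ((g y + 1) * indicator (shell j t x) y)" "-1" x] by simp
  also have "ennreal (2^j) * \<dots> = (\<integral>\<^sup>+y. ennreal (2^j) * ennreal ((g y + 1) * indicator (shell j t x) y) \<partial>lborel)"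
    by (rule nn_integral_cmult[symmetric]) measurable
  also have "\<dots> \<le> (\<integral>\<^sup>+y. ennreal (h y * shell_kern 0 j t x y + 2^j * indicator (shell j t x) y) \<partial>lborel)"
  proof (rule nn_integral_mono_AE)
    show "AE y in lborel. ennreal (2^j) * ennreal ((g y + 1) * indicator (shell j t x) y) \<le>
      ennreal (h y * shell_kern 0 j t x y + 2^j * indicator (shell j t x) y)"
      using h(3)
    proof eventually_elim
      case (elim y)
      have "2^j * ((g y + 1) * indicator (shell j t x) y) \<le> h y * shell_kern 0 j t x y + 2^j * indicator (shell j t x) y"
        using elim by (auto simp: shell_kern_def shell_def indicator_def algebra_simps)
      then show ?case using g(2) by (subst ennreal_mult'[symmetric]) (auto intro: ennreal_leI)
    qed
  qed
  also have "\<dots> = ennreal (\<integral>y. h y * shell_kern 0 j t x y + 2^j * indicator (shell j t x) y \<partial>lborel)"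
  proof (rule nn_integral_eq_integral)
    show "integrable lborel (\<lambda>y. h y * shell_kern 0 j t x y + 2^j * indicator (shell j t x) y)"
      by (intro Bochner_Integration.integrable_add integrable_mult_shell_kern h integrable_mult_right integrable_shell_indicator t)
    show "AE y in lborel. 0 \<le> h y * shell_kern 0 j t x y + 2^j * indicator (shell j t x) y"
      using h(2) by (intro AE_I2) (auto simp: shell_kern_def)
  qed
  also have "(\<integral>y. h y * shell_kern 0 j t x y + 2^j * indicator (shell j t x) y \<partial>lborel) =
      shell_avg 0 j t h x + 2^j * measure lborel (shell j t x)"
    unfolding shell_avg_def using integrable_mult_shell_kern[OF h(1), of 0 j t x] integrable_shell_indicator[OF t, of j x]
    by (subst Bochner_Integration.integral_add) auto
  also have "ennreal (shell_avg 0 j t h x + 2^j * measure lborel (shell j t x)) \<le>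
      ennreal (shell_avg 0 j t h x + shell_vol_const TYPE('a) t)"
    using measure_shell_le[OF t, of j x] by (intro ennreal_leI add_left_mono) (simp add: field_simps)
  finally show ?thesis by blast
qed

text \<open>The level \<open>j\<close> at which the spherical average of \<open>g m\<close> is
  dominated depends on \<open>m\<close>, but a bound on the shell averages at all levels gives a
  \<open>C\<close> that does not. Monotone convergence then makes the integral of the supremum
  finite.\<close>

lemma shell_avg_unbounded:
  fixes g :: "nat \<Rightarrow> 'a::euclidean_space \<Rightarrow> real"
  assumes t: "t > 0" and d: "DIM('a) \<ge> 2"
    and g: "\<And>m. continuous_on UNIV (g m)" "\<And>m y. 0 \<le> g m y" "\<And>m y. g m y \<le> g (Suc m) y"
    and h: "integrable lborel h" "\<And>y. 0 \<le> h y" "AE y in lborel. \<forall>m. g m y \<le> h y"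
    and inf: "(\<integral>\<^sup>+y. (SUP m. ennreal (g m (x - t *\<^sub>R y))) \<partial>sphere_measure) = \<infinity>"
  shows "\<not> (\<exists>B. \<forall>j. \<bar>shell_avg 0 j t h x\<bar> \<le> B)"
proof
  assume "\<exists>B. \<forall>j. \<bar>shell_avg 0 j t h x\<bar> \<le> B"
  then obtain B where B: "\<And>j. \<bar>shell_avg 0 j t h x\<bar> \<le> B" by blast
  let ?d = "DIM('a)"
  let ?k = "\<lambda>m (w::'a). ennreal (g m (x - t *\<^sub>R sgn w)) * indicator (ball 0 1 - {0}) w"
  define C where "C = (B + shell_vol_const TYPE('a) t) / t^(?d - 2)"
  have [measurable]: "g m \<in> borel_measurable borel" for m
    using g(1) by (rule borel_measurable_continuous_onI)
  have "(\<lambda>w::'a. w /\<^sub>R norm w) \<in> borel_measurable borel" by measurable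
  then have [measurable]: "(sgn :: 'a \<Rightarrow> 'a) \<in> borel_measurable borel"
    by (simp add: sgn_div_norm[abs_def])
  have [measurable]: "ball (0::'a) 1 - {0} \<in> sets borel" by auto
  have J: "(\<integral>\<^sup>+w. ?k m w \<partial>lborel) \<le> ennreal C" for m
  proof -
    have "AE y in lborel. g m y \<le> h y" using h(3) by auto
    then obtain j where "ennreal (t^(?d - 2)) * (\<integral>\<^sup>+w. ?k m w \<partial>lborel) \<le> ennreal (shell_avg 0 j t h x + shell_vol_const TYPE('a) t)"
      using shell_avg_ge_sphere_average[OF t d g(1) g(2) h(1,2)] by blast
    also have "\<dots> \<le> ennreal (B + shell_vol_const TYPE('a) t)"
      using B[of j] by (intro ennreal_leI) linarith
    also have "\<dots> = ennreal (t^(?d - 2) * C)" using t by (simp add: C_def)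
    also have "\<dots> = ennreal (t^(?d - 2)) * ennreal C" using t by (intro ennreal_mult') simp
    finally show ?thesis using t by (subst (asm) ennreal_mult_le_mult_iff) auto
  qed
  have "(\<integral>\<^sup>+y. (SUP m. ennreal (g m (x - t *\<^sub>R y))) \<partial>sphere_measure) =
      of_nat ?d * (\<integral>\<^sup>+w. (SUP m. ennreal (g m (x - t *\<^sub>R sgn w))) * indicator (ball 0 1 - {0}) w \<partial>lborel)"
    by (rule nn_integral_sphere_measure) measurable
  also have "(\<integral>\<^sup>+w. (SUP m. ennreal (g m (x - t *\<^sub>R sgn w))) * indicator (ball 0 1 - {0}) w \<partial>lborel) =
     (\<integral>\<^sup>+w. (SUP m. ?k m w) \<partial>lborel)"
    by (intro nn_integral_cong) (simp add: SUP_mult_right_ennreal)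
  also have "\<dots> = (SUP m. \<integral>\<^sup>+w. ?k m w \<partial>lborel)"
  proof (rule nn_integral_monotone_convergence_SUP)
    show "incseq ?k"
      by (intro incseq_SucI le_funI mult_right_mono ennreal_leI g(3)) auto
  qed measurable
  also have "\<dots> \<le> ennreal C" by (intro SUP_least J)
  finally have "(\<integral>\<^sup>+y. (SUP m. ennreal (g m (x - t *\<^sub>R y))) \<partial>sphere_measure) \<le> of_nat ?d * ennreal C"
    by (simp add: mult_left_mono)
  also have "\<dots> < \<infinity>" by (simp add: ennreal_of_nat_eq_real_of_nat ennreal_mult_less_top)
  finally show False using inf by simp
qed

section \<open>Localisation and the dimension bound\<close>

lemma content_null_subset:
  assumes "content_null s B" "A \<subseteq> B"
  shows "content_null s A"
  unfolding content_null_def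
proof (intro allI impI)
  fix \<epsilon> :: real assume "\<epsilon> > 0"
  then obtain U where "B \<subseteq> (\<Union>i. U i)" "\<forall>i::nat. bounded (U i)" "(\<Sum>i. diam_power s (U i)) \<le> ennreal \<epsilon>"
    using assms(1) unfolding content_null_def by blast
  then show "\<exists>U :: nat \<Rightarrow> 'a set. A \<subseteq> (\<Union>i. U i) \<and> (\<forall>i. bounded (U i)) \<and> (\<Sum>i. diam_power s (U i)) \<le> ennreal \<epsilon>"
    using subset_trans[OF assms(2)] by (intro exI[of _ U]) simp
qed

lemma content_null_infinity_set:
  fixes f :: "'a::euclidean_space \<Rightarrow> real"
  assumes t: "t > 0" and d: "DIM('a) \<ge> 2" and p: "1 \<le> p" "p \<le> 2"
    and f: "f \<in> borel_measurable lebesgue"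
    and fin: "\<And>z r. (\<integral>\<^sup>+x. ennreal (\<bar>f x\<bar> powr p) * indicator (ball z r) x \<partial>lebesgue) < \<infinity>"
    and s: "s > real DIM('a) - (p - 1) * (real DIM('a) - 1)"
  shows "content_null s (infinity_set t f)"
proof -
  \<comment> \<open>For \<open>x\<close> in this ball the sphere of radius \<open>t\<close> about
    \<open>x\<close> stays within \<open>5 * t / 4\<close> of \<open>z\<close>, so a majorant on
    \<open>ball z (2 * t)\<close> suffices.\<close>
  have loc: "content_null s (infinity_set t f \<inter> ball z (t/4))" for z
  proof -
    obtain g h where gh: "\<And>m::nat. continuous_on UNIV (g m)" "\<And>m x. 0 \<le> g m x" "\<And>m x. g m x \<le> g (Suc m) x"
      "\<And>x. x \<in> ball z (2 * t) \<Longrightarrow> ennreal (f x) \<le> (SUP m. ennreal (g m x))"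
      "\<And>x. 0 \<le> h x" "integrable lborel h" "integrable lborel (\<lambda>x::'a. h x powr p)"
      "AE x in lborel. \<forall>m. g m x \<le> h x"
      by (rule exists_continuous_majorants[OF open_ball[of z "2 * t"] bounded_ball p(1) f fin]) (rule that; assumption)
    have "infinity_set t f \<inter> ball z (t/4) \<subseteq> {x \<in> ball z (t/4). \<not> (\<exists>B. \<forall>j. \<bar>shell_avg 0 j t h x\<bar> \<le> B)}"
    proof
      fix x assume x: "x \<in> infinity_set t f \<inter> ball z (t/4)"
      then have "(\<integral>\<^sup>+ y. ennreal (f (x - t *\<^sub>R y)) \<partial>sphere_measure) = \<infinity>"
        by (simp add: infinity_set_def sphere_average_eq_infinity_iff)
      moreover have "(\<integral>\<^sup>+ y. ennreal (f (x - t *\<^sub>R y)) \<partial>sphere_measure) \<le>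
          (\<integral>\<^sup>+y. (SUP m. ennreal (g m (x - t *\<^sub>R y))) \<partial>sphere_measure)"
      \<comment> \<open>\<open>f\<close> is only Lebesgue measurable, so its restriction to a null
        sphere may be arbitrary; the comparison therefore holds at every point of the sphere rather
        than almost everywhere.\<close>
      proof (rule nn_integral_mono)
        fix y :: 'a assume "y \<in> space sphere_measure"
        then have y: "norm y = 1"
          by (simp add: sphere_measure_def space_scale_measure space_restrict_space)
        have "norm (x - t *\<^sub>R y - z) \<le> norm (x - z) + norm (t *\<^sub>R y)"
          using norm_triangle_ineq4[of "x - z" "t *\<^sub>R y"] by (simp add: algebra_simps)
        moreover have "norm (x - z) < t/4" using x by (simp add: dist_norm norm_minus_commute)
        ultimately have "x - t *\<^sub>R y \<in> ball z (2 * t)" using y t by (simp add: dist_norm norm_minus_commute)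
        then show "ennreal (f (x - t *\<^sub>R y)) \<le> (SUP m. ennreal (g m (x - t *\<^sub>R y)))" by (rule gh(4))
      qed
      ultimately have "(\<integral>\<^sup>+y. (SUP m. ennreal (g m (x - t *\<^sub>R y))) \<partial>sphere_measure) = \<infinity>"
        by (simp add: top_unique)
      then have "\<not> (\<exists>B. \<forall>j. \<bar>shell_avg 0 j t h x\<bar> \<le> B)"
        by (rule shell_avg_unbounded[OF t d gh(1-3,6,5,8)])
      then show "x \<in> {x \<in> ball z (t/4). \<not> (\<exists>B. \<forall>j. \<bar>shell_avg 0 j t h x\<bar> \<le> B)}" using x by blast
    qed
    then show ?thesis
      using content_null_unbounded_shell_avg[OF t d p gh(6,7,5) s] content_null_subset by blast
  qed
  \<comment> \<open>Balls of the fixed radius \<open>t/4\<close> about a countable dense set cover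
    the space.\<close>
  obtain D :: "'a set" where D: "countable D" "\<And>X. open X \<Longrightarrow> X \<noteq> {} \<Longrightarrow> \<exists>u\<in>D. u \<in> X"
    using countable_dense_exists by blast
  have "D \<noteq> {}" using D(2)[of UNIV] by auto
  have "content_null s (\<Union>n. infinity_set t f \<inter> ball (from_nat_into D n) (t/4))"
    by (intro content_null_UN loc)
  moreover have "infinity_set t f \<subseteq> (\<Union>n. infinity_set t f \<inter> ball (from_nat_into D n) (t/4))"
  proof
    fix x assume x: "x \<in> infinity_set t f"
    obtain u where u: "u \<in> D" "u \<in> ball x (t/4)" using D(2)[of "ball x (t/4)"] t by auto
    then obtain n where "u = from_nat_into D n" using from_nat_into_surj[OF D(1)] by metis
    then show "x \<in> (\<Union>n. infinity_set t f \<inter> ball (from_nat_into D n) (t/4))"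
      using x u by (auto simp: dist_commute)
  qed
  ultimately show ?thesis by (rule content_null_subset)
qed

lemma hausdorff_dim_le:
  assumes "0 \<le> r" "\<And>s. s > r \<Longrightarrow> content_null s A"
  shows "hausdorff_dim A \<le> ereal r"
proof (rule ereal_le_epsilon2)
  fix e :: real assume "e > 0"
  then have "hausdorff_outer_measure (r + e) A = 0"
    using assms by (intro hausdorff_outer_measure_eq_0) auto
  then have "hausdorff_dim A \<le> ereal (r + e)"
    unfolding hausdorff_dim_def using assms(1) \<open>e > 0\<close> by (intro Inf_lower) auto
  then show "hausdorff_dim A \<le> ereal r + ereal e" by simp
qed

theorem corollary4p4:
  fixes f :: "real ^ 'n \<Rightarrow> real" and t :: real and p :: ereal
  assumes "CARD('n) \<ge> 2"
    and "t > 0"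
    and "in_Lp p lebesgue f"
  shows "(1 \<le> p \<and> p \<le> 2 \<longrightarrow>
            hausdorff_dim (infinity_set t f)
              \<le> ereal (real CARD('n)) - (p - 1) * (ereal (real CARD('n)) - 1))
         \<and> (p \<ge> 2 \<longrightarrow> hausdorff_dim (infinity_set t f) \<le> 1)"
proof -
  have dim: "DIM(real ^ 'n) = CARD('n)" by simp
  have d: "DIM(real ^ 'n) \<ge> 2" using assms(1) by simp
  have f: "f \<in> borel_measurable lebesgue" using assms(3) by (simp add: in_Lp_def)
  \<comment> \<open>Asking for local integrability alone lets one statement serve both halves: for
    \<open>p \<ge> 2\<close> it is used with \<open>q = 2\<close>, where the bound is
    \<open>d - (d - 1) = 1\<close>.\<close>
  have main: "hausdorff_dim (infinity_set t f) \<le> ereal (real CARD('n) - (q - 1) * (real CARD('n) - 1))"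
    if q: "1 \<le> q" "q \<le> 2"
      and fin: "\<And>z r. (\<integral>\<^sup>+x. ennreal (\<bar>f x\<bar> powr q) * indicator (ball z r) x \<partial>lebesgue) < \<infinity>" for q
  proof (rule hausdorff_dim_le)
    have "(q - 1) * (real CARD('n) - 1) \<le> 1 * (real CARD('n) - 1)"
      using q assms(1) by (intro mult_right_mono) auto
    then show "0 \<le> real CARD('n) - (q - 1) * (real CARD('n) - 1)" by simp
    fix s assume "s > real CARD('n) - (q - 1) * (real CARD('n) - 1)"
    then show "content_null s (infinity_set t f)"
      using content_null_infinity_set[OF assms(2) d q f fin] by (simp only: dim)
  qed
  show ?thesis
  proof (intro conjI impI)
    assume "1 \<le> p \<and> p \<le> 2"
    then obtain q where q: "p = ereal q" "1 \<le> q" "q \<le> 2"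
      by (cases p) (auto simp: one_ereal_def numeral_eq_ereal)
    have "(\<integral>\<^sup>+x. ennreal (\<bar>f x\<bar> powr q) * indicator (ball z r) x \<partial>lebesgue) < \<infinity>" for z r
    proof -
      have "(\<integral>\<^sup>+x. ennreal (\<bar>f x\<bar> powr q) * indicator (ball z r) x \<partial>lebesgue) \<le>
         (\<integral>\<^sup>+x. ennreal (\<bar>f x\<bar> powr q) \<partial>lebesgue)"
        by (intro nn_integral_mono) (auto simp: indicator_def)
      also have "\<dots> < \<infinity>" using assms(3) q by (simp add: in_Lp_def)
      finally show ?thesis .
    qed
    from main[OF q(2,3) this]
    show "hausdorff_dim (infinity_set t f) \<le> ereal (real CARD('n)) - (p - 1) * (ereal (real CARD('n)) - 1)"
      by (simp add: q(1) one_ereal_def)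
  next
    assume p: "p \<ge> 2"
    have "(\<integral>\<^sup>+x. ennreal (\<bar>f x\<bar> powr 2) * indicator (ball z r) x \<partial>lebesgue) < \<infinity>" for z r
    proof -
      have bm: "ball z r \<in> sets lebesgue" by (rule fmeasurableD[OF lmeasurable_ball])
      have ball: "emeasure lebesgue (ball z r) < \<infinity>"
        using emeasure_lborel_ball_finite[of z r] by (simp add: emeasure_completion)
      \<comment> \<open>For \<open>p = \<infinity>\<close> membership means an essential bound; any
        other \<open>p \<ge> 2\<close> is a real exponent.\<close>
      have "(\<exists>C. AE x in lebesgue. \<bar>f x\<bar> \<le> C) \<or> (\<exists>q\<ge>2. (\<integral>\<^sup>+x. ennreal (\<bar>f x\<bar> powr q) \<partial>lebesgue) < \<infinity>)"
        using assms(3) p by (cases p) (auto simp: in_Lp_def numeral_eq_ereal)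
      then show ?thesis
      proof (elim disjE exE conjE)
        fix C assume C: "AE x in lebesgue. \<bar>f x\<bar> \<le> C"
        have "(\<integral>\<^sup>+x. ennreal (\<bar>f x\<bar> powr 2) * indicator (ball z r) x \<partial>lebesgue) \<le>
           (\<integral>\<^sup>+x. ennreal (C powr 2) * indicator (ball z r) x \<partial>lebesgue)"
        proof (rule nn_integral_mono_AE)
          show "AE x in lebesgue. ennreal (\<bar>f x\<bar> powr 2) * indicator (ball z r) x \<le> ennreal (C powr 2) * indicator (ball z r) x"
            using C by eventually_elim (intro mult_right_mono ennreal_leI powr_mono2, auto)
        qed
        also have "\<dots> = ennreal (C powr 2) * emeasure lebesgue (ball z r)"
          by (rule nn_integral_cmult_indicator[OF bm])
        also have "\<dots> < \<infinity>" using ball by (simp add: ennreal_mult_less_top)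
        finally show ?thesis .
      next
        fix q :: real assume q: "q \<ge> 2" "(\<integral>\<^sup>+x. ennreal (\<bar>f x\<bar> powr q) \<partial>lebesgue) < \<infinity>"
        have "(\<integral>\<^sup>+x. ennreal (\<bar>f x\<bar> powr 2) * indicator (ball z r) x \<partial>lebesgue) \<le>
           (\<integral>\<^sup>+x. ennreal (\<bar>f x\<bar> powr q) + indicator (ball z r) x \<partial>lebesgue)"
        proof (rule nn_integral_mono)
          fix x
          have "\<bar>f x\<bar> powr 2 \<le> \<bar>f x\<bar> powr q + 1"
          proof (cases "\<bar>f x\<bar> \<le> 1")
            case True
            then have "\<bar>f x\<bar> powr 2 \<le> 1" by (intro powr_le1) auto
            then show ?thesis by (simp add: add_increasing)
          next
            case False
            then have "\<bar>f x\<bar> powr 2 \<le> \<bar>f x\<bar> powr q" using q(1) by (intro powr_mono) auto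
            then show ?thesis by simp
          qed
          then have "ennreal (\<bar>f x\<bar> powr 2) \<le> ennreal (\<bar>f x\<bar> powr q) + 1"
            using ennreal_leI by fastforce
          then show "ennreal (\<bar>f x\<bar> powr 2) * indicator (ball z r) x \<le> ennreal (\<bar>f x\<bar> powr q) + indicator (ball z r) x"
            by (auto simp: indicator_def)
        qed
        also have "\<dots> = (\<integral>\<^sup>+x. ennreal (\<bar>f x\<bar> powr q) \<partial>lebesgue) + emeasure lebesgue (ball z r)"
          using f bm by (subst nn_integral_add[OF _ borel_measurable_indicator[OF bm]]) auto
        also have "\<dots> < \<infinity>" using ball q(2) by simp
        finally show ?thesis .
      qed
    qed
    from main[OF _ _ this] show "hausdorff_dim (infinity_set t f) \<le> 1"
      by (simp add: one_ereal_def)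
  qed
qed

end
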